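(* Let $(M^n,g)$ be a closed $n$-dimensional Riemannian manifold with a smooth vector field $X$ such that $(M,g,X)$ has positive weighted sectional curvature. Assume $N_1$ and $N_2$ are closed, totally geodesic submanifolds of $M$ such that $X$ is tangent to $N_i$ for $i\in\{1,2\}$. If $\dim(N_1)+\dim(N_2)\ge n$, then $N_1$ and $N_2$ intersect.
   Context: Manifolds $M$ are connected; closed means compact without boundary; submanifolds are nonempty. "$X$ is tangent to $N$" means $X_p\in T_pN$ for all $p\in N$. Let $(M,g)$ be a Riemannian manifold and $X$ a smooth vector field on $M$. For an orthonormal pair $(U,V)$ in $T_pM$, let $\sec(U,V)$ be the sectional curvature of the plane spanned by $U,V$, and set $$\sec_X^V(U)=\sec(U,V)+\tfrac12 (L_Xg)(V,V).$$ If $X=\nabla f$ for a smooth function $f$, set $$\overline{\sec}_f^V(U)=\sec(U,V)+\mathrm{Hess}\, f(V,V)+df(V)^2.$$ Write $\sec_X>0$ (resp. $\overline{\sec}_f>0$) if $\sec_X^V(U)>0$ (resp. $\overline{\sec}_f^V(U)>0$) for every point $p$ and every orthonormal pair $(U,V)$ in $T_pM$. The triple $(M,g,X)$ has positive weighted sectional curvature if either $\sec_X>0$, or $X=\nabla f$ and $\overline{\sec}_f>0$ for some smooth function $f$. *)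

theory Defs
  imports "HOL-Analysis.Analysis"
begin

section \<open>Smooth maps between open subsets of Euclidean spaces\<close>

abbreviation D :: "('e::real_normed_vector \<Rightarrow> 'f::real_normed_vector) \<Rightarrow> 'e \<Rightarrow> 'e \<Rightarrow> 'f" where
  "D f x \<equiv> frechet_derivative f (at x)"

text \<open>Only meant for open \<open>S\<close>.\<close>

primrec Ck_on :: "nat \<Rightarrow> 'e::real_normed_vector set \<Rightarrow> ('e \<Rightarrow> 'f::real_normed_vector) \<Rightarrow> bool" where
  "Ck_on 0 S f \<longleftrightarrow> continuous_on S f"
| "Ck_on (Suc k) S f \<longleftrightarrow> (\<forall>x\<in>S. f differentiable (at x)) \<and> (\<forall>v. Ck_on k S (\<lambda>x. D f x v))"

definition smooth_on :: "'e::real_normed_vector set \<Rightarrow> ('e \<Rightarrow> 'f::real_normed_vector) \<Rightarrow> bool" where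
  "smooth_on S f \<longleftrightarrow> (\<forall>k. Ck_on k S f)"


section \<open>Smooth manifolds\<close>

text \<open>
  The manifold is the whole type \<open>'m\<close>, its dimension is \<open>DIM('e)\<close>.
  A chart is a pair of its domain and its coordinate map; the values of the coordinate map outside
  of the domain are irrelevant.
\<close>

type_synonym ('m, 'e) chart = "'m set \<times> ('m \<Rightarrow> 'e)"

abbreviation cdom :: "('m, 'e) chart \<Rightarrow> 'm set" where
  "cdom c \<equiv> fst c"

abbreviation coord :: "('m, 'e) chart \<Rightarrow> 'm \<Rightarrow> 'e" where
  "coord c \<equiv> snd c"

abbreviation cimg :: "('m, 'e) chart \<Rightarrow> 'e set" where
  "cimg c \<equiv> coord c ` cdom c"

abbreviation param :: "('m, 'e) chart \<Rightarrow> 'e \<Rightarrow> 'm" where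
  "param c \<equiv> inv_into (cdom c) (coord c)"

definition is_chart :: "('m::topological_space, 'e::euclidean_space) chart \<Rightarrow> bool" where
  "is_chart c \<longleftrightarrow> open (cdom c) \<and> open (cimg c) \<and> homeomorphism (cdom c) (cimg c) (coord c) (param c)"

definition transition :: "('m, 'e) chart \<Rightarrow> ('m, 'e) chart \<Rightarrow> 'e \<Rightarrow> 'e" where
  "transition c d = (\<lambda>x. coord d (param c x))"

definition compatible :: "('m, 'e::euclidean_space) chart \<Rightarrow> ('m, 'e) chart \<Rightarrow> bool" where
  "compatible c d \<longleftrightarrow>
     smooth_on (coord c ` (cdom c \<inter> cdom d)) (transition c d) \<and>
     smooth_on (coord d ` (cdom c \<inter> cdom d)) (transition d c)"

text \<open>A smooth structure is a maximal smooth atlas.\<close>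

definition smooth_structure :: "('m::topological_space, 'e::euclidean_space) chart set \<Rightarrow> bool" where
  "smooth_structure A \<longleftrightarrow>
     (\<forall>c\<in>A. is_chart c) \<and>
     (\<Union>c\<in>A. cdom c) = UNIV \<and>
     (\<forall>c\<in>A. \<forall>d\<in>A. compatible c d) \<and>
     (\<forall>c. is_chart c \<and> (\<forall>d\<in>A. compatible c d) \<longrightarrow> c \<in> A)"

definition smooth_function :: "('m, 'e::euclidean_space) chart set \<Rightarrow> ('m \<Rightarrow> real) \<Rightarrow> bool" where
  "smooth_function A f \<longleftrightarrow> (\<forall>c\<in>A. smooth_on (cimg c) (\<lambda>x. f (param c x)))"


section \<open>Tangent vectors and vector fields\<close>

text \<open>
  A tangent vector at \<open>p\<close> is the family of its components in all charts around \<open>p\<close>, which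
  are related by the derivatives of the transition maps.  At charts which do not contain \<open>p\<close> the
  family is zero, so that equality of functions is equality of tangent vectors.
\<close>

type_synonym ('m, 'e) tvec = "('m, 'e) chart \<Rightarrow> 'e"

definition tangent_space ::
    "('m, 'e::euclidean_space) chart set \<Rightarrow> 'm \<Rightarrow> ('m, 'e) tvec set" where
  "tangent_space A p =
     {v. (\<forall>c\<in>A. \<forall>d\<in>A. p \<in> cdom c \<inter> cdom d \<longrightarrow> v d = D (transition c d) (coord c p) (v c)) \<and>
         (\<forall>c. \<not> (c \<in> A \<and> p \<in> cdom c) \<longrightarrow> v c = 0)}"

text \<open>The tangent vector at \<open>p\<close> whose components in the chart \<open>c\<close> are \<open>a\<close>.\<close>

definition tvec_of ::
    "('m, 'e::euclidean_space) chart set \<Rightarrow> ('m, 'e) chart \<Rightarrow> 'm \<Rightarrow> 'e \<Rightarrow> ('m, 'e) tvec" where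
  "tvec_of A c p a =
     (\<lambda>d. if d \<in> A \<and> p \<in> cdom d then D (transition c d) (coord c p) a else 0)"

definition field_rep ::
    "('m \<Rightarrow> ('m, 'e) tvec) \<Rightarrow> ('m, 'e) chart \<Rightarrow> 'e \<Rightarrow> 'e" where
  "field_rep X c = (\<lambda>x. X (param c x) c)"

definition smooth_vector_field_on ::
    "('m, 'e::euclidean_space) chart set \<Rightarrow> 'm set \<Rightarrow> ('m \<Rightarrow> ('m, 'e) tvec) \<Rightarrow> bool" where
  "smooth_vector_field_on A W X \<longleftrightarrow>
     (\<forall>p\<in>W. X p \<in> tangent_space A p) \<and>
     (\<forall>c\<in>A. smooth_on (coord c ` (cdom c \<inter> W)) (field_rep X c))"

text \<open>
  Differential operators are evaluated at \<open>p\<close> in the following arbitrary chart around \<open>p\<close>;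
  their values do not depend on this choice.
\<close>

definition chart_at :: "('m, 'e) chart set \<Rightarrow> 'm \<Rightarrow> ('m, 'e) chart" where
  "chart_at A p = (SOME c. c \<in> A \<and> p \<in> cdom c)"

definition differential ::
    "('m, 'e::euclidean_space) chart set \<Rightarrow> ('m \<Rightarrow> real) \<Rightarrow> 'm \<Rightarrow> ('m, 'e) tvec \<Rightarrow> real" where
  "differential A f p v =
     (let c = chart_at A p in D (\<lambda>x. f (param c x)) (coord c p) (v c))"


section \<open>Riemannian metrics\<close>

text \<open>The matrix (as a bilinear form) of \<open>g\<close> in the chart \<open>c\<close>.\<close>

definition metric_rep ::
    "('m, 'e::euclidean_space) chart set \<Rightarrow> ('m \<Rightarrow> ('m, 'e) tvec \<Rightarrow> ('m, 'e) tvec \<Rightarrow> real)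
      \<Rightarrow> ('m, 'e) chart \<Rightarrow> 'e \<Rightarrow> 'e \<Rightarrow> 'e \<Rightarrow> real" where
  "metric_rep A g c x a b =
     g (param c x) (tvec_of A c (param c x) a) (tvec_of A c (param c x) b)"

definition riemannian_metric ::
    "('m, 'e::euclidean_space) chart set \<Rightarrow> ('m \<Rightarrow> ('m, 'e) tvec \<Rightarrow> ('m, 'e) tvec \<Rightarrow> real) \<Rightarrow> bool" where
  "riemannian_metric A g \<longleftrightarrow>
     (\<forall>p. \<forall>u\<in>tangent_space A p. \<forall>v\<in>tangent_space A p.
        g p u v = g p v u \<and>
        (\<forall>w\<in>tangent_space A p. g p (\<lambda>c. u c + w c) v = g p u v + g p w v) \<and>
        (\<forall>r. g p (\<lambda>c. r *\<^sub>R u c) v = r * g p u v) \<and>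
        (u \<noteq> (\<lambda>c. 0) \<longrightarrow> g p u u > 0)) \<and>
     (\<forall>c\<in>A. \<forall>a b. smooth_on (cimg c) (\<lambda>x. metric_rep A g c x a b))"

text \<open>
  In the following four definitions \<open>G\<close> is a metric on an open subset of \<open>'e\<close>, and vectors
  \<open>a\<close>, \<open>b\<close>, \<open>w\<close> are identified with constant vector fields.  Since these commute, the
  bracket terms in the Koszul formula and in the curvature tensor vanish.
\<close>

definition christoffel :: "('e::euclidean_space \<Rightarrow> 'e \<Rightarrow> 'e \<Rightarrow> real) \<Rightarrow> 'e \<Rightarrow> 'e \<Rightarrow> 'e \<Rightarrow> 'e" where
  "christoffel G x a b =
     (THE z. \<forall>w. 2 * G x z w =
        D (\<lambda>y. G y b w) x a + D (\<lambda>y. G y a w) x b - D (\<lambda>y. G y a b) x w)"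

definition nabla_rep ::
    "('e::euclidean_space \<Rightarrow> 'e \<Rightarrow> 'e \<Rightarrow> real) \<Rightarrow> 'e \<Rightarrow> ('e \<Rightarrow> 'e) \<Rightarrow> 'e \<Rightarrow> 'e" where
  "nabla_rep G a Y x = D Y x a + christoffel G x a (Y x)"

definition curvature_rep ::
    "('e::euclidean_space \<Rightarrow> 'e \<Rightarrow> 'e \<Rightarrow> real) \<Rightarrow> 'e \<Rightarrow> 'e \<Rightarrow> 'e \<Rightarrow> 'e \<Rightarrow> 'e" where
  "curvature_rep G x a b w =
     nabla_rep G a (nabla_rep G b (\<lambda>_. w)) x - nabla_rep G b (nabla_rep G a (\<lambda>_. w)) x"

definition sec_rep :: "('e::euclidean_space \<Rightarrow> 'e \<Rightarrow> 'e \<Rightarrow> real) \<Rightarrow> 'e \<Rightarrow> 'e \<Rightarrow> 'e \<Rightarrow> real" where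
  "sec_rep G x a b =
     G x (curvature_rep G x a b b) a / (G x a a * G x b b - (G x a b)\<^sup>2)"

definition sectional_curvature ::
    "('m, 'e::euclidean_space) chart set \<Rightarrow> ('m \<Rightarrow> ('m, 'e) tvec \<Rightarrow> ('m, 'e) tvec \<Rightarrow> real)
      \<Rightarrow> 'm \<Rightarrow> ('m, 'e) tvec \<Rightarrow> ('m, 'e) tvec \<Rightarrow> real" where
  "sectional_curvature A g p u v =
     (let c = chart_at A p in sec_rep (metric_rep A g c) (coord c p) (u c) (v c))"

text \<open>The Levi-Civita covariant derivative of \<open>Y\<close> in direction \<open>v\<close>, a vector at \<open>p\<close>.\<close>

definition nabla ::
    "('m, 'e::euclidean_space) chart set \<Rightarrow> ('m \<Rightarrow> ('m, 'e) tvec \<Rightarrow> ('m, 'e) tvec \<Rightarrow> real)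
      \<Rightarrow> 'm \<Rightarrow> ('m, 'e) tvec \<Rightarrow> ('m \<Rightarrow> ('m, 'e) tvec) \<Rightarrow> ('m, 'e) tvec" where
  "nabla A g p v Y =
     (let c = chart_at A p
      in tvec_of A c p (nabla_rep (metric_rep A g c) (v c) (field_rep Y c) (coord c p)))"

text \<open>
  \<open>(L\<^sub>X g)(u, v) = X (g(u, v)) - g([X, u], v) - g(u, [X, v])\<close> for the constant extensions of
  \<open>u\<close> and \<open>v\<close> in the chart, for which \<open>[X, u]\<close> is minus the derivative of \<open>X\<close> along \<open>u\<close>.
\<close>

definition lie_derivative_metric ::
    "('m, 'e::euclidean_space) chart set \<Rightarrow> ('m \<Rightarrow> ('m, 'e) tvec \<Rightarrow> ('m, 'e) tvec \<Rightarrow> real)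
      \<Rightarrow> ('m \<Rightarrow> ('m, 'e) tvec) \<Rightarrow> 'm \<Rightarrow> ('m, 'e) tvec \<Rightarrow> ('m, 'e) tvec \<Rightarrow> real" where
  "lie_derivative_metric A g X p u v =
     (let c = chart_at A p; G = metric_rep A g c; x = coord c p; Z = field_rep X c
      in D (\<lambda>y. G y (u c) (v c)) x (Z x) + G x (D Z x (u c)) (v c) + G x (u c) (D Z x (v c)))"

text \<open>\<open>Hess f (u, v) = u (v f) - (\<nabla>\<^sub>u v) f\<close>, again for constant extensions.\<close>

definition hessian ::
    "('m, 'e::euclidean_space) chart set \<Rightarrow> ('m \<Rightarrow> ('m, 'e) tvec \<Rightarrow> ('m, 'e) tvec \<Rightarrow> real)
      \<Rightarrow> ('m \<Rightarrow> real) \<Rightarrow> 'm \<Rightarrow> ('m, 'e) tvec \<Rightarrow> ('m, 'e) tvec \<Rightarrow> real" where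
  "hessian A g f p u v =
     (let c = chart_at A p; F = (\<lambda>y. f (param c y)); x = coord c p
      in D (\<lambda>y. D F y (v c)) x (u c) - D F x (nabla_rep (metric_rep A g c) (u c) (\<lambda>_. v c) x))"

definition is_gradient ::
    "('m, 'e::euclidean_space) chart set \<Rightarrow> ('m \<Rightarrow> ('m, 'e) tvec \<Rightarrow> ('m, 'e) tvec \<Rightarrow> real)
      \<Rightarrow> ('m \<Rightarrow> real) \<Rightarrow> ('m \<Rightarrow> ('m, 'e) tvec) \<Rightarrow> bool" where
  "is_gradient A g f X \<longleftrightarrow>
     (\<forall>p. X p \<in> tangent_space A p \<and> (\<forall>v\<in>tangent_space A p. g p (X p) v = differential A f p v))"


section \<open>Weighted sectional curvature\<close>

definition weighted_sec ::
    "('m, 'e::euclidean_space) chart set \<Rightarrow> ('m \<Rightarrow> ('m, 'e) tvec \<Rightarrow> ('m, 'e) tvec \<Rightarrow> real)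
      \<Rightarrow> ('m \<Rightarrow> ('m, 'e) tvec) \<Rightarrow> 'm \<Rightarrow> ('m, 'e) tvec \<Rightarrow> ('m, 'e) tvec \<Rightarrow> real" where
  "weighted_sec A g X p V U =
     sectional_curvature A g p U V + 1 / 2 * lie_derivative_metric A g X p V V"

definition strongly_weighted_sec ::
    "('m, 'e::euclidean_space) chart set \<Rightarrow> ('m \<Rightarrow> ('m, 'e) tvec \<Rightarrow> ('m, 'e) tvec \<Rightarrow> real)
      \<Rightarrow> ('m \<Rightarrow> real) \<Rightarrow> 'm \<Rightarrow> ('m, 'e) tvec \<Rightarrow> ('m, 'e) tvec \<Rightarrow> real" where
  "strongly_weighted_sec A g f p V U =
     sectional_curvature A g p U V + hessian A g f p V V + (differential A f p V)\<^sup>2"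

definition orthonormal_pair ::
    "('m, 'e::euclidean_space) chart set \<Rightarrow> ('m \<Rightarrow> ('m, 'e) tvec \<Rightarrow> ('m, 'e) tvec \<Rightarrow> real)
      \<Rightarrow> 'm \<Rightarrow> ('m, 'e) tvec \<Rightarrow> ('m, 'e) tvec \<Rightarrow> bool" where
  "orthonormal_pair A g p U V \<longleftrightarrow>
     U \<in> tangent_space A p \<and> V \<in> tangent_space A p \<and> g p U U = 1 \<and> g p V V = 1 \<and> g p U V = 0"

definition positive_weighted_sectional_curvature ::
    "('m, 'e::euclidean_space) chart set \<Rightarrow> ('m \<Rightarrow> ('m, 'e) tvec \<Rightarrow> ('m, 'e) tvec \<Rightarrow> real)
      \<Rightarrow> ('m \<Rightarrow> ('m, 'e) tvec) \<Rightarrow> bool" where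
  "positive_weighted_sectional_curvature A g X \<longleftrightarrow>
     (\<forall>p U V. orthonormal_pair A g p U V \<longrightarrow> weighted_sec A g X p V U > 0) \<or>
     (\<exists>f. smooth_function A f \<and> is_gradient A g f X \<and>
        (\<forall>p U V. orthonormal_pair A g p U V \<longrightarrow> strongly_weighted_sec A g f p V U > 0))"


section \<open>Submanifolds\<close>

definition slice_chart ::
    "('m, 'e::euclidean_space) chart set \<Rightarrow> 'm set \<Rightarrow> ('m, 'e) chart \<Rightarrow> 'e set \<Rightarrow> bool" where
  "slice_chart A N c S \<longleftrightarrow>
     c \<in> A \<and> subspace S \<and> coord c ` (cdom c \<inter> N) = cimg c \<inter> S"

text \<open>
  Closed (that is, compact and without boundary) embedded submanifolds of dimension \<open>k\<close>; they are
  nonempty, but need not be connected.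
\<close>

definition closed_submanifold ::
    "('m::topological_space, 'e::euclidean_space) chart set \<Rightarrow> 'm set \<Rightarrow> nat \<Rightarrow> bool" where
  "closed_submanifold A N k \<longleftrightarrow>
     N \<noteq> {} \<and> compact N \<and> (\<forall>p\<in>N. \<exists>c S. slice_chart A N c S \<and> dim S = k \<and> p \<in> cdom c)"

definition submanifold_tangent_space ::
    "('m, 'e::euclidean_space) chart set \<Rightarrow> 'm set \<Rightarrow> 'm \<Rightarrow> ('m, 'e) tvec set" where
  "submanifold_tangent_space A N p =
     {v \<in> tangent_space A p. \<exists>c S. slice_chart A N c S \<and> p \<in> cdom c \<and> v c \<in> S}"

definition tangent_on ::
    "('m, 'e::euclidean_space) chart set \<Rightarrow> 'm set \<Rightarrow> ('m \<Rightarrow> ('m, 'e) tvec) \<Rightarrow> bool" where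
  "tangent_on A N X \<longleftrightarrow> (\<forall>p\<in>N. X p \<in> submanifold_tangent_space A N p)"

text \<open>
  The second fundamental form of \<open>N\<close> vanishes: the normal part of \<open>\<nabla>\<^sub>v Y\<close> is zero for each
  \<open>v\<close> tangent to \<open>N\<close> and each local vector field \<open>Y\<close> on the ambient manifold extending a
  vector field of \<open>N\<close>.
\<close>

definition totally_geodesic ::
    "('m::topological_space, 'e::euclidean_space) chart set
      \<Rightarrow> ('m \<Rightarrow> ('m, 'e) tvec \<Rightarrow> ('m, 'e) tvec \<Rightarrow> real) \<Rightarrow> 'm set \<Rightarrow> bool" where
  "totally_geodesic A g N \<longleftrightarrow>
     (\<forall>p\<in>N. \<forall>v\<in>submanifold_tangent_space A N p. \<forall>W Y.
        open W \<and> p \<in> W \<and> smooth_vector_field_on A W Y \<and>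
        (\<forall>q\<in>N \<inter> W. Y q \<in> submanifold_tangent_space A N q)
        \<longrightarrow> nabla A g p v Y \<in> submanifold_tangent_space A N p)"

end

theory Submission
  imports Defs
begin

text \<open>
  Suppose that \<open>N\<^sub>1\<close> and \<open>N\<^sub>2\<close> are disjoint, and take a shortest geodesic \<open>\<gamma>\<close> from \<open>N\<^sub>1\<close> to
  \<open>N\<^sub>2\<close>, which is perpendicular to both. Since the dimensions add up to at least \<open>n\<close>, there is a
  parallel unit field \<open>U\<close> along \<open>\<gamma>\<close>, normal to \<open>\<gamma>\<close>, which is tangent to \<open>N\<^sub>1\<close> at the start and to
  \<open>N\<^sub>2\<close> at the end. The second variation of the energy in the direction \<open>\<phi> U\<close> is the integral of
  \<open>\<phi>'\<^sup>2 - \<phi>\<^sup>2 sec(U, \<gamma>') |\<gamma>'|\<^sup>2\<close>; the boundary terms vanish as the \<open>N\<^sub>i\<close> are totally geodesic.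
  Along \<open>\<gamma>\<close> the term \<open>1/2 (L\<^sub>X g)(\<gamma>', \<gamma>')\<close> is the derivative of \<open>g(X, \<gamma>')\<close>, which is zero at both
  ends. Hence the second variation is negative for \<open>\<phi> = 1\<close> if \<open>sec\<^sub>X > 0\<close>. In the gradient case the
  same holds for \<open>\<phi> = e\<^sup>f\<close>, as then \<open>\<phi>'\<^sup>2 + \<phi>\<^sup>2 (f'' + f'\<^sup>2) = (e\<^sup>2\<^sup>f f')'\<close>. This contradicts minimality.

  No completeness theorem is needed for the existence of \<open>\<gamma>\<close>: a chain of \<open>m\<close> curves, each inside one
  chart, can be subdivided so that all pieces have small energy, and a limit of such chains with
  almost minimal total energy is replaced piecewise by short geodesics, which exist by the contraction
  principle and are minimal by a direct estimate.
\<close>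

section \<open>Calculus of smooth maps\<close>

text \<open>The minimiser is a chain of pieces lying in different charts, and no single chart sees
  all of it; this obstacle shapes the later parts. Energy is used in place of length: it is
  differentiable along every variation, and cutting each piece into \<open>k\<close> equal parts,
  each rescaled to the unit interval, divides the total by \<open>k\<close>. A variation moves every
  joint along a straight line of a fixed chart, at the two ends a slice chart, so that the varied
  chains still run from \<open>N\<^sub>1\<close> to \<open>N\<^sub>2\<close>. Such a line is in
  general no geodesic, so every piece contributes boundary terms with its covariant acceleration. At
  an inner joint the two neighbouring pieces see the same line and, since a minimiser has no corner,
  the same velocity, so these terms telescope; at the ends the acceleration is tangent to the
  submanifold and hence orthogonal to the velocity. The weight e^f is suggested by f'' + f'^2, which
  is \<phi>'' / \<phi> for \<phi> = e^f: then \<phi>'^2 + \<phi> \<phi>'' is the derivative of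
  \<phi> \<phi>'.\<close>

definition dB :: "('e::real_normed_vector \<Rightarrow> 'f::real_normed_vector) \<Rightarrow> 'e \<Rightarrow> 'e \<Rightarrow>\<^sub>L 'f" where
  "dB f x = Blinfun (D f x)"

lemma dB_apply: "f differentiable (at x) \<Longrightarrow> blinfun_apply (dB f x) = D f x"
  unfolding dB_def
  by (intro bounded_linear_Blinfun_apply) (metis frechet_derivative_works has_derivative_bounded_linear)

lemma has_derivative_dB:
  "f differentiable (at x) \<Longrightarrow> (f has_derivative blinfun_apply (dB f x)) (at x)"
  by (simp add: dB_apply frechet_derivative_works[symmetric])

lemma D_eqI: "(f has_derivative f') (at x) \<Longrightarrow> D f x = f'"
  by (rule frechet_derivative_at[symmetric])

lemma D_cong_open:
  assumes "open S" "x \<in> S" "\<And>y. y \<in> S \<Longrightarrow> f y = h y"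
  shows "D f x = D h x"
proof -
  have "(f has_derivative f') (at x) \<longleftrightarrow> (h has_derivative f') (at x)" for f'
    using has_derivative_transform_within_open[OF _ assms(1,2)] assms(3) by metis
  then show ?thesis by (simp add: frechet_derivative_def)
qed

lemma differentiable_cong_open:
  assumes "open S" "x \<in> S" "\<And>y. y \<in> S \<Longrightarrow> f y = h y"
  shows "f differentiable (at x) \<longleftrightarrow> h differentiable (at x)"
  unfolding differentiable_def
  using has_derivative_transform_within_open[OF _ assms(1,2)] assms(3) by metis

lemma Ck_on_cong:
  assumes "open S" "\<And>y. y \<in> S \<Longrightarrow> f y = h y"
  shows "Ck_on k S f \<longleftrightarrow> Ck_on k S h"
  using assms(2)
proof (induction k arbitrary: f h)
  case 0
  then show ?case by (auto intro: continuous_on_cong)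
next
  case (Suc k)
  have "Ck_on k S (\<lambda>x. D f x v) \<longleftrightarrow> Ck_on k S (\<lambda>x. D h x v)" for v
    by (rule Suc.IH) (metis D_cong_open[OF assms(1)] Suc.prems)
  then show ?case
    using differentiable_cong_open[OF assms(1) _ Suc.prems] by auto
qed

lemma smooth_on_cong:
  "open S \<Longrightarrow> (\<And>y. y \<in> S \<Longrightarrow> f y = h y) \<Longrightarrow> smooth_on S f \<longleftrightarrow> smooth_on S h"
  unfolding smooth_on_def using Ck_on_cong by blast

lemma Ck_on_const: "Ck_on k S (\<lambda>x. c)"
  by (induction k arbitrary: c) (auto simp: frechet_derivative_const)

lemma Ck_on_add:
  assumes "open S"
  shows "Ck_on k S f \<Longrightarrow> Ck_on k S h \<Longrightarrow> Ck_on k S (\<lambda>x. f x + h x)"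
proof (induction k arbitrary: f h)
  case 0
  then show ?case by (simp add: continuous_on_add)
next
  case (Suc k)
  have d: "((\<lambda>x. f x + h x) has_derivative (\<lambda>v. D f x v + D h x v)) (at x)" if "x \<in> S" for x
    using that Suc.prems by (auto intro!: has_derivative_add simp: frechet_derivative_works)
  then have "D (\<lambda>x. f x + h x) x v = D f x v + D h x v" if "x \<in> S" for x v
    using D_eqI[OF d[OF that]] by simp
  then have "Ck_on k S (\<lambda>x. D (\<lambda>x. f x + h x) x v)" for v
    using Suc.IH[of "\<lambda>x. D f x v" "\<lambda>x. D h x v"] Suc.prems
    by (subst Ck_on_cong[OF assms(1)]) auto
  then show ?case using Suc.prems by (simp add: differentiable_add)
qed

lemma Ck_on_linear:
  assumes "open S" "bounded_linear L"
  shows "Ck_on k S f \<Longrightarrow> Ck_on k S (\<lambda>x. L (f x))"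
proof (induction k arbitrary: f)
  case 0
  then show ?case
    using assms(2) by (auto intro: bounded_linear.continuous_on)
next
  case (Suc k)
  have d: "((\<lambda>x. L (f x)) has_derivative (\<lambda>v. L (D f x v))) (at x)" if "x \<in> S" for x
    using that Suc.prems bounded_linear.has_derivative[OF assms(2)]
    by (auto simp: frechet_derivative_works)
  have "D (\<lambda>x. L (f x)) x v = L (D f x v)" if "x \<in> S" for x v
    using D_eqI[OF d[OF that]] by simp
  then have "Ck_on k S (\<lambda>x. D (\<lambda>x. L (f x)) x v)" for v
    using Suc.IH[of "\<lambda>x. D f x v"] Suc.prems
    by (subst Ck_on_cong[OF assms(1)]) auto
  then show ?case using d by (auto simp: differentiable_def)
qed

lemma Ck_on_sum:
  assumes "open S" "finite I" "\<And>i. i \<in> I \<Longrightarrow> Ck_on k S (f i)"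
  shows "Ck_on k S (\<lambda>x. \<Sum>i\<in>I. f i x)"
  using assms(2,3) by (induction I rule: finite_induct) (auto intro: Ck_on_const Ck_on_add[OF assms(1)])

lemma smooth_on_add: "open S \<Longrightarrow> smooth_on S f \<Longrightarrow> smooth_on S h \<Longrightarrow> smooth_on S (\<lambda>x. f x + h x)"
  unfolding smooth_on_def using Ck_on_add by blast

lemma smooth_on_linear: "open S \<Longrightarrow> bounded_linear L \<Longrightarrow> smooth_on S f \<Longrightarrow> smooth_on S (\<lambda>x. L (f x))"
  unfolding smooth_on_def using Ck_on_linear by blast

text \<open>A linear map on a Euclidean space depends linearly on its values on the basis:
  \<open>F x\<close> is a finite sum of the fixed linear maps \<open>L i\<close> applied to
  \<open>F x i\<close>. So regularity may be tested on one vector at a time.\<close>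

lemma Ck_on_blinfunI:
  fixes F :: "'x::real_normed_vector \<Rightarrow> 'a::euclidean_space \<Rightarrow>\<^sub>L 'b::real_normed_vector"
  assumes "open S" "\<And>v. Ck_on k S (\<lambda>x. F x v)"
  shows "Ck_on k S F"
proof -
  define L where "L i y = blinfun_scaleR_left y o\<^sub>L blinfun_inner_left i" for i :: 'a and y :: 'b
  have L: "bounded_linear (L i)" for i
    unfolding L_def
    by (intro bounded_linear_compose[OF bounded_bilinear.bounded_linear_left[OF bounded_bilinear_blinfun_compose]]
        bounded_linear_blinfun_scaleR_left)
  have rep: "F x = (\<Sum>i\<in>Basis. L i (F x i))" for x
  proof (rule blinfun_eqI)
    fix v
    have "F x v = F x (\<Sum>i\<in>Basis. (v \<bullet> i) *\<^sub>R i)" by (simp add: euclidean_representation)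
    also have "\<dots> = (\<Sum>i\<in>Basis. L i (F x i)) v"
      by (simp add: blinfun.bilinear_simps L_def blinfun_inner_left.rep_eq)
    finally show "F x v = (\<Sum>i\<in>Basis. L i (F x i)) v" .
  qed
  define R where "R x = (\<Sum>i\<in>Basis. L i (F x i))" for x
  have "Ck_on k S R"
    unfolding R_def
    by (rule Ck_on_sum[OF assms(1) finite_Basis Ck_on_linear[OF assms(1) L assms(2)]])
  moreover have "F x = R x" for x
    unfolding R_def by (rule rep)
  ultimately show ?thesis using Ck_on_cong[OF assms(1), of F R] by blast
qed

lemma smooth_on_blinfunI:
  fixes F :: "'x::real_normed_vector \<Rightarrow> 'a::euclidean_space \<Rightarrow>\<^sub>L 'b::real_normed_vector"
  assumes "open S" "\<And>v. smooth_on S (\<lambda>x. F x v)"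
  shows "smooth_on S F"
  using assms Ck_on_blinfunI unfolding smooth_on_def by blast

lemma smooth_on_differentiable: "smooth_on S f \<Longrightarrow> x \<in> S \<Longrightarrow> f differentiable (at x)"
  unfolding smooth_on_def using Ck_on.simps(2) by blast

lemma smooth_on_has_derivative:
  "smooth_on S f \<Longrightarrow> x \<in> S \<Longrightarrow> (f has_derivative blinfun_apply (dB f x)) (at x)"
  by (simp add: has_derivative_dB smooth_on_differentiable)

lemma smooth_on_D_eq: "smooth_on S f \<Longrightarrow> x \<in> S \<Longrightarrow> D f x = blinfun_apply (dB f x)"
  by (simp add: dB_apply smooth_on_differentiable)

lemma smooth_on_continuous: "smooth_on S f \<Longrightarrow> continuous_on S f"
  unfolding smooth_on_def using Ck_on.simps(1) by blast

text \<open>\<open>smooth_on\<close> only speaks of derivatives in fixed directions; bundling these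
  into one map with values in bounded linear maps is what allows derivatives to be iterated,
  evaluated and composed.\<close>

lemma smooth_on_dB:
  fixes f :: "'a::euclidean_space \<Rightarrow> 'b::real_normed_vector"
  assumes "open S" "smooth_on S f"
  shows "smooth_on S (dB f)"
proof (rule smooth_on_blinfunI[OF assms(1)])
  fix v
  have "smooth_on S (\<lambda>x. D f x v)"
    using assms(2) unfolding smooth_on_def by (metis Ck_on.simps(2))
  moreover have "dB f x v = D f x v" if "x \<in> S" for x
    using that assms(2) smooth_on_D_eq by metis
  ultimately show "smooth_on S (\<lambda>x. dB f x v)"
    using smooth_on_cong[OF assms(1), of "\<lambda>x. dB f x v" "\<lambda>x. D f x v"] by blast
qed

lemma smooth_on_dB_apply:
  fixes f :: "'a::euclidean_space \<Rightarrow> 'b::real_normed_vector"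
  shows "open S \<Longrightarrow> smooth_on S f \<Longrightarrow> smooth_on S (\<lambda>x. dB f x v)"
  by (rule smooth_on_linear[OF _ blinfun.bounded_linear_left smooth_on_dB])

lemma Ck_on_SucI:
  assumes "open S" "\<And>x. x \<in> S \<Longrightarrow> (f has_derivative f' x) (at x)"
    "\<And>v. Ck_on k S (\<lambda>x. f' x v)"
  shows "Ck_on (Suc k) S f"
proof -
  have "D f x v = f' x v" if "x \<in> S" for x v
    using D_eqI[OF assms(2)[OF that]] by simp
  then have "Ck_on k S (\<lambda>x. D f x v)" for v
    using assms(3) by (subst Ck_on_cong[OF assms(1)]) auto
  then show ?thesis using assms(2) by (auto simp: differentiable_def)
qed

lemma Ck_on_SucD: "Ck_on (Suc k) S f \<Longrightarrow> Ck_on k S f"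
proof (induction k arbitrary: f)
  case 0
  then show ?case
    by (auto intro!: continuous_at_imp_continuous_on differentiable_imp_continuous_within)
next
  case (Suc k)
  then show ?case by (metis Ck_on.simps(2))
qed

lemma Ck_on_bilinear:
  assumes "open S" "bounded_bilinear P"
  shows "Ck_on k S f \<Longrightarrow> Ck_on k S h \<Longrightarrow> Ck_on k S (\<lambda>x. P (f x) (h x))"
proof (induction k arbitrary: f h)
  case 0
  then show ?case
    using assms(2) by (auto intro: bounded_bilinear.continuous_on)
next
  case (Suc k)
  note lower = Suc.prems[THEN Ck_on_SucD]
  show ?case
  proof (rule Ck_on_SucI[OF assms(1)])
    show "((\<lambda>x. P (f x) (h x)) has_derivative (\<lambda>v. P (f x) (D h x v) + P (D f x v) (h x))) (at x)"
      if "x \<in> S" for x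
      using that Suc.prems by (intro bounded_bilinear.FDERIV[OF assms(2)]) (auto simp: frechet_derivative_works)
    show "Ck_on k S (\<lambda>x. P (f x) (D h x v) + P (D f x v) (h x))" for v
      using Suc.IH lower Suc.prems by (intro Ck_on_add assms(1)) auto
  qed
qed

text \<open>The induction keeps \<open>f\<close> fixed and varies \<open>h\<close>: by the chain
  rule the derivative is the product of \<open>dB h\<close> along \<open>f\<close> with the
  derivative of \<open>f\<close>, and each component of \<open>dB h\<close> is again a smooth
  function to which the induction hypothesis applies.\<close>

lemma Ck_on_compose:
  fixes h :: "'b::euclidean_space \<Rightarrow> 'c::real_normed_vector"
  assumes "open S" "open T" "smooth_on S f" "f ` S \<subseteq> T"
  shows "smooth_on T h \<Longrightarrow> Ck_on k S (\<lambda>x. h (f x))"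
proof (induction k arbitrary: h)
  case 0
  then show ?case
    using assms(3,4) by (auto intro: continuous_on_compose2 smooth_on_continuous)
next
  case (Suc k)
  show ?case
  proof (rule Ck_on_SucI[OF assms(1)])
    show "((\<lambda>x. h (f x)) has_derivative (\<lambda>v. dB h (f x) (D f x v))) (at x)" if "x \<in> S" for x
    proof -
      have "(f has_derivative D f x) (at x)"
        using that assms(3) smooth_on_differentiable frechet_derivative_works by blast
      moreover have "(h has_derivative blinfun_apply (dB h (f x))) (at (f x))"
        using that assms(4) smooth_on_has_derivative[OF Suc.prems] by blast
      ultimately show ?thesis by (rule has_derivative_compose)
    qed
    have "Ck_on k S (\<lambda>x. D f x v)" for v
      using assms(3) unfolding smooth_on_def by (metis Ck_on.simps(2))
    moreover have "Ck_on k S (\<lambda>x. dB h (f x))"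
    proof (rule Ck_on_blinfunI[OF assms(1)])
      fix w show "Ck_on k S (\<lambda>x. dB h (f x) w)"
        by (rule Suc.IH[OF smooth_on_dB_apply[OF assms(2) Suc.prems]])
    qed
    ultimately show "Ck_on k S (\<lambda>x. dB h (f x) (D f x v))" for v
      by (intro Ck_on_bilinear[OF assms(1) bounded_bilinear_blinfun_apply])
  qed
qed

lemma smooth_on_compose:
  fixes h :: "'b::euclidean_space \<Rightarrow> 'c::real_normed_vector"
  assumes "open S" "open T" "smooth_on S f" "f ` S \<subseteq> T" "smooth_on T h"
  shows "smooth_on S (\<lambda>x. h (f x))"
  using Ck_on_compose[OF assms] unfolding smooth_on_def by blast

text \<open>The mean value theorem is applied twice to the second difference, to \<open>p\<close>
  along \<open>u\<close> and then to \<open>q\<close> along \<open>v\<close>. Exchanging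
  \<open>u\<close> and \<open>v\<close> leaves the left side unchanged, which yields the symmetry of
  second derivatives.\<close>

lemma mixed_difference_mean_value:
  fixes f :: "'a::euclidean_space \<Rightarrow> real"
  assumes "open S" "smooth_on S f" "h > 0" "cball x (h * (norm u + norm v)) \<subseteq> S"
  shows "\<exists>y\<in>cball x (h * (norm u + norm v)).
    f (x + h *\<^sub>R u + h *\<^sub>R v) - f (x + h *\<^sub>R u) - f (x + h *\<^sub>R v) + f x = h * h * dB (dB f) y v u"
proof -
  have mem: "x + s *\<^sub>R u + t *\<^sub>R v \<in> cball x (h * (norm u + norm v))" if "0 \<le> s" "s \<le> h" "0 \<le> t" "t \<le> h" for s t
  proof -
    have "norm (s *\<^sub>R u + t *\<^sub>R v) \<le> s * norm u + t * norm v"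
      using that norm_triangle_ineq[of "s *\<^sub>R u" "t *\<^sub>R v"] by simp
    also have "\<dots> \<le> h * (norm u + norm v)"
      using that by (simp add: distrib_left add_mono mult_right_mono)
    finally show ?thesis by (simp add: dist_norm algebra_simps norm_minus_commute)
  qed
  have memS: "x + s *\<^sub>R u + t *\<^sub>R v \<in> S" if "0 \<le> s" "s \<le> h" "0 \<le> t" "t \<le> h" for s t
    using mem[OF that] assms(4) by blast
  define p where "p s = f (x + s *\<^sub>R u + h *\<^sub>R v) - f (x + s *\<^sub>R u)" for s
  have dp: "(p has_real_derivative dB f (x + s *\<^sub>R u + h *\<^sub>R v) u - dB f (x + s *\<^sub>R u) u) (at s)"
    if "0 \<le> s" "s \<le> h" for s
  proof -
    have lin: "((\<lambda>s. x + s *\<^sub>R u + c) has_derivative (\<lambda>r. r *\<^sub>R u)) (at s)" for c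
      by (auto intro!: derivative_eq_intros)
    have "((\<lambda>s. f (x + s *\<^sub>R u + h *\<^sub>R v)) has_derivative (\<lambda>r. dB f (x + s *\<^sub>R u + h *\<^sub>R v) (r *\<^sub>R u))) (at s)"
      by (rule has_derivative_compose[OF lin smooth_on_has_derivative[OF assms(2)]])
        (use memS[of s h] that assms(3) in auto)
    moreover have "((\<lambda>s. f (x + s *\<^sub>R u)) has_derivative (\<lambda>r. dB f (x + s *\<^sub>R u) (r *\<^sub>R u))) (at s)"
      using has_derivative_compose[OF lin[of 0, simplified] smooth_on_has_derivative[OF assms(2)]]
        memS[of s 0] that assms(3) by auto
    ultimately have "(p has_derivative (\<lambda>r. dB f (x + s *\<^sub>R u + h *\<^sub>R v) (r *\<^sub>R u) - dB f (x + s *\<^sub>R u) (r *\<^sub>R u))) (at s)"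
      unfolding p_def by (rule has_derivative_diff)
    then show ?thesis
      by (rule has_derivative_imp_has_field_derivative) (simp add: blinfun.bilinear_simps algebra_simps)
  qed
  obtain s where s: "0 < s" "s < h" "p h - p 0 = (h - 0) * (dB f (x + s *\<^sub>R u + h *\<^sub>R v) u - dB f (x + s *\<^sub>R u) u)"
    using MVT2[OF assms(3) dp] by blast
  define q where "q t = dB f (x + s *\<^sub>R u + t *\<^sub>R v) u" for t
  have dq: "(q has_real_derivative dB (dB f) (x + s *\<^sub>R u + t *\<^sub>R v) v u) (at t)" if "0 \<le> t" "t \<le> h" for t
  proof -
    have lin: "((\<lambda>t. x + s *\<^sub>R u + t *\<^sub>R v) has_derivative (\<lambda>r. r *\<^sub>R v)) (at t)"
      by (auto intro!: derivative_eq_intros)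
    have "((\<lambda>t. dB f (x + s *\<^sub>R u + t *\<^sub>R v)) has_derivative (\<lambda>r. dB (dB f) (x + s *\<^sub>R u + t *\<^sub>R v) (r *\<^sub>R v))) (at t)"
      by (rule has_derivative_compose[OF lin smooth_on_has_derivative[OF smooth_on_dB[OF assms(1,2)]]])
        (use memS[of s t] that s in auto)
    then have "(q has_derivative (\<lambda>r. dB (dB f) (x + s *\<^sub>R u + t *\<^sub>R v) (r *\<^sub>R v) u)) (at t)"
      unfolding q_def by (rule bounded_linear.has_derivative[OF blinfun.bounded_linear_left])
    then show ?thesis
      by (rule has_derivative_imp_has_field_derivative) (simp add: blinfun.bilinear_simps algebra_simps)
  qed
  obtain t where t: "0 < t" "t < h" "q h - q 0 = (h - 0) * dB (dB f) (x + s *\<^sub>R u + t *\<^sub>R v) v u"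
    using MVT2[OF assms(3) dq] by blast
  have "p h - p 0 = h * h * dB (dB f) (x + s *\<^sub>R u + t *\<^sub>R v) v u"
    using s(3) t(3) by (simp add: q_def)
  then show ?thesis
    using mem[of s t] s t unfolding p_def by (intro bexI[of _ "x + s *\<^sub>R u + t *\<^sub>R v"]) auto
qed

lemma dB_dB_commute_real:
  fixes f :: "'a::euclidean_space \<Rightarrow> real"
  assumes "open S" "smooth_on S f" "x \<in> S"
  shows "dB (dB f) x u v = dB (dB f) x v u"
proof -
  have cont: "continuous_on S (\<lambda>y. dB (dB f) y a b)" for a b
    by (intro smooth_on_continuous smooth_on_linear[OF _ blinfun.bounded_linear_left]
       smooth_on_dB_apply smooth_on_dB assms(1,2))
  have "dist (dB (dB f) x u v) (dB (dB f) x v u) < e" if "e > 0" for e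
  proof -
    have "\<exists>d>0. \<forall>y\<in>S. dist y x < d \<longrightarrow> dist (dB (dB f) y a b) (dB (dB f) x a b) < e/2" for a b
      using cont[of a b] assms(3) \<open>e > 0\<close> unfolding continuous_on_iff by (meson half_gt_zero)
    then obtain d1 d2 where d: "d1 > 0" "d2 > 0"
      "\<And>y. y \<in> S \<Longrightarrow> dist y x < d1 \<Longrightarrow> dist (dB (dB f) y u v) (dB (dB f) x u v) < e/2"
      "\<And>y. y \<in> S \<Longrightarrow> dist y x < d2 \<Longrightarrow> dist (dB (dB f) y v u) (dB (dB f) x v u) < e/2"
      by metis
    obtain r where r: "r > 0" "cball x r \<subseteq> S"
      using assms(1,3) open_contains_cball by blast
    define m where "m = Min {d1, d2, r} / 2"
    have m: "m > 0" "m < d1" "m < d2" "m < r" using d r unfolding m_def by auto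
    \<comment> \<open>\<open>h\<close> is so small that both parallelograms lie in \<open>S\<close>
      and within the two continuity radii; the added 1 avoids a division by zero when
      \<open>u\<close> and \<open>v\<close> vanish.\<close>
    define h where "h = m / (norm u + norm v + 1)"
    have n: "norm u + norm v + 1 > 0" by (smt (verit) norm_ge_zero)
    have h: "h > 0" using m n unfolding h_def by simp
    have hm: "h * (norm u + norm v) \<le> m"
      using m n unfolding h_def by (simp add: field_simps)
    have sub: "cball x (h * (norm u + norm v)) \<subseteq> S"
      using hm m r by (meson dual_order.trans less_imp_le subset_cball)
    obtain y1 where y1: "y1 \<in> cball x (h * (norm u + norm v))"
      "f (x + h *\<^sub>R u + h *\<^sub>R v) - f (x + h *\<^sub>R u) - f (x + h *\<^sub>R v) + f x = h * h * dB (dB f) y1 v u"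
      using mixed_difference_mean_value[OF assms(1,2) h sub] by blast
    obtain y2 where y2: "y2 \<in> cball x (h * (norm v + norm u))"
      "f (x + h *\<^sub>R v + h *\<^sub>R u) - f (x + h *\<^sub>R v) - f (x + h *\<^sub>R u) + f x = h * h * dB (dB f) y2 u v"
      using mixed_difference_mean_value[OF assms(1,2) h, of x v u] sub by (auto simp: add.commute)
    have "h * h * dB (dB f) y1 v u = h * h * dB (dB f) y2 u v"
      using y1(2) y2(2) by (simp add: algebra_simps)
    then have eq: "dB (dB f) y1 v u = dB (dB f) y2 u v" using h by simp
    have "y1 \<in> S" "y2 \<in> S" using y1(1) y2(1) sub by (auto simp: add.commute)
    moreover have "dist y1 x < d2" "dist y2 x < d1"
      using y1(1) y2(1) hm m by (auto simp: dist_commute add.commute)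
    ultimately have "dist (dB (dB f) y2 u v) (dB (dB f) x u v) < e/2" "dist (dB (dB f) y1 v u) (dB (dB f) x v u) < e/2"
      using d by auto
    then show ?thesis using eq by (metis dist_triangle_half_r)
  qed
  then show ?thesis by (metis dist_pos_lt less_irrefl)
qed

lemma dB_linear:
  assumes "f differentiable (at x)" "bounded_linear L"
  shows "dB (\<lambda>y. L (f y)) x v = L (dB f x v)"
proof -
  have "((\<lambda>y. L (f y)) has_derivative (\<lambda>v. L (dB f x v))) (at x)"
    using bounded_linear.has_derivative[OF assms(2) has_derivative_dB[OF assms(1)]] .
  then show ?thesis
    using D_eqI dB_apply differentiableI by metis
qed

lemma dB_cong_open:
  "open S \<Longrightarrow> x \<in> S \<Longrightarrow> (\<And>y. y \<in> S \<Longrightarrow> f y = h y) \<Longrightarrow> dB f x = dB h x"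
  unfolding dB_def using D_cong_open by metis

lemma dB_dB_linear:
  fixes f :: "'a::euclidean_space \<Rightarrow> 'b::real_normed_vector"
  assumes "open S" "smooth_on S f" "x \<in> S" "bounded_linear L"
  shows "dB (dB (\<lambda>y. L (f y))) x u v = L (dB (dB f) x u v)"
proof -
  have 1: "smooth_on S (\<lambda>y. L (f y))" using assms smooth_on_linear by blast
  have "dB (dB (\<lambda>y. L (f y))) x u v = dB (\<lambda>y. dB (\<lambda>y. L (f y)) y v) x u"
    using dB_linear[OF smooth_on_differentiable[OF smooth_on_dB[OF assms(1) 1] assms(3)] blinfun.bounded_linear_left] by simp
  also have "\<dots> = dB (\<lambda>y. L (dB f y v)) x u"
    by (subst dB_cong_open[OF assms(1,3)])
      (use dB_linear[OF smooth_on_differentiable[OF assms(2)] assms(4)] in auto)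
  also have "\<dots> = L (dB (dB f) x u v)"
    using dB_linear[OF smooth_on_differentiable[OF smooth_on_dB[OF assms(1,2)] assms(3)]
       bounded_linear_compose[OF assms(4) blinfun.bounded_linear_left]] by simp
  finally show ?thesis .
qed

lemma dB_dB_commute:
  fixes f :: "'a::euclidean_space \<Rightarrow> 'b::euclidean_space"
  assumes "open S" "smooth_on S f" "x \<in> S"
  shows "dB (dB f) x u v = dB (dB f) x v u"
proof (rule euclidean_eqI)
  fix b :: 'b
  have "smooth_on S (\<lambda>y. f y \<bullet> b)"
    by (rule smooth_on_linear[OF assms(1) bounded_linear_inner_left assms(2)])
  from dB_dB_commute_real[OF assms(1) this assms(3)]
  show "dB (dB f) x u v \<bullet> b = dB (dB f) x v u \<bullet> b"
    using dB_dB_linear[OF assms bounded_linear_inner_left] by metis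
qed

lemma norm_blinfun_apply2: "norm (blinfun_apply (blinfun_apply (T :: 'a::real_normed_vector \<Rightarrow>\<^sub>L 'b::real_normed_vector \<Rightarrow>\<^sub>L 'c::real_normed_vector) a) b) \<le> norm T * norm a * norm b"
  by (meson dual_order.trans mult_right_mono norm_blinfun norm_ge_zero)

lemma norm_blinfun_apply3: "norm (blinfun_apply (blinfun_apply (blinfun_apply (T :: 'a::real_normed_vector \<Rightarrow>\<^sub>L 'b::real_normed_vector \<Rightarrow>\<^sub>L 'c::real_normed_vector \<Rightarrow>\<^sub>L 'd::real_normed_vector) u) a) b)
    \<le> norm T * norm u * norm a * norm b"
  by (rule order_trans[OF norm_blinfun_apply2]) (intro mult_right_mono norm_blinfun norm_ge_zero)

section \<open>Riemannian metrics in one chart\<close>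

text \<open>The form as an iterated bounded linear map, so that \<open>bform1\<close> and
  \<open>bform2\<close> are its Frechet derivatives. Directions of differentiation come first: in
  \<open>bform2 G x u v a b\<close> the vectors \<open>u\<close> and \<open>v\<close> are
  directions, \<open>a\<close> and \<open>b\<close> the arguments of the form.\<close>

definition bform :: "('e::euclidean_space \<Rightarrow> 'e \<Rightarrow> 'e \<Rightarrow> real) \<Rightarrow> 'e \<Rightarrow> 'e \<Rightarrow>\<^sub>L 'e \<Rightarrow>\<^sub>L real" where
  "bform G x = Blinfun (\<lambda>a. Blinfun (G x a))"

definition bform1 where "bform1 G = dB (bform G)"

definition bform2 where "bform2 G = dB (bform1 G)"

text \<open>The Christoffel symbols of the first kind.\<close>

definition koszul :: "('e::euclidean_space \<Rightarrow> 'e \<Rightarrow> 'e \<Rightarrow> real) \<Rightarrow> 'e \<Rightarrow> 'e \<Rightarrow> 'e \<Rightarrow> 'e \<Rightarrow> real" where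
  "koszul G x a b w = (bform1 G x a b w + bform1 G x b a w - bform1 G x w a b) / 2"

definition dkoszul :: "('e::euclidean_space \<Rightarrow> 'e \<Rightarrow> 'e \<Rightarrow> real) \<Rightarrow> 'e \<Rightarrow> 'e \<Rightarrow> 'e \<Rightarrow> 'e \<Rightarrow> 'e \<Rightarrow> real" where
  "dkoszul G x u a b w = (bform2 G x u a b w + bform2 G x u b a w - bform2 G x u w a b) / 2"

text \<open>All local Riemannian geometry is done for a metric on an open set of Euclidean space,
  later the image of a chart.\<close>

locale chart_metric =
  fixes S :: "'e::euclidean_space set" and G :: "'e \<Rightarrow> 'e \<Rightarrow> 'e \<Rightarrow> real"
  assumes open_S: "open S"
    and bilinear_G: "x \<in> S \<Longrightarrow> bilinear (G x)"
    and sym_G: "x \<in> S \<Longrightarrow> G x a b = G x b a"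
    and pos_G: "x \<in> S \<Longrightarrow> a \<noteq> 0 \<Longrightarrow> G x a a > 0"
    and smooth_G: "smooth_on S (\<lambda>x. G x a b)"
begin

lemma bform_eq [simp]: "x \<in> S \<Longrightarrow> bform G x a b = G x a b"
proof -
  assume "x \<in> S"
  then have bb: "bounded_bilinear (G x)" using bilinear_G bilinear_conv_bounded_bilinear by blast
  have 1: "blinfun_apply (Blinfun (G x a)) = G x a" for a
    using bb by (intro bounded_linear_Blinfun_apply) (rule bounded_bilinear.bounded_linear_right)
  have "linear (\<lambda>a. Blinfun (G x a))"
    by (rule linearI; rule blinfun_eqI)
      (use bb in \<open>auto simp: blinfun.bilinear_simps 1 bounded_bilinear.add_left bounded_bilinear.scaleR_left\<close>)
  then have "blinfun_apply (Blinfun (\<lambda>a. Blinfun (G x a))) = (\<lambda>a. Blinfun (G x a))"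
    by (intro bounded_linear_Blinfun_apply) (simp add: linear_conv_bounded_linear)
  then show ?thesis unfolding bform_def using 1 by simp
qed

lemma smooth_bform: "smooth_on S (bform G)"
proof -
  have "smooth_on S (\<lambda>x. bform G x a b)" for a b
    using smooth_on_cong[OF open_S, of "\<lambda>x. bform G x a b" "\<lambda>x. G x a b"] smooth_G by simp
  then show ?thesis by (intro smooth_on_blinfunI open_S)
qed

lemma smooth_bform1: "smooth_on S (bform1 G)"
  unfolding bform1_def by (intro smooth_on_dB open_S smooth_bform)

lemma smooth_bform2: "smooth_on S (bform2 G)"
  unfolding bform2_def by (intro smooth_on_dB open_S smooth_bform1)

lemma bform_deriv: "x \<in> S \<Longrightarrow> (bform G has_derivative blinfun_apply (bform1 G x)) (at x)"
  unfolding bform1_def by (rule smooth_on_has_derivative[OF smooth_bform])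

lemma bform1_deriv: "x \<in> S \<Longrightarrow> (bform1 G has_derivative blinfun_apply (bform2 G x)) (at x)"
  unfolding bform2_def by (rule smooth_on_has_derivative[OF smooth_bform1])

lemma cont_bform: "continuous_on S (bform G)" "continuous_on S (bform1 G)" "continuous_on S (bform2 G)"
  using smooth_bform smooth_bform1 smooth_bform2 smooth_on_continuous by blast+

lemma D_G: assumes "x \<in> S" shows "D (\<lambda>y. G y a b) x = (\<lambda>u. bform1 G x u a b)"
proof -
  have "((\<lambda>y. bform G y a b) has_derivative (\<lambda>u. bform1 G x u a b)) (at x)"
    using bform_deriv[OF assms] by (auto intro!: derivative_eq_intros simp: blinfun.bilinear_simps)
  then have "D (\<lambda>y. bform G y a b) x = (\<lambda>u. bform1 G x u a b)" by (rule D_eqI)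
  then show ?thesis
    using D_cong_open[OF open_S assms, of "\<lambda>y. bform G y a b" "\<lambda>y. G y a b"] by simp
qed

lemma bform1_sym: "x \<in> S \<Longrightarrow> bform1 G x u a b = bform1 G x u b a"
proof -
  assume x: "x \<in> S"
  have "D (\<lambda>y. G y a b) x = D (\<lambda>y. G y b a) x"
    by (rule D_cong_open[OF open_S x]) (rule sym_G)
  then show ?thesis using x by (metis D_G)
qed

lemma D_bform1: "x \<in> S \<Longrightarrow> D (\<lambda>y. bform1 G y v a b) x = (\<lambda>u. bform2 G x u v a b)"
  by (rule D_eqI) (use bform1_deriv in \<open>auto intro!: derivative_eq_intros simp: blinfun.bilinear_simps\<close>)

lemma bform2_sym: "x \<in> S \<Longrightarrow> bform2 G x u v a b = bform2 G x u v b a"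
proof -
  assume x: "x \<in> S"
  have "D (\<lambda>y. bform1 G y v a b) x = D (\<lambda>y. bform1 G y v b a) x"
    by (rule D_cong_open[OF open_S x]) (rule bform1_sym)
  then show ?thesis using x by (metis D_bform1)
qed

text \<open>\<open>dB_dB_commute\<close> applies to maps into a Euclidean space, so the form is
  first evaluated at \<open>a\<close> and \<open>b\<close> by the linear functional
  \<open>L\<close>.\<close>

lemma bform2_commute:
  assumes "x \<in> S" shows "bform2 G x u v a b = bform2 G x v u a b"
proof -
  define L where "L T = blinfun_apply (blinfun_apply T a) b" for T :: "'e \<Rightarrow>\<^sub>L 'e \<Rightarrow>\<^sub>L real"
  have L: "bounded_linear L"
    unfolding L_def by (rule bounded_linear_compose[OF blinfun.bounded_linear_left blinfun.bounded_linear_left])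
  have "smooth_on S (\<lambda>y. L (bform G y))"
    by (rule smooth_on_linear[OF open_S L smooth_bform])
  from dB_dB_commute[OF open_S this assms, of u v] show ?thesis
    unfolding dB_dB_linear[OF open_S smooth_bform assms L]
    by (simp add: L_def bform2_def bform1_def)
qed

lemma G_bilinear_simps:
  assumes "x \<in> S"
  shows "G x (a + b) c = G x a c + G x b c" "G x c (a + b) = G x c a + G x c b"
    "G x (a - b) c = G x a c - G x b c" "G x c (a - b) = G x c a - G x c b"
    "G x (r *\<^sub>R a) c = r * G x a c" "G x c (r *\<^sub>R a) = r * G x c a"
    "G x (- a) c = - G x a c" "G x c (- a) = - G x c a" "G x 0 c = 0" "G x c 0 = 0"
  using assms by (simp_all flip: bform_eq add: blinfun.bilinear_simps)

lemma G_nonneg: "x \<in> S \<Longrightarrow> G x a a \<ge> 0"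
  using pos_G[of x a] G_bilinear_simps(9)[of x] by (cases "a = 0") auto

lemma nondegenerate: "x \<in> S \<Longrightarrow> (\<And>w. G x z w = G x z' w) \<Longrightarrow> z = z'"
  using pos_G[of x "z - z'"] by (auto simp: G_bilinear_simps)

text \<open>The map sending \<open>z\<close> to its functional is injective because the form is
  definite, so it is onto in finite dimension. \<open>L\<close> represents functionals by the
  standard inner product.\<close>

lemma riesz:
  assumes "x \<in> S" "linear k"
  shows "\<exists>z. \<forall>w. G x z w = k w"
proof -
  define L where "L z = (\<Sum>i\<in>Basis. G x z i *\<^sub>R i)" for z
  have L: "L z \<bullet> w = G x z w" for z w
  proof -
    have "G x z w = bform G x z (\<Sum>i\<in>Basis. (w \<bullet> i) *\<^sub>R i)"
      using assms(1) by (simp add: euclidean_representation)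
    also have "\<dots> = L z \<bullet> w"
      using assms(1) by (simp add: blinfun.bilinear_simps L_def inner_sum_left) (simp add: mult.commute inner_commute)
    finally show ?thesis by simp
  qed
  have "linear L"
    unfolding L_def using assms(1)
    by (intro linearI) (simp_all add: G_bilinear_simps scaleR_add_left sum.distrib scaleR_sum_right)
  moreover have "inj L"
    using L nondegenerate[OF assms(1)] by (intro injI) metis
  ultimately have "surj L" using linear_injective_imp_surjective by blast
  then obtain z where z: "L z = (\<Sum>i\<in>Basis. k i *\<^sub>R i)" by (metis surjD)
  have "G x z w = k w" for w
  proof -
    have "G x z w = (\<Sum>i\<in>Basis. k i *\<^sub>R i) \<bullet> w" using L z by metis
    also have "\<dots> = (\<Sum>i\<in>Basis. (w \<bullet> i) *\<^sub>R k i)"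
      by (simp add: inner_sum_left) (simp add: inner_commute mult.commute)
    also have "\<dots> = k w"
      using linear_sum[OF assms(2)] linear_scale[OF assms(2)] euclidean_representation[of w] by (metis (no_types, lifting) sum.cong)
    finally show ?thesis .
  qed
  then show ?thesis by blast
qed

abbreviation "\<Gamma> \<equiv> christoffel G"

text \<open>Existence of the vector described by the Koszul formula comes from \<open>riesz\<close>,
  uniqueness from nondegeneracy. From here on the definite description in \<open>christoffel\<close>
  is used only through this equation.\<close>

lemma christoffel_koszul:
  assumes "x \<in> S"
  shows "G x (\<Gamma> x a b) w = koszul G x a b w"
proof -
  have "linear (koszul G x a b)"
    by (rule linearI) (simp_all add: koszul_def blinfun.bilinear_simps field_simps)
  then obtain z where z: "\<And>w. G x z w = koszul G x a b w" using riesz[OF assms] by blast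
  have "\<forall>w. 2 * G x (\<Gamma> x a b) w = D (\<lambda>y. G y b w) x a + D (\<lambda>y. G y a w) x b - D (\<lambda>y. G y a b) x w"
    unfolding christoffel_def
  proof (rule theI[where a = z])
    show "\<forall>w. 2 * G x z w = D (\<lambda>y. G y b w) x a + D (\<lambda>y. G y a w) x b - D (\<lambda>y. G y a b) x w"
      by (simp add: z D_G[OF assms] koszul_def)
    show "z' = z" if "\<forall>w. 2 * G x z' w = D (\<lambda>y. G y b w) x a + D (\<lambda>y. G y a w) x b - D (\<lambda>y. G y a b) x w" for z'
    proof (rule nondegenerate[OF assms])
      fix w
      have "2 * G x z' w = 2 * koszul G x a b w"
        using that by (simp add: D_G[OF assms] koszul_def)
      then show "G x z' w = G x z w" by (simp add: z)
    qed
  qed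
  then show ?thesis using D_G[OF assms] by (simp add: koszul_def field_simps)
qed

lemma christoffel_eqI: "x \<in> S \<Longrightarrow> (\<And>w. G x z w = koszul G x a b w) \<Longrightarrow> \<Gamma> x a b = z"
  using nondegenerate christoffel_koszul by metis

lemma christoffel_sym: "x \<in> S \<Longrightarrow> \<Gamma> x a b = \<Gamma> x b a"
  by (rule christoffel_eqI) (auto simp: christoffel_koszul koszul_def bform1_sym[of x _ a b])

lemma christoffel_bilinear_simps:
  assumes "x \<in> S"
  shows "\<Gamma> x (a + b) c = \<Gamma> x a c + \<Gamma> x b c" "\<Gamma> x (r *\<^sub>R a) c = r *\<^sub>R \<Gamma> x a c"
    "\<Gamma> x c (a + b) = \<Gamma> x c a + \<Gamma> x c b" "\<Gamma> x c (r *\<^sub>R a) = r *\<^sub>R \<Gamma> x c a"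
    "\<Gamma> x (a - b) c = \<Gamma> x a c - \<Gamma> x b c" "\<Gamma> x c (a - b) = \<Gamma> x c a - \<Gamma> x c b"
    "\<Gamma> x (- a) c = - \<Gamma> x a c" "\<Gamma> x c (- a) = - \<Gamma> x c a" "\<Gamma> x 0 c = 0" "\<Gamma> x c 0 = 0"
  by (rule christoffel_eqI[OF assms],
      simp add: assms G_bilinear_simps christoffel_koszul koszul_def blinfun.bilinear_simps field_simps)+

text \<open>Metric compatibility of the Levi-Civita connection, in Christoffel symbols of the first
  kind.\<close>

lemma koszul_metric: "x \<in> S \<Longrightarrow> koszul G x u a b + koszul G x u b a = bform1 G x u a b"
  unfolding koszul_def using bform1_sym[of x u a b] bform1_sym[of x b u a] bform1_sym[of x a u b] by argo

text \<open>The form attains a positive minimum on the compact product of \<open>K\<close> with the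
  unit sphere; homogeneity extends the bound to all vectors.\<close>

lemma ex_lower_bound:
  assumes "compact K" "K \<subseteq> S"
  shows "\<exists>l>0. \<forall>x\<in>K. \<forall>a. l * (norm a)\<^sup>2 \<le> G x a a"
proof (cases "K = {}")
  case True then show ?thesis by (auto intro: exI[of _ 1])
next
  case False
  let ?T = "K \<times> sphere (0::'e) 1"
  have ne: "?T \<noteq> {}" using False by auto
  have "continuous_on ?T (\<lambda>(x, a). bform G x a a)"
    unfolding split_beta
    by (intro continuous_intros continuous_on_compose2[OF cont_bform(1)]) (use assms in auto)
  then obtain p where p: "p \<in> ?T" "\<And>q. q \<in> ?T \<Longrightarrow> (\<lambda>(x, a). bform G x a a) p \<le> (\<lambda>(x, a). bform G x a a) q"
    using continuous_attains_inf[OF compact_Times[OF assms(1) compact_sphere] ne] by blast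
  obtain x0 a0 where p_eq: "p = (x0, a0)" by force
  have x0: "x0 \<in> S" "a0 \<noteq> 0" using p(1) p_eq assms by auto
  define l where "l = G x0 a0 a0"
  have "l > 0" using pos_G x0 l_def by simp
  moreover have "l * (norm a)\<^sup>2 \<le> G x a a" if "x \<in> K" for x a
  proof (cases "a = 0")
    case True then show ?thesis using G_bilinear_simps(9)[of x 0] that assms by auto
  next
    case False
    let ?a = "(1 / norm a) *\<^sub>R a"
    have "(x, ?a) \<in> ?T" using that False by auto
    then have "l \<le> bform G x ?a ?a" using p(2) p_eq x0 l_def by fastforce
    also have "\<dots> = G x a a / (norm a)\<^sup>2"
      using that assms by (simp add: blinfun.bilinear_simps subsetD power2_eq_square)
    finally show ?thesis using False by (simp add: field_simps)
  qed
  ultimately show ?thesis by blast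
qed

lemma ex_upper_bound:
  assumes "compact K" "K \<subseteq> S"
  shows "\<exists>C>0. \<forall>x\<in>K. norm (bform G x) \<le> C \<and> norm (bform1 G x) \<le> C \<and> norm (bform2 G x) \<le> C"
proof -
  have "\<exists>C. \<forall>x\<in>K. norm (f x) \<le> C" if "continuous_on S f" for f :: "'e \<Rightarrow> 'z::real_normed_vector"
    using compact_continuous_image[OF continuous_on_subset[OF that assms(2)] assms(1)]
    by (metis bounded_iff compact_imp_bounded imageI)
  then obtain C0 C1 C2 :: real where C: "\<And>x. x \<in> K \<Longrightarrow> norm (bform G x) \<le> C0"
     "\<And>x. x \<in> K \<Longrightarrow> norm (bform1 G x) \<le> C1" "\<And>x. x \<in> K \<Longrightarrow> norm (bform2 G x) \<le> C2"
    using cont_bform by metis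
  then show ?thesis by (intro exI[of _ "\<bar>C0\<bar> + \<bar>C1\<bar> + \<bar>C2\<bar> + 1"]) (use C in \<open>fastforce intro: order_trans\<close>)
qed

text \<open>\<open>\<Gamma> x a b\<close> is the solution of a linear system depending smoothly on \<open>x\<close>; its derivative
  is found by differentiating the system.\<close>

lemma christoffel_differentiable:
  assumes x: "x \<in> S"
  shows "(\<lambda>y. \<Gamma> y a b) differentiable (at x)"
proof -
  let ?g = "bform G" and ?g1 = "bform1 G" and ?g2 = "bform2 G"
  define z where "z y = \<Gamma> y a b" for y
  define k where "k y = (1/2) *\<^sub>R (?g1 y a b + ?g1 y b a - Blinfun (\<lambda>w. ?g1 y w a b))" for y
  have bl: "bounded_linear (\<lambda>w. blinfun_apply (blinfun_apply (T w) a) b)" if "bounded_linear T" for T :: "'e \<Rightarrow> 'e \<Rightarrow>\<^sub>L 'e \<Rightarrow>\<^sub>L real"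
    by (intro bounded_linear_compose[OF blinfun.bounded_linear_left] that)
  have k: "k y w = koszul G y a b w" for y w
    using bounded_linear_Blinfun_apply[OF bl[OF blinfun.bounded_linear_right]]
    by (simp add: k_def koszul_def blinfun.bilinear_simps)
  have "k differentiable (at x)"
  proof -
    have "smooth_on S k"
    proof (rule smooth_on_blinfunI[OF open_S])
      fix w
      have 1: "smooth_on S (\<lambda>y. ?g1 y u c d)" for u c d
        by (intro smooth_on_linear[OF open_S blinfun.bounded_linear_left] smooth_bform1)
      have "smooth_on S (\<lambda>y. (1/2) *\<^sub>R ((?g1 y a b w + ?g1 y b a w) + (-1) *\<^sub>R ?g1 y w a b))"
        by (intro smooth_on_linear[OF open_S bounded_linear_scaleR_right] smooth_on_add open_S 1)
      then show "smooth_on S (\<lambda>y. k y w)" by (simp add: k koszul_def field_simps)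
    qed
    then show ?thesis using smooth_on_differentiable x by blast
  qed
  then obtain k' where k': "(k has_derivative blinfun_apply k') (at x)"
    using has_derivative_dB by blast
  obtain l where l: "l > 0" "\<And>c. l * (norm c)\<^sup>2 \<le> G x c c"
    using ex_lower_bound[of "{x}"] x by auto
  \<comment> \<open>Coercivity: a bound on a functional becomes a bound on the vector representing
    it.\<close>
  have est: "norm c \<le> norm R / l" if "\<And>w. G x c w = blinfun_apply R w" for c R
  proof -
    have "l * (norm c)\<^sup>2 \<le> blinfun_apply R c" using l(2)[of c] that by simp
    also have "\<dots> \<le> norm R * norm c" by (metis norm_blinfun real_norm_def abs_le_D1)
    finally show ?thesis using l(1) by (cases "c = 0") (auto simp: field_simps power2_eq_square)
  qed
  \<comment> \<open>The candidate derivative: differentiating \<open>G y (z y) w = k y w\<close> at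
    \<open>x\<close> gives a linear equation for it, solved by Riesz representation.\<close>
  have "\<exists>c. \<forall>w. G x c w = (k' h - ?g1 x h (z x)) w" for h
    by (rule riesz[OF x]) (simp add: bounded_linear.linear blinfun.bounded_linear_right)
  then obtain Z where Z: "\<And>h w. G x (Z h) w = (k' h - ?g1 x h (z x)) w" by metis
  have "linear Z"
    by (intro linearI; rule nondegenerate[OF x])
      (simp_all add: G_bilinear_simps[OF x] Z blinfun.bilinear_simps algebra_simps)
  have eqz: "G y (z y) w = k y w" if "y \<in> S" for y w
    using christoffel_koszul[OF that] k by (simp add: z_def)
  have d1: "G x (z y - z x) w = (k y - k x - (?g y - ?g x) (z y)) w" if "y \<in> S" for y w
    using eqz[OF that] eqz[OF x] that x
    by (simp add: blinfun.bilinear_simps G_bilinear_simps)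
  have d2: "G x (z y - z x - Z (y - x)) w =
    ((k y - k x - k' (y - x)) - (?g y - ?g x - ?g1 x (y - x)) (z y) - ?g1 x (y - x) (z y - z x)) w"
    if "y \<in> S" for y w
    using d1[OF that, of w] x
    by (simp add: blinfun.bilinear_simps G_bilinear_simps Z)
  have evS: "eventually (\<lambda>y. y \<in> S) (at x)" using open_S x eventually_at_topological by blast
  have contk: "(k \<longlongrightarrow> k x) (at x)" using k' has_derivative_continuous isCont_def by blast
  have contg: "(?g \<longlongrightarrow> ?g x) (at x)"
    using bform_deriv[OF x] has_derivative_continuous isCont_def by blast
  \<comment> \<open>Continuity has to come first, since the error terms in \<open>d2\<close> still
    contain \<open>z y\<close>.\<close>
  have zlim: "(z \<longlongrightarrow> z x) (at x)"
  proof -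
    \<comment> \<open>Near \<open>x\<close> the term with \<open>z y - z x\<close> on the right has
      at most half the size of the left side and is absorbed; this gives the factor 2 in
      \<open>e\<close>.\<close>
    have evg: "eventually (\<lambda>y. norm (?g y - ?g x) \<le> l/2) (at x)"
      using tendstoD[OF contg, of "l/2"] l(1) by (auto simp: dist_norm elim: eventually_mono)
    define e where "e y = 2 * (norm (k y - k x) + norm (?g y - ?g x) * norm (z x)) / l" for y
    have "eventually (\<lambda>y. norm (z y - z x) \<le> e y) (at x)"
      using evS evg
    proof eventually_elim
      fix y assume y: "y \<in> S" "norm (?g y - ?g x) \<le> l/2"
      have "norm (z y - z x) \<le> norm (k y - k x - (?g y - ?g x) (z y)) / l"
        using est[OF d1[OF y(1)]] .
      also have "norm (k y - k x - (?g y - ?g x) (z y)) \<le> norm (k y - k x) + norm (?g y - ?g x) * norm (z y)"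
        by (meson add_left_mono dual_order.trans norm_blinfun norm_triangle_ineq4)
      also have "norm (?g y - ?g x) * norm (z y) \<le> norm (?g y - ?g x) * norm (z x) + norm (?g y - ?g x) * norm (z y - z x)"
        by (metis distrib_left mult_left_mono norm_ge_zero norm_triangle_sub)
      also have "norm (?g y - ?g x) * norm (z y - z x) \<le> l/2 * norm (z y - z x)"
        by (rule mult_right_mono[OF y(2) norm_ge_zero])
      finally have "norm (z y - z x) \<le> (norm (k y - k x) + (norm (?g y - ?g x) * norm (z x) + l/2 * norm (z y - z x))) / l"
        using l(1) by (simp add: divide_right_mono)
      then show "norm (z y - z x) \<le> e y" using l(1) by (simp add: e_def field_simps)
    qed
    moreover have "(e \<longlongrightarrow> 0) (at x)"
    proof -
      have "(e \<longlongrightarrow> 2 * (norm (k x - k x) + norm (?g x - ?g x) * norm (z x)) / l) (at x)"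
        unfolding e_def by (intro tendsto_intros contk contg) (use l in auto)
      then show ?thesis by simp
    qed
    ultimately have "((\<lambda>y. z y - z x) \<longlongrightarrow> 0) (at x)"
      by (rule Lim_null_comparison)
    then show ?thesis by (simp add: LIM_zero_iff)
  qed
  have "(z has_derivative Z) (at x)"
    unfolding has_derivative_iff_norm
  proof
    show "bounded_linear Z" using \<open>linear Z\<close> by (simp add: linear_conv_bounded_linear)
    define e where "e y = (norm (k y - k x - k' (y - x)) / norm (y - x)
      + norm (?g y - ?g x - ?g1 x (y - x)) / norm (y - x) * norm (z y) + norm (?g1 x) * norm (z y - z x)) / l" for y
    have "eventually (\<lambda>y. norm (norm (z y - z x - Z (y - x)) / norm (y - x)) \<le> e y) (at x)"
      using evS eventually_neq_at_within[of x x UNIV]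
    proof eventually_elim
      fix y assume y: "y \<in> S" "y \<noteq> x"
      let ?A = "k y - k x - k' (y - x)" and ?B = "(?g y - ?g x - ?g1 x (y - x)) (z y)" and ?C = "?g1 x (y - x) (z y - z x)"
      have "norm (z y - z x - Z (y - x)) \<le> norm (?A - ?B - ?C) / l"
        using est[OF d2[OF y(1)]] .
      also have "norm (?A - ?B - ?C) \<le> norm ?A + norm ?B + norm ?C"
        by (smt (verit) norm_triangle_ineq4)
      also have "norm ?B \<le> norm (?g y - ?g x - ?g1 x (y - x)) * norm (z y)" by (rule norm_blinfun)
      also have "norm ?C \<le> norm (?g1 x) * norm (y - x) * norm (z y - z x)"
        by (meson dual_order.trans mult_right_mono norm_blinfun norm_ge_zero)
      finally have "norm (z y - z x - Z (y - x)) \<le> (norm ?A + norm (?g y - ?g x - ?g1 x (y - x)) * norm (z y)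
         + norm (?g1 x) * norm (y - x) * norm (z y - z x)) / l"
        using l(1) by (simp add: divide_right_mono)
      from divide_right_mono[OF this norm_ge_zero[of "y - x"]]
      have "norm (z y - z x - Z (y - x)) / norm (y - x) \<le> (norm ?A + norm (?g y - ?g x - ?g1 x (y - x)) * norm (z y)
         + norm (?g1 x) * norm (y - x) * norm (z y - z x)) / l / norm (y - x)" .
      also have "\<dots> = e y" using y l(1) by (simp add: e_def field_simps)
      finally show "norm (norm (z y - z x - Z (y - x)) / norm (y - x)) \<le> e y" by simp
    qed
    moreover have "(e \<longlongrightarrow> 0) (at x)"
    proof -
      have 1: "((\<lambda>y. norm (k y - k x - k' (y - x)) / norm (y - x)) \<longlongrightarrow> 0) (at x)"
        using k' unfolding has_derivative_iff_norm by blast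
      have 2: "((\<lambda>y. norm (?g y - ?g x - ?g1 x (y - x)) / norm (y - x)) \<longlongrightarrow> 0) (at x)"
        using bform_deriv[OF x] unfolding has_derivative_iff_norm by blast
      have "(e \<longlongrightarrow> (0 + 0 * norm (z x) + norm (?g1 x) * norm (z x - z x)) / l) (at x)"
        unfolding e_def by (intro tendsto_intros 1 2 zlim) (use l in auto)
      then show ?thesis by simp
    qed
    ultimately show "((\<lambda>y. norm (z y - z x - Z (y - x)) / norm (y - x)) \<longlongrightarrow> 0) (at x)"
      by (rule Lim_null_comparison)
  qed
  then show ?thesis unfolding z_def differentiable_def by blast
qed

text \<open>Product rule applied to the Koszul formula; the derivative of the Christoffel symbol
  thus becomes known through its inner products.\<close>

lemma christoffel_derivative:
  assumes x: "x \<in> S"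
  shows "G x (D (\<lambda>y. \<Gamma> y a b) x u) w = dkoszul G x u a b w - bform1 G x u (\<Gamma> x a b) w"
proof -
  have d\<Gamma>: "((\<lambda>y. \<Gamma> y a b) has_derivative D (\<lambda>y. \<Gamma> y a b) x) (at x)"
    using christoffel_differentiable[OF x] frechet_derivative_works by blast
  have "((\<lambda>y. bform G y (\<Gamma> y a b) w) has_derivative
     (\<lambda>u. bform G x (D (\<lambda>y. \<Gamma> y a b) x u) w + bform1 G x u (\<Gamma> x a b) w)) (at x)"
    using d\<Gamma> bform_deriv[OF x]
    by (auto intro!: derivative_eq_intros simp: blinfun.bilinear_simps)
  then have "D (\<lambda>y. bform G y (\<Gamma> y a b) w) x u = bform G x (D (\<lambda>y. \<Gamma> y a b) x u) w + bform1 G x u (\<Gamma> x a b) w"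
    using D_eqI by fastforce
  moreover have "D (\<lambda>y. bform G y (\<Gamma> y a b) w) x = D (\<lambda>y. koszul G y a b w) x"
    by (rule D_cong_open[OF open_S x]) (simp add: christoffel_koszul)
  moreover have "((\<lambda>y. koszul G y a b w) has_derivative (\<lambda>u. dkoszul G x u a b w)) (at x)"
    unfolding koszul_def dkoszul_def using bform1_deriv[OF x]
    by (auto intro!: derivative_eq_intros simp: blinfun.bilinear_simps)
  then have "D (\<lambda>y. koszul G y a b w) x u = dkoszul G x u a b w" using D_eqI by fastforce
  ultimately show ?thesis using x by simp
qed

end

text \<open>The classical coordinate formula for g(R(v,t)t,v): second derivatives of the metric and
  two quadratic Christoffel terms. It is not divided by the area of the parallelogram, so it is
  quadratic in each vector. In this form the change of charts and the second variation are plain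
  algebra.\<close>

definition Rm :: "('e::euclidean_space \<Rightarrow> 'e \<Rightarrow> 'e \<Rightarrow> real) \<Rightarrow> 'e \<Rightarrow> 'e \<Rightarrow> 'e \<Rightarrow> real" where
  "Rm G x v t = bform2 G x v t t v - bform2 G x v v t t / 2 - bform2 G x t t v v / 2
     - G x (christoffel G x v v) (christoffel G x t t) + G x (christoffel G x v t) (christoffel G x v t)"

context chart_metric
begin

text \<open>Metric compatibility turns each first derivative of the metric together with its Koszul
  term into an inner product of two Christoffel vectors; the second derivatives are sorted by their
  symmetries.\<close>

lemma curvature_Rm:
  assumes x: "x \<in> S"
  shows "G x (curvature_rep G x v t t) v = Rm G x v t"
proof -
  have n: "nabla_rep G a (\<lambda>_. w) = (\<lambda>y. \<Gamma> y a w)" for a w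
    by (simp add: nabla_rep_def fun_eq_iff)
  have "G x (curvature_rep G x v t t) v =
     G x (D (\<lambda>y. \<Gamma> y t t) x v) v + G x (\<Gamma> x v (\<Gamma> x t t)) v
      - G x (D (\<lambda>y. \<Gamma> y v t) x t) v - G x (\<Gamma> x t (\<Gamma> x v t)) v"
    unfolding curvature_rep_def n nabla_rep_def[of G _ "\<lambda>y. \<Gamma> y _ _"] using x by (simp add: G_bilinear_simps)
  also have "\<dots> = dkoszul G x v t t v - bform1 G x v (\<Gamma> x t t) v + koszul G x v (\<Gamma> x t t) v
      - dkoszul G x t v t v + bform1 G x t (\<Gamma> x v t) v - koszul G x t (\<Gamma> x v t) v"
    by (simp add: christoffel_derivative christoffel_koszul x)
  also have "\<dots> = dkoszul G x v t t v - dkoszul G x t v t v - koszul G x v v (\<Gamma> x t t) + koszul G x t v (\<Gamma> x v t)"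
    using koszul_metric[OF x, of v "\<Gamma> x t t" v] koszul_metric[OF x, of t "\<Gamma> x v t" v] by simp
  also have "\<dots> = dkoszul G x v t t v - dkoszul G x t v t v - G x (\<Gamma> x v v) (\<Gamma> x t t) + G x (\<Gamma> x v t) (\<Gamma> x v t)"
    using christoffel_sym[OF x, of t v] by (simp add: christoffel_koszul[OF x, symmetric])
  also have "\<dots> = Rm G x v t"
    unfolding Rm_def dkoszul_def
    using bform2_sym[OF x, of t v t v] by (simp add: field_simps)
  finally show ?thesis .
qed

text \<open>The left side is half the second derivative of the energy density under a variation with
  velocity \<open>t\<close>, variation field \<open>v\<close> and derivative \<open>v'\<close> of
  that field, apart from the second order part of the variation. On the right, the last three terms
  are along a geodesic the derivative of \<open>koszul G x v v t\<close> and so contribute only at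
  the ends.\<close>

lemma second_variation_identity:
  assumes x: "x \<in> S"
  shows "bform2 G x v v t t / 2 + 2 * bform1 G x v v' t + G x v' v'
    = G x (v' + \<Gamma> x t v) (v' + \<Gamma> x t v) - Rm G x v t
      + dkoszul G x t v v t + 2 * koszul G x v v' t - koszul G x v v (\<Gamma> x t t)"
proof -
  have 1: "G x (v' + \<Gamma> x t v) (v' + \<Gamma> x t v) = G x v' v' + 2 * koszul G x t v v' + G x (\<Gamma> x v t) (\<Gamma> x v t)"
    using christoffel_sym[OF x, of t v] sym_G[OF x, of v' "\<Gamma> x v t"] christoffel_koszul[OF x, of t v v']
    by (simp add: G_bilinear_simps x)
  have 2: "koszul G x t v v' + koszul G x v v' t = bform1 G x v v' t"
    using koszul_metric[OF x, of v v' t] christoffel_sym[OF x, of t v] by (metis add.commute christoffel_koszul x)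
  have 3: "dkoszul G x t v v t = bform2 G x v t t v - bform2 G x t t v v / 2"
    unfolding dkoszul_def using bform2_commute[OF x, of t v] bform2_sym[OF x, of v t v t] by simp
  show ?thesis
    unfolding 1 3 Rm_def using 2 christoffel_koszul[OF x, of v v "\<Gamma> x t t"] by simp
qed

lemma sec_rep_Rm: "x \<in> S \<Longrightarrow> G x v v = 1 \<Longrightarrow> G x t t = 1 \<Longrightarrow> G x v t = 0 \<Longrightarrow> sec_rep G x v t = Rm G x v t"
  by (simp add: sec_rep_def curvature_Rm)

lemma Rm_scale: "x \<in> S \<Longrightarrow> Rm G x (r *\<^sub>R v) (s *\<^sub>R t) = r\<^sup>2 * s\<^sup>2 * Rm G x v t"
  by (simp add: Rm_def blinfun.bilinear_simps christoffel_bilinear_simps G_bilinear_simps power2_eq_square algebra_simps)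

end

section \<open>Change of charts\<close>

text \<open>A local isometry between two coordinate metrics; later \<phi> is a transition map.
  Surjectivity of the derivative lets every test vector of the target be written as an image, so
  that Christoffel symbols can be identified there by their inner products.\<close>

locale chart_change = s: chart_metric S G + t: chart_metric T H
  for S :: "'e::euclidean_space set" and G and T :: "'e set" and H +
  fixes U :: "'e set" and \<phi> :: "'e \<Rightarrow> 'e"
  assumes open_U: "open U"
    and U_S: "U \<subseteq> S"
    and U_T: "\<phi> ` U \<subseteq> T"
    and smooth_\<phi>: "smooth_on U \<phi>"
    and isometric: "x \<in> U \<Longrightarrow> G x a b = H (\<phi> x) (dB \<phi> x a) (dB \<phi> x b)"
    and surj_\<phi>: "x \<in> U \<Longrightarrow> surj (blinfun_apply (dB \<phi> x))"
begin

abbreviation "\<phi>1 \<equiv> dB \<phi>"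
abbreviation "\<phi>2 \<equiv> dB (dB \<phi>)"
abbreviation "\<phi>3 \<equiv> dB (dB (dB \<phi>))"

lemma mem: "x \<in> U \<Longrightarrow> x \<in> S" "x \<in> U \<Longrightarrow> \<phi> x \<in> T"
  using U_S U_T by auto

lemma \<phi>_deriv:
  assumes "x \<in> U"
  shows "(\<phi> has_derivative blinfun_apply (\<phi>1 x)) (at x)"
    "(\<phi>1 has_derivative blinfun_apply (\<phi>2 x)) (at x)"
    "(\<phi>2 has_derivative blinfun_apply (\<phi>3 x)) (at x)"
  using assms by (blast intro: smooth_on_has_derivative smooth_on_dB open_U smooth_\<phi>)+

lemma \<phi>2_sym: "x \<in> U \<Longrightarrow> \<phi>2 x u v = \<phi>2 x v u"
  by (rule dB_dB_commute[OF open_U smooth_\<phi>])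

lemma \<phi>3_sym: assumes "x \<in> U" shows "\<phi>3 x u v w = \<phi>3 x v u w" "\<phi>3 x u v w = \<phi>3 x u w v"
proof -
  have sm: "smooth_on U \<phi>1" by (rule smooth_on_dB[OF open_U smooth_\<phi>])
  have eq: "dB (dB (\<lambda>y. \<phi>1 y w)) x u v = \<phi>3 x u v w" for u v
    by (rule dB_dB_linear[OF open_U sm assms blinfun.bounded_linear_left])
  show "\<phi>3 x u v w = \<phi>3 x v u w"
    using dB_dB_commute[OF open_U smooth_on_dB_apply[OF open_U smooth_\<phi>] assms, of w u v] unfolding eq .
  have L: "bounded_linear (\<lambda>T :: 'e \<Rightarrow>\<^sub>L 'e \<Rightarrow>\<^sub>L 'e. T a b)" for a b
    by (rule bounded_linear_compose[OF blinfun.bounded_linear_left blinfun.bounded_linear_left])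
  have d2: "\<phi>2 differentiable (at x)" using \<phi>_deriv(3)[OF assms] differentiableI by blast
  have eq2: "dB (\<lambda>y. \<phi>2 y a b) x u = \<phi>3 x u a b" for a b
    by (rule dB_linear[OF d2 L])
  have "dB (\<lambda>y. \<phi>2 y v w) x = dB (\<lambda>y. \<phi>2 y w v) x"
    by (rule dB_cong_open[OF open_U assms]) (rule \<phi>2_sym)
  then show "\<phi>3 x u v w = \<phi>3 x u w v" using eq2 by metis
qed

lemma bform_H_deriv:
  assumes "x \<in> U"
  shows "((\<lambda>y. bform H (\<phi> y)) has_derivative (\<lambda>u. bform1 H (\<phi> x) (\<phi>1 x u))) (at x)"
    "((\<lambda>y. bform1 H (\<phi> y)) has_derivative (\<lambda>u. bform2 H (\<phi> x) (\<phi>1 x u))) (at x)"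
  using has_derivative_compose[OF \<phi>_deriv(1)[OF assms] t.bform_deriv[OF mem(2)[OF assms]]]
    has_derivative_compose[OF \<phi>_deriv(1)[OF assms] t.bform1_deriv[OF mem(2)[OF assms]]] by auto

text \<open>The isometry equation differentiated once; \<open>bform2_pullback\<close> differentiates
  the result again, which brings in third derivatives of \<phi>.\<close>

lemma bform1_pullback:
  assumes "x \<in> U"
  shows "bform1 G x u a b = bform1 H (\<phi> x) (\<phi>1 x u) (\<phi>1 x a) (\<phi>1 x b)
    + bform H (\<phi> x) (\<phi>2 x u a) (\<phi>1 x b) + bform H (\<phi> x) (\<phi>1 x a) (\<phi>2 x u b)"
proof -
  have "((\<lambda>y. bform H (\<phi> y) (\<phi>1 y a) (\<phi>1 y b)) has_derivative
    (\<lambda>u. bform1 H (\<phi> x) (\<phi>1 x u) (\<phi>1 x a) (\<phi>1 x b)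
    + bform H (\<phi> x) (\<phi>2 x u a) (\<phi>1 x b) + bform H (\<phi> x) (\<phi>1 x a) (\<phi>2 x u b))) (at x)"
    using bform_H_deriv[OF assms] \<phi>_deriv[OF assms]
    by (auto intro!: derivative_eq_intros simp: blinfun.bilinear_simps)
  from D_eqI[OF this] have "D (\<lambda>y. bform H (\<phi> y) (\<phi>1 y a) (\<phi>1 y b)) x u =
     bform1 H (\<phi> x) (\<phi>1 x u) (\<phi>1 x a) (\<phi>1 x b)
    + bform H (\<phi> x) (\<phi>2 x u a) (\<phi>1 x b) + bform H (\<phi> x) (\<phi>1 x a) (\<phi>2 x u b)" by simp
  moreover have "D (\<lambda>y. bform H (\<phi> y) (\<phi>1 y a) (\<phi>1 y b)) x = D (\<lambda>y. G y a b) x"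
    by (rule D_cong_open[OF open_U assms]) (simp add: isometric mem)
  ultimately show ?thesis using s.D_G[OF mem(1)[OF assms]] by simp
qed

lemma bform2_pullback:
  assumes "x \<in> U"
  shows "bform2 G x u v a b = bform2 H (\<phi> x) (\<phi>1 x u) (\<phi>1 x v) (\<phi>1 x a) (\<phi>1 x b)
    + bform1 H (\<phi> x) (\<phi>2 x u v) (\<phi>1 x a) (\<phi>1 x b)
    + bform1 H (\<phi> x) (\<phi>1 x v) (\<phi>2 x u a) (\<phi>1 x b)
    + bform1 H (\<phi> x) (\<phi>1 x v) (\<phi>1 x a) (\<phi>2 x u b)
    + bform1 H (\<phi> x) (\<phi>1 x u) (\<phi>2 x v a) (\<phi>1 x b)
    + bform1 H (\<phi> x) (\<phi>1 x u) (\<phi>1 x a) (\<phi>2 x v b)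
    + bform H (\<phi> x) (\<phi>3 x u v a) (\<phi>1 x b) + bform H (\<phi> x) (\<phi>1 x a) (\<phi>3 x u v b)
    + bform H (\<phi> x) (\<phi>2 x v a) (\<phi>2 x u b) + bform H (\<phi> x) (\<phi>2 x u a) (\<phi>2 x v b)"
    (is "_ = ?R u")
proof -
  have "((\<lambda>y. bform1 H (\<phi> y) (\<phi>1 y v) (\<phi>1 y a) (\<phi>1 y b)
    + bform H (\<phi> y) (\<phi>2 y v a) (\<phi>1 y b) + bform H (\<phi> y) (\<phi>1 y a) (\<phi>2 y v b)) has_derivative ?R) (at x)"
    using bform_H_deriv[OF assms] \<phi>_deriv[OF assms]
    by (auto intro!: derivative_eq_intros simp: blinfun.bilinear_simps)
  from D_eqI[OF this] have "D (\<lambda>y. bform1 H (\<phi> y) (\<phi>1 y v) (\<phi>1 y a) (\<phi>1 y b)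
    + bform H (\<phi> y) (\<phi>2 y v a) (\<phi>1 y b) + bform H (\<phi> y) (\<phi>1 y a) (\<phi>2 y v b)) x u = ?R u" by simp
  moreover have "D (\<lambda>y. bform1 H (\<phi> y) (\<phi>1 y v) (\<phi>1 y a) (\<phi>1 y b)
    + bform H (\<phi> y) (\<phi>2 y v a) (\<phi>1 y b) + bform H (\<phi> y) (\<phi>1 y a) (\<phi>2 y v b)) x = D (\<lambda>y. bform1 G y v a b) x"
    by (rule D_cong_open[OF open_U assms]) (simp add: bform1_pullback)
  ultimately show ?thesis using s.D_bform1[OF mem(1)[OF assms]] by simp
qed

text \<open>The inhomogeneous transformation law of a connection. In the three first derivatives of
  the Koszul formula all terms with second derivatives of \<phi> cancel by symmetry, except those
  pairing \<open>\<phi>2 x a b\<close> with the test vector.\<close>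

lemma christoffel_pullback:
  assumes "x \<in> U"
  shows "\<phi>1 x (christoffel G x a b) = christoffel H (\<phi> x) (\<phi>1 x a) (\<phi>1 x b) + \<phi>2 x a b"
proof -
  note m = mem[OF assms]
  have "christoffel H (\<phi> x) (\<phi>1 x a) (\<phi>1 x b) = \<phi>1 x (christoffel G x a b) - \<phi>2 x a b"
  proof (rule t.christoffel_eqI[OF m(2)])
    fix w
    obtain w' where w: "w = \<phi>1 x w'" using surj_\<phi>[OF assms] by (metis surjD)
    have "H (\<phi> x) (\<phi>1 x (christoffel G x a b) - \<phi>2 x a b) w = koszul G x a b w' - H (\<phi> x) (\<phi>2 x a b) w"
      using m by (simp add: t.G_bilinear_simps w isometric[OF assms, symmetric] s.christoffel_koszul)
    also have "\<dots> = koszul H (\<phi> x) (\<phi>1 x a) (\<phi>1 x b) w"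
      unfolding koszul_def bform1_pullback[OF assms] w
      using m \<phi>2_sym[OF assms, of b a] \<phi>2_sym[OF assms, of w' a] \<phi>2_sym[OF assms, of w' b]
         t.sym_G[OF m(2), of "\<phi>1 x a"] t.sym_G[OF m(2), of "\<phi>1 x b"]
      by (simp add: field_simps)
    finally show "H (\<phi> x) (\<phi>1 x (christoffel G x a b) - \<phi>2 x a b) w = koszul H (\<phi> x) (\<phi>1 x a) (\<phi>1 x b) w" .
  qed
  then show ?thesis by simp
qed

text \<open>Third derivatives of \<phi> cancel because they are symmetric (\<open>s3\<close>). The
  terms with one second derivative of \<phi> are matched by the inhomogeneous parts of the
  Christoffel symbols, and the products of two such derivatives cancel as well.\<close>

lemma Rm_pullback:
  assumes "x \<in> U"
  shows "Rm G x v t = Rm H (\<phi> x) (\<phi>1 x v) (\<phi>1 x t)"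
proof -
  note m = mem[OF assms]
  define p where "p = \<phi>1 x v"
  define q where "q = \<phi>1 x t"
  define \<alpha> where "\<alpha> = \<phi>2 x v v"
  define \<beta> where "\<beta> = \<phi>2 x v t"
  define \<tau> where "\<tau> = \<phi>2 x t t"
  define y where "y = \<phi> x"
  have y: "y \<in> T" using m y_def by simp
  let ?h = "H y" and ?h1 = "bform1 H y" and ?h2 = "bform2 H y"
  let ?C = "christoffel H y"
  have \<beta>': "\<phi>2 x t v = \<beta>" using \<phi>2_sym[OF assms] \<beta>_def by metis
  have e1: "bform2 G x v t t v = ?h2 p q q p + ?h1 \<beta> q p + ?h1 q \<beta> p + ?h1 q q \<alpha>
     + ?h1 p \<tau> p + ?h1 p q \<beta> + ?h (\<phi>3 x v t t) p + ?h q (\<phi>3 x v t v) + ?h \<tau> \<alpha> + ?h \<beta> \<beta>"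
    unfolding bform2_pullback[OF assms]
    by (simp add: y flip: p_def q_def \<alpha>_def \<beta>_def \<tau>_def y_def add: \<beta>')
  have e2: "bform2 G x v v t t = ?h2 p p q q + ?h1 \<alpha> q q + 4 * ?h1 p \<beta> q + 2 * ?h (\<phi>3 x v v t) q + 2 * ?h \<beta> \<beta>"
    unfolding bform2_pullback[OF assms]
    using t.bform1_sym[OF y, of p \<beta> q] t.sym_G[OF y, of q]
    by (simp add: y flip: p_def q_def \<alpha>_def \<beta>_def \<tau>_def y_def add: \<beta>')
  have e3: "bform2 G x t t v v = ?h2 q q p p + ?h1 \<tau> p p + 4 * ?h1 q \<beta> p + 2 * ?h (\<phi>3 x t t v) p + 2 * ?h \<beta> \<beta>"
    unfolding bform2_pullback[OF assms]
    using t.bform1_sym[OF y, of q \<beta> p] t.sym_G[OF y, of p]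
    by (simp add: y flip: p_def q_def \<alpha>_def \<beta>_def \<tau>_def y_def add: \<beta>')
  have s3: "?h q (\<phi>3 x v t v) = ?h (\<phi>3 x v v t) q" "?h (\<phi>3 x v t t) p = ?h (\<phi>3 x t t v) p"
    using \<phi>3_sym[OF assms] t.sym_G[OF y] by metis+
  have e4: "G x (christoffel G x v v) (christoffel G x t t) = ?h (?C p p + \<alpha>) (?C q q + \<tau>)"
    unfolding isometric[OF assms] christoffel_pullback[OF assms]
    by (simp flip: p_def q_def \<alpha>_def \<tau>_def y_def)
  have e5: "G x (christoffel G x v t) (christoffel G x v t) = ?h (?C p q + \<beta>) (?C p q + \<beta>)"
    unfolding isometric[OF assms] christoffel_pullback[OF assms]
    by (simp flip: p_def q_def \<beta>_def y_def)
  have f4: "?h (?C p p + \<alpha>) (?C q q + \<tau>) = ?h (?C p p) (?C q q) + koszul H y p p \<tau> + koszul H y q q \<alpha> + ?h \<tau> \<alpha>"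
    using t.sym_G[OF y, of \<alpha>] by (simp add: t.G_bilinear_simps t.christoffel_koszul y)
  have f5: "?h (?C p q + \<beta>) (?C p q + \<beta>) = ?h (?C p q) (?C p q) + 2 * koszul H y p q \<beta> + ?h \<beta> \<beta>"
    using t.sym_G[OF y, of \<beta> "?C p q"] by (simp add: t.G_bilinear_simps t.christoffel_koszul y)
  have "Rm G x v t = Rm H y p q"
    unfolding Rm_def e1 e2 e3 e4 e5 f4 f5 s3 koszul_def
    using t.bform1_sym[OF y, of q p \<beta>] t.bform1_sym[OF y, of p \<beta> q] t.bform1_sym[OF y, of \<beta> p q]
       t.bform1_sym[OF y, of p \<tau> p] t.bform1_sym[OF y, of q \<alpha> q]
    by (simp add: field_simps)
  then show ?thesis by (simp add: p_def q_def y_def)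
qed

text \<open>Differentiating \<open>eq\<close> gives an extra term with the second derivative of
  \<phi>; it is exactly the one by which the derivative of the metric changes.\<close>

lemma lie_pullback:
  assumes x: "x \<in> U" and Z: "Z differentiable (at x)" "Z' differentiable (at (\<phi> x))"
    and eq: "\<And>y. y \<in> U \<Longrightarrow> Z' (\<phi> y) = \<phi>1 y (Z y)"
  shows "bform1 G x (Z x) v v + 2 * G x (dB Z x v) v =
    bform1 H (\<phi> x) (Z' (\<phi> x)) (\<phi>1 x v) (\<phi>1 x v) + 2 * H (\<phi> x) (dB Z' (\<phi> x) (\<phi>1 x v)) (\<phi>1 x v)"
proof -
  note m = mem[OF x]
  have 1: "((\<lambda>y. Z' (\<phi> y)) has_derivative (\<lambda>u. dB Z' (\<phi> x) (\<phi>1 x u))) (at x)"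
    by (rule has_derivative_compose[OF \<phi>_deriv(1)[OF x] has_derivative_dB[OF Z(2)]])
  have 2: "((\<lambda>y. \<phi>1 y (Z y)) has_derivative (\<lambda>u. \<phi>1 x (dB Z x u) + \<phi>2 x u (Z x))) (at x)"
    using \<phi>_deriv[OF x] has_derivative_dB[OF Z(1)]
    by (auto intro!: derivative_eq_intros simp: blinfun.bilinear_simps)
  have "D (\<lambda>y. Z' (\<phi> y)) x = D (\<lambda>y. \<phi>1 y (Z y)) x"
    by (rule D_cong_open[OF open_U x eq])
  then have 3: "dB Z' (\<phi> x) (\<phi>1 x v) = \<phi>1 x (dB Z x v) + \<phi>2 x v (Z x)"
    unfolding D_eqI[OF 1] D_eqI[OF 2] by metis
  show ?thesis
    unfolding 3 eq[OF x] bform1_pullback[OF x] isometric[OF x]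
    using t.sym_G[OF m(2), of "\<phi>1 x v"] \<phi>2_sym[OF x, of v]
    by (simp add: m t.G_bilinear_simps)
qed

text \<open>The second derivative of the composite picks up \<open>dB F'\<close> applied to the
  second derivative of \<phi>, which the inhomogeneous part of the Christoffel symbol
  removes.\<close>

lemma hess_pullback:
  assumes x: "x \<in> U" and F: "smooth_on S F" "smooth_on T F'"
    and eq: "\<And>y. y \<in> U \<Longrightarrow> F y = F' (\<phi> y)"
  shows "dB F x v = dB F' (\<phi> x) (\<phi>1 x v)"
    "dB (dB F) x v v - dB F x (christoffel G x v v) =
     dB (dB F') (\<phi> x) (\<phi>1 x v) (\<phi>1 x v) - dB F' (\<phi> x) (christoffel H (\<phi> x) (\<phi>1 x v) (\<phi>1 x v))"
proof -
  note m = mem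
  have 1: "dB F y u = dB F' (\<phi> y) (\<phi>1 y u)" if y: "y \<in> U" for y u
  proof -
    have "((\<lambda>y. F' (\<phi> y)) has_derivative (\<lambda>u. dB F' (\<phi> y) (\<phi>1 y u))) (at y)"
      by (rule has_derivative_compose[OF \<phi>_deriv(1)[OF y] smooth_on_has_derivative[OF F(2) m(2)[OF y]]])
    from D_eqI[OF this] show ?thesis
      using D_cong_open[OF open_U y, of F "\<lambda>y. F' (\<phi> y)"] eq smooth_on_D_eq[OF F(1) m(1)[OF y]] by simp
  qed
  then show "dB F x v = dB F' (\<phi> x) (\<phi>1 x v)" using x .
  have d: "((\<lambda>y. dB F' (\<phi> y)) has_derivative (\<lambda>u. dB (dB F') (\<phi> x) (\<phi>1 x u))) (at x)"
    by (rule has_derivative_compose[OF \<phi>_deriv(1)[OF x]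
          smooth_on_has_derivative[OF smooth_on_dB[OF t.open_S F(2)] m(2)[OF x]]])
  have 2: "((\<lambda>y. dB F' (\<phi> y) (\<phi>1 y v)) has_derivative
     (\<lambda>u. dB (dB F') (\<phi> x) (\<phi>1 x u) (\<phi>1 x v) + dB F' (\<phi> x) (\<phi>2 x u v))) (at x)"
    using \<phi>_deriv[OF x] d
    by (auto intro!: derivative_eq_intros simp: blinfun.bilinear_simps)
  have 3: "((\<lambda>y. dB F y v) has_derivative (\<lambda>u. dB (dB F) x u v)) (at x)"
    using smooth_on_has_derivative[OF smooth_on_dB[OF s.open_S F(1)] m(1)[OF x]]
    by (auto intro!: derivative_eq_intros simp: blinfun.bilinear_simps)
  have "D (\<lambda>y. dB F y v) x = D (\<lambda>y. dB F' (\<phi> y) (\<phi>1 y v)) x"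
    by (rule D_cong_open[OF open_U x 1])
  then have "dB (dB F) x v v = dB (dB F') (\<phi> x) (\<phi>1 x v) (\<phi>1 x v) + dB F' (\<phi> x) (\<phi>2 x v v)"
    unfolding D_eqI[OF 2] D_eqI[OF 3] by metis
  then show "dB (dB F) x v v - dB F x (christoffel G x v v) =
     dB (dB F') (\<phi> x) (\<phi>1 x v) (\<phi>1 x v) - dB F' (\<phi> x) (christoffel H (\<phi> x) (\<phi>1 x v) (\<phi>1 x v))"
    unfolding 1[OF x] christoffel_pullback[OF x] by (simp add: blinfun.bilinear_simps)
qed

end

section \<open>Short geodesics and parallel fields\<close>

text \<open>Contraction principle with constant 1/2 in the ball of radius \<rho> among bounded
  continuous functions. The Banach space consists of functions on the whole line, so
  \<open>E\<close> extends the values of \<open>H\<close> constantly beyond the unit interval by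
  \<open>clamp\<close>.\<close>

lemma integral_equation_solution:
  fixes H :: "(real \<Rightarrow> 'e::banach) \<Rightarrow> real \<Rightarrow> 'e"
  assumes "\<rho> \<ge> 0"
    and H: "\<And>u. continuous_on {0..1} u \<Longrightarrow> (\<And>t. t \<in> {0..1} \<Longrightarrow> norm (u t) \<le> \<rho>) \<Longrightarrow>
      continuous_on {0..1} (H u) \<and> (\<forall>t\<in>{0..1}. norm (H u t) \<le> \<rho>)"
    and contr: "\<And>u v d. continuous_on {0..1} u \<Longrightarrow> (\<And>t. t \<in> {0..1} \<Longrightarrow> norm (u t) \<le> \<rho>) \<Longrightarrow>
      continuous_on {0..1} v \<Longrightarrow> (\<And>t. t \<in> {0..1} \<Longrightarrow> norm (v t) \<le> \<rho>) \<Longrightarrow>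
      (\<And>t. t \<in> {0..1} \<Longrightarrow> norm (u t - v t) \<le> d) \<Longrightarrow> \<forall>t\<in>{0..1}. norm (H u t - H v t) \<le> d / 2"
  shows "\<exists>u. continuous_on {0..1} u \<and> (\<forall>t\<in>{0..1}. norm (u t) \<le> \<rho>) \<and> (\<forall>t\<in>{0..1}. u t = H u t)"
proof -
  define P where "P w g \<longleftrightarrow> (\<forall>t\<in>cbox 0 1. apply_bcontfun g t = H (apply_bcontfun w) t) \<and>
    (\<forall>t. apply_bcontfun g t = H (apply_bcontfun w) (clamp 0 1 t))" for w g :: "real \<Rightarrow>\<^sub>C 'e"
  define E where "E w = (SOME g. P w g)" for w
  let ?S = "cball 0 \<rho> :: (real \<Rightarrow>\<^sub>C 'e) set"
  have bd: "norm (w t) \<le> \<rho>" if "w \<in> ?S" for w t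
    using that norm_bounded[of w t] by simp
  have E: "(\<forall>t\<in>cbox 0 1. E w t = H (apply_bcontfun w) t) \<and> (\<forall>t. E w t = H (apply_bcontfun w) (clamp 0 1 t))"
    if "w \<in> ?S" for w
  proof -
    have "continuous_on (cbox 0 1) (H (apply_bcontfun w))"
      using H[of w] bd[OF that] by auto
    then obtain g :: "real \<Rightarrow>\<^sub>C 'e" where "\<And>t. t \<in> cbox 0 1 \<Longrightarrow> apply_bcontfun g t = H (apply_bcontfun w) t"
      "\<And>t. apply_bcontfun g t = H (apply_bcontfun w) (clamp 0 1 t)"
      by (rule continuous_on_cbox_bcontfunE) blast
    then have "P w g" by (simp add: P_def)
    then have "P w (E w)" unfolding E_def by (rule someI)
    then show ?thesis by (simp add: P_def)
  qed
  have cl: "clamp 0 1 t \<in> {0..1::real}" for t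
    using clamp_in_interval[of 0 1 t] by simp
  have "\<exists>!w\<in>?S. E w = w"
  proof (rule Banach_fix[where c = "1/2"])
    show "complete ?S" by (simp add: complete_eq_closed)
    show "?S \<noteq> {}" using assms(1) by auto
    show "E ` ?S \<subseteq> ?S"
    proof
      fix g assume "g \<in> E ` ?S"
      then obtain w where w: "w \<in> ?S" "g = E w" by blast
      have "norm (E w t) \<le> \<rho>" for t
        using E[OF w(1)] H[of w] bd[OF w(1)] cl[of t] by simp
      from norm_bound[OF this] show "g \<in> ?S" using w(2) by simp
    qed
    show "dist (E w) (E z) \<le> 1/2 * dist w z" if "w \<in> ?S" "z \<in> ?S" for w z
    proof (rule dist_bound)
      fix t
      have "norm (w s - z s) \<le> dist w z" for s
        using dist_bounded[of w s z] by (simp add: dist_norm)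
      then have "\<forall>t\<in>{0..1}. norm (H w t - H z t) \<le> dist w z / 2"
        using contr[of w z] bd that by auto
      then show "dist (E w t) (E z t) \<le> 1/2 * dist w z"
        using E that cl[of t] by (simp add: dist_norm)
    qed
  qed auto
  then obtain w where w: "w \<in> ?S" "E w = w" by blast
  have "w t = H w t" if "t \<in> {0..1}" for t
    using E[OF w(1)] w(2) that by (metis cbox_interval)
  then show ?thesis using bd[OF w(1)] by (intro exI[of _ "apply_bcontfun w"] conjI ballI continuous_on_apply_bcontfun) blast+
qed

lemma (in chart_metric) christoffel_expand:
  assumes "x \<in> S"
  shows "\<Gamma> x a b = (\<Sum>i\<in>Basis. \<Sum>j\<in>Basis. ((a \<bullet> i) * (b \<bullet> j)) *\<^sub>R \<Gamma> x i j)"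
proof -
  have l: "linear (\<lambda>a. \<Gamma> x a c)" "linear (\<lambda>a. \<Gamma> x c a)" for c
    using christoffel_bilinear_simps[OF assms] by (auto intro!: linearI)
  have "\<Gamma> x a b = \<Gamma> x (\<Sum>i\<in>Basis. (a \<bullet> i) *\<^sub>R i) (\<Sum>j\<in>Basis. (b \<bullet> j) *\<^sub>R j)"
    by (simp add: euclidean_representation)
  also have "\<dots> = (\<Sum>i\<in>Basis. \<Sum>j\<in>Basis. ((a \<bullet> i) * (b \<bullet> j)) *\<^sub>R \<Gamma> x i j)"
    by (simp add: linear_sum[OF l(1)] linear_sum[OF l(2)] christoffel_bilinear_simps[OF assms] scaleR_sum_right,
        subst sum.swap, simp add: mult.commute)
  finally show ?thesis .
qed

text \<open>For fixed vectors the symbol is continuous in the point; its basis expansion has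
  finitely many such terms, with coefficients continuous along \<open>a\<close> and
  \<open>b\<close>.\<close>

lemma (in chart_metric) continuous_on_christoffel:
  assumes "continuous_on T x" "continuous_on T a" "continuous_on T b" "x ` T \<subseteq> S"
  shows "continuous_on T (\<lambda>t. \<Gamma> (x t) (a t) (b t))"
proof -
  have c: "continuous_on S (\<lambda>y. \<Gamma> y i j)" for i j
    using christoffel_differentiable differentiable_imp_continuous_within
    by (blast intro: continuous_at_imp_continuous_on)
  have "continuous_on T (\<lambda>t. \<Gamma> (x t) i j)" for i j
    by (rule continuous_on_compose2[OF c assms(1,4)])
  then have "continuous_on T (\<lambda>t. \<Sum>i\<in>Basis. \<Sum>j\<in>Basis. ((a t \<bullet> i) * (b t \<bullet> j)) *\<^sub>R \<Gamma> (x t) i j)"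
    by (intro continuous_intros assms)
  moreover have "\<Gamma> (x t) (a t) (b t) = (\<Sum>i\<in>Basis. \<Sum>j\<in>Basis. ((a t \<bullet> i) * (b t \<bullet> j)) *\<^sub>R \<Gamma> (x t) i j)" if "t \<in> T" for t
    using christoffel_expand assms(4) that by blast
  ultimately show ?thesis by (simp cong: continuous_on_cong_simp)
qed

lemma mult_mono3: "0 \<le> c \<Longrightarrow> 0 \<le> a \<Longrightarrow> 0 \<le> b \<Longrightarrow> a \<le> a' \<Longrightarrow> b \<le> b' \<Longrightarrow> c * a * b \<le> c * a' * b'"
  for a b c :: real
  by (intro mult_mono) auto

lemma mult_mono4: "0 \<le> c \<Longrightarrow> 0 \<le> a \<Longrightarrow> 0 \<le> b \<Longrightarrow> 0 \<le> d \<Longrightarrow> a \<le> a' \<Longrightarrow> b \<le> b' \<Longrightarrow> d \<le> d' \<Longrightarrow>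
    c * a * b * d \<le> c * a' * b' * d'"
  for a b c d :: real
  by (intro mult_mono) auto

lemma norm_triangle3: "norm (a + b + c) \<le> norm a + norm b + norm c"
  using norm_triangle_ineq[of "a + b" c] norm_triangle_ineq[of a b] by linarith

definition geodesic :: "'e::euclidean_space set \<Rightarrow> ('e \<Rightarrow> 'e \<Rightarrow> 'e \<Rightarrow> real) \<Rightarrow> (real \<Rightarrow> 'e) \<Rightarrow> (real \<Rightarrow> 'e) \<Rightarrow> bool" where
  "geodesic S G x x' \<longleftrightarrow> (\<forall>t\<in>{0..1}. x t \<in> S \<and> (x has_vector_derivative x' t) (at t within {0..1}) \<and>
     (x' has_vector_derivative - christoffel G (x t) (x' t) (x' t)) (at t within {0..1}))"

definition parallel_along :: "('e::euclidean_space \<Rightarrow> 'e \<Rightarrow> 'e \<Rightarrow> real) \<Rightarrow> (real \<Rightarrow> 'e) \<Rightarrow> (real \<Rightarrow> 'e) \<Rightarrow> (real \<Rightarrow> 'e) \<Rightarrow> bool" where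
  "parallel_along G x x' V \<longleftrightarrow>
     (\<forall>t\<in>{0..1}. (V has_vector_derivative - christoffel G (x t) (x' t) (V t)) (at t within {0..1}))"

text \<open>Existence of parallel transport is recorded together with each geodesic piece:
  \<open>ex_parallel\<close> obtains it by contraction, where the velocity is small.\<close>

definition transportable :: "('e::euclidean_space \<Rightarrow> 'e \<Rightarrow> 'e \<Rightarrow> real) \<Rightarrow> (real \<Rightarrow> 'e) \<Rightarrow> (real \<Rightarrow> 'e) \<Rightarrow> bool" where
  "transportable G x x' \<longleftrightarrow> (\<forall>v. \<exists>V. parallel_along G x x' V \<and> V 0 = v)"

definition energy :: "('e::euclidean_space \<Rightarrow> 'e \<Rightarrow> 'e \<Rightarrow> real) \<Rightarrow> (real \<Rightarrow> 'e) \<Rightarrow> (real \<Rightarrow> 'e) \<Rightarrow> real" where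
  "energy G x x' = integral {0..1} (\<lambda>t. G (x t) (x' t) (x' t))"

lemma continuous_on_vector_derivative:
  "(\<And>t. t \<in> T \<Longrightarrow> (f has_vector_derivative f' t) (at t within T)) \<Longrightarrow> continuous_on T f"
  by (meson continuous_on_eq_continuous_within has_vector_derivative_continuous)

lemma integral_norm_le:
  fixes f :: "real \<Rightarrow> 'e::banach"
  assumes "continuous_on {0..1} f" "\<And>t. t \<in> {0..1} \<Longrightarrow> norm (f t) \<le> B" "t \<in> {0..1}"
  shows "norm (integral {0..t} f) \<le> B"
proof -
  have "norm (integral {0..t} f) \<le> B * (t - 0)"
    using assms by (intro integral_bound) (auto intro: continuous_on_subset)
  also have "\<dots> \<le> B"
    using assms(3) order_trans[OF norm_ge_zero assms(2)[OF assms(3)]] by (simp add: mult_left_le)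
  finally show ?thesis .
qed

section \<open>Existence of short geodesics and of parallel fields\<close>

context chart_metric
begin

text \<open>Both bounds come from testing the Koszul formula with the vector to be estimated and
  dividing by the coercivity constant. For the difference of two symbols, the change of the form
  itself contributes the summand \<open>C * M\<close> in \<open>N\<close>.\<close>

lemma christoffel_bounds:
  assumes "cball x0 R \<subseteq> S"
  shows "\<exists>C>0. (\<forall>x\<in>cball x0 R. \<forall>a b. norm (\<Gamma> x a b) \<le> C * norm a * norm b) \<and>
    (\<forall>x\<in>cball x0 R. \<forall>y\<in>cball x0 R. \<forall>a b. norm (\<Gamma> x a b - \<Gamma> y a b) \<le> C * norm (x - y) * norm a * norm b)"
proof -
  let ?K = "cball x0 R"
  obtain l where l: "l > 0" "\<And>x a. x \<in> ?K \<Longrightarrow> l * (norm a)\<^sup>2 \<le> G x a a"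
    using ex_lower_bound[OF compact_cball assms] by blast
  obtain C where C: "C > 0" "\<And>x. x \<in> ?K \<Longrightarrow> norm (bform G x) \<le> C"
     "\<And>x. x \<in> ?K \<Longrightarrow> norm (bform1 G x) \<le> C" "\<And>x. x \<in> ?K \<Longrightarrow> norm (bform2 G x) \<le> C"
    using ex_upper_bound[OF compact_cball assms] by blast
  have est: "norm z \<le> B / l" if "x \<in> ?K" "G x z z \<le> B * norm z" "B \<ge> 0" for x z B
  proof (cases "z = 0")
    case True then show ?thesis using that l by simp
  next
    case False
    have "l * norm z * norm z \<le> B * norm z" using l(2)[OF that(1), of z] that(2) by (simp add: power2_eq_square mult.assoc)
    then show ?thesis using False l(1) by (simp add: field_simps)
  qed
  have b1: "\<bar>bform1 G x u a b\<bar> \<le> C * norm u * norm a * norm b" if "x \<in> ?K" for x u a b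
  proof -
    have "\<bar>bform1 G x u a b\<bar> \<le> norm (bform1 G x) * norm u * norm a * norm b"
      using norm_blinfun_apply3[of "bform1 G x"] by simp
    also have "\<dots> \<le> C * norm u * norm a * norm b"
      by (intro mult_right_mono C that norm_ge_zero)
    finally show ?thesis .
  qed
  have lip: "norm (bform G x - bform G y) \<le> C * norm (x - y)" "norm (bform1 G x - bform1 G y) \<le> C * norm (x - y)"
    if "x \<in> ?K" "y \<in> ?K" for x y
    using that assms C
    by (auto intro!: differentiable_bound[of ?K _ "\<lambda>x. blinfun_apply (bform1 G x)"]
       differentiable_bound[of ?K _ "\<lambda>x. blinfun_apply (bform2 G x)"]
       has_derivative_at_withinI bform_deriv bform1_deriv simp flip: norm_blinfun.rep_eq)
  have k1: "\<bar>koszul G x a b w\<bar> \<le> 2 * C * norm a * norm b * norm w" if "x \<in> ?K" for x a b w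
    using b1[OF that, of a b w] b1[OF that, of b a w] b1[OF that, of w a b]
    unfolding koszul_def by (simp add: mult_ac)
  define M where "M = 2 * C / l"
  have M: "M > 0" using C l by (simp add: M_def)
  have \<Gamma>1: "norm (\<Gamma> x a b) \<le> M * norm a * norm b" if "x \<in> ?K" for x a b
  proof -
    have "G x (\<Gamma> x a b) (\<Gamma> x a b) \<le> 2 * C * norm a * norm b * norm (\<Gamma> x a b)"
      using k1[OF that, of a b "\<Gamma> x a b"] christoffel_koszul[of x a b] that assms by (simp add: abs_le_iff subset_iff)
    from est[OF that this] show ?thesis using C by (simp add: M_def mult_ac)
  qed
  define N where "N = (2 * C + C * M) / l"
  have \<Gamma>2: "norm (\<Gamma> x a b - \<Gamma> y a b) \<le> N * norm (x - y) * norm a * norm b" if "x \<in> ?K" "y \<in> ?K" for x y a b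
  proof -
    define z where "z = \<Gamma> x a b - \<Gamma> y a b"
    have xy: "x \<in> S" "y \<in> S" using that assms by auto
    have kd: "\<bar>koszul G x a b z - koszul G y a b z\<bar> \<le> 2 * C * norm (x - y) * norm a * norm b * norm z"
    proof -
      have d: "\<bar>bform1 G x u p q - bform1 G y u p q\<bar> \<le> C * norm (x - y) * norm u * norm p * norm q" for u p q
      proof -
        have "\<bar>bform1 G x u p q - bform1 G y u p q\<bar> = norm ((bform1 G x - bform1 G y) u p q)"
          by (simp add: blinfun.bilinear_simps)
        also have "\<dots> \<le> norm (bform1 G x - bform1 G y) * norm u * norm p * norm q" by (rule norm_blinfun_apply3)
        also have "\<dots> \<le> C * norm (x - y) * norm u * norm p * norm q"
          by (intro mult_right_mono lip that norm_ge_zero)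
        finally show ?thesis .
      qed
      define N where "N = C * norm (x - y) * norm a * norm b * norm z"
      have "\<bar>bform1 G x a b z - bform1 G y a b z\<bar> \<le> N" "\<bar>bform1 G x b a z - bform1 G y b a z\<bar> \<le> N"
         "\<bar>bform1 G x z a b - bform1 G y z a b\<bar> \<le> N" "N \<ge> 0"
        using d[of a b z] d[of b a z] d[of z a b] C(1) by (simp_all add: N_def mult_ac)
      then have "\<bar>koszul G x a b z - koszul G y a b z\<bar> \<le> 2 * N"
        unfolding koszul_def by argo
      then show ?thesis by (simp add: N_def mult_ac)
    qed
    have gd: "\<bar>(bform G x - bform G y) (\<Gamma> y a b) z\<bar> \<le> C * M * norm (x - y) * norm a * norm b * norm z"
    proof -
      have "norm ((bform G x - bform G y) (\<Gamma> y a b) z) \<le> norm (bform G x - bform G y) * norm (\<Gamma> y a b) * norm z"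
        by (rule norm_blinfun_apply2)
      also have "\<dots> \<le> (C * norm (x - y)) * (M * norm a * norm b) * norm z"
        by (intro mult_mono lip \<Gamma>1 that norm_ge_zero order_refl mult_nonneg_nonneg) (use C M in auto)
      finally show ?thesis by (simp add: mult_ac)
    qed
    have "G x z z = koszul G x a b z - koszul G y a b z - (bform G x - bform G y) (\<Gamma> y a b) z"
      using xy christoffel_koszul[OF xy(1), of a b z] christoffel_koszul[OF xy(2), of a b z]
      unfolding z_def by (simp add: G_bilinear_simps blinfun.bilinear_simps)
    also have "\<dots> \<le> ((2 * C + C * M) * norm (x - y) * norm a * norm b) * norm z"
      using kd gd by (simp add: algebra_simps)
    finally have "norm z \<le> ((2 * C + C * M) * norm (x - y) * norm a * norm b) / l"
      using C M by (intro est[OF that(1)]) auto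
    then show ?thesis unfolding z_def N_def by simp
  qed
  have "2 * C + C * M > 0" using C(1) M by (simp add: add_pos_pos)
  then have N: "N > 0" using l(1) by (simp add: N_def)
  have "norm (\<Gamma> x a b) \<le> (M + N) * norm a * norm b" if "x \<in> ?K" for x a b
  proof -
    have "M * norm a * norm b \<le> (M + N) * norm a * norm b" using N by (intro mult_right_mono) auto
    then show ?thesis using \<Gamma>1[OF that, of a b] by linarith
  qed
  moreover have "norm (\<Gamma> x a b - \<Gamma> y a b) \<le> (M + N) * norm (x - y) * norm a * norm b" if "x \<in> ?K" "y \<in> ?K" for x y a b
  proof -
    have "N * norm (x - y) * norm a * norm b \<le> (M + N) * norm (x - y) * norm a * norm b" using M by (intro mult_right_mono) auto
    then show ?thesis using \<Gamma>2[OF that, of a b] by linarith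
  qed
  ultimately show ?thesis using M N by (intro exI[of _ "M + N"]) auto
qed

text \<open>Small connection coefficients along the curve make the integral operator a contraction
  on the whole unit interval and keep it in the ball of radius \<open>2 * norm v\<close>.\<close>

lemma ex_parallel:
  assumes "continuous_on {0..1} x" "continuous_on {0..1} x'" "x ` {0..1} \<subseteq> S"
    and small: "\<And>t v. t \<in> {0..1} \<Longrightarrow> norm (\<Gamma> (x t) (x' t) v) \<le> norm v / 2"
  shows "transportable G x x'"
  unfolding transportable_def
proof
  fix v
  define H where "H V t = v - integral {0..t} (\<lambda>s. \<Gamma> (x s) (x' s) (V s))" for V t
  have ci: "continuous_on {0..1} (\<lambda>s. \<Gamma> (x s) (x' s) (V s))" if "continuous_on {0..1} V" for V
    by (intro continuous_on_christoffel assms that)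
  have "\<exists>u. continuous_on {0..1} u \<and> (\<forall>t\<in>{0..1}. norm (u t) \<le> 2 * norm v) \<and> (\<forall>t\<in>{0..1}. u t = H u t)"
  proof (rule integral_equation_solution)
    fix u :: "real \<Rightarrow> 'e" assume u: "continuous_on {0..1} u" "\<And>t. t \<in> {0..1} \<Longrightarrow> norm (u t) \<le> 2 * norm v"
    have "norm (\<Gamma> (x s) (x' s) (u s)) \<le> norm v" if "s \<in> {0..1}" for s
      using small[OF that, of "u s"] u(2)[OF that] by linarith
    then have "norm (integral {0..t} (\<lambda>s. \<Gamma> (x s) (x' s) (u s))) \<le> norm v" if "t \<in> {0..1}" for t
      using integral_norm_le[OF ci[OF u(1)] _ that] by blast
    then have "norm (H u t) \<le> 2 * norm v" if "t \<in> {0..1}" for t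
      using that norm_triangle_ineq4[of v "integral {0..t} (\<lambda>s. \<Gamma> (x s) (x' s) (u s))"] unfolding H_def by fastforce
    moreover have "continuous_on {0..1} (H u)"
      unfolding H_def
      by (intro continuous_intros indefinite_integral_continuous_1 integrable_continuous_interval ci u)
    ultimately show "continuous_on {0..1} (H u) \<and> (\<forall>t\<in>{0..1}. norm (H u t) \<le> 2 * norm v)" by blast
  next
    fix u w :: "real \<Rightarrow> 'e" and d
    assume u: "continuous_on {0..1} u" "continuous_on {0..1} w" "\<And>t. t \<in> {0..1} \<Longrightarrow> norm (u t - w t) \<le> d"
    show "\<forall>t\<in>{0..1}. norm (H u t - H w t) \<le> d / 2"
    proof
      fix t :: real assume t: "t \<in> {0..1}"
      have int: "(\<lambda>s. \<Gamma> (x s) (x' s) (u s)) integrable_on {0..t}" if "continuous_on {0..1} u" for u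
        by (rule integrable_continuous_interval, rule continuous_on_subset[OF ci[OF that]]) (use t in auto)
      have "H u t - H w t = integral {0..t} (\<lambda>s. \<Gamma> (x s) (x' s) (w s) - \<Gamma> (x s) (x' s) (u s))"
        unfolding H_def by (simp add: integral_diff int u)
      also have "norm \<dots> \<le> d / 2"
      proof (rule integral_norm_le[OF _ _ t])
        show "continuous_on {0..1} (\<lambda>s. \<Gamma> (x s) (x' s) (w s) - \<Gamma> (x s) (x' s) (u s))"
          by (intro continuous_intros ci u)
        fix s :: real assume s: "s \<in> {0..1}"
        then have xs: "x s \<in> S" using assms(3) by blast
        have "norm (\<Gamma> (x s) (x' s) (w s) - \<Gamma> (x s) (x' s) (u s)) \<le> norm (w s - u s) / 2"
          using small[OF s, of "w s - u s"] by (simp add: christoffel_bilinear_simps[OF xs])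
        then show "norm (\<Gamma> (x s) (x' s) (w s) - \<Gamma> (x s) (x' s) (u s)) \<le> d / 2"
          using u(3)[OF s] by (simp add: norm_minus_commute)
      qed
      finally show "norm (H u t - H w t) \<le> d / 2" .
    qed
  qed auto
  then obtain V where V: "continuous_on {0..1} V" "\<And>t. t \<in> {0..1} \<Longrightarrow> V t = H V t" by blast
  have "parallel_along G x x' V"
    unfolding parallel_along_def
  proof
    fix t :: real assume t: "t \<in> {0..1}"
    have "(H V has_vector_derivative 0 - \<Gamma> (x t) (x' t) (V t)) (at t within {0..1})"
      unfolding H_def
      by (intro has_vector_derivative_diff has_vector_derivative_const integral_has_vector_derivative ci V t)
    then show "(V has_vector_derivative - \<Gamma> (x t) (x' t) (V t)) (at t within {0..1})"
      using V(2) t by (auto intro: has_vector_derivative_transform)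
  qed
  moreover have "V 0 = v" using V(2)[of 0] by (simp add: H_def)
  ultimately show "\<exists>V. parallel_along G x x' V \<and> V 0 = v" by blast
qed

text \<open>The boundary value problem is solved with the velocity \<open>u\<close> as unknown: the
  curve \<open>X u\<close> is its integral, and the geodesic equation becomes a fixed point
  equation. One radius \<delta> serves all \<open>a\<close> in the half ball.\<close>

lemma ex_short_geodesic:
  assumes "R > 0" "cball x0 R \<subseteq> S" "\<epsilon> > 0"
  shows "\<exists>\<delta>>0. \<forall>a\<in>cball x0 (R/2). \<forall>b. norm (b - a) \<le> \<delta> \<longrightarrow>
    (\<exists>x x'. geodesic S G x x' \<and> x 0 = a \<and> x 1 = b \<and> transportable G x x' \<and>
       (\<forall>t\<in>{0..1}. x t \<in> cball x0 R \<and> norm (x' t) \<le> \<epsilon>))"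
proof -
  let ?K = "cball x0 R"
  obtain C where C: "C > 0" "\<And>x a b. x \<in> ?K \<Longrightarrow> norm (\<Gamma> x a b) \<le> C * norm a * norm b"
    "\<And>x y a b. x \<in> ?K \<Longrightarrow> y \<in> ?K \<Longrightarrow> norm (\<Gamma> x a b - \<Gamma> y a b) \<le> C * norm (x - y) * norm a * norm b"
    using christoffel_bounds[OF assms(2)] by metis
  \<comment> \<open>With speed at most \<open>2 * r\<close>, the entry R/4 keeps the curve in the
    ball, \<open>1/(32 * C)\<close> makes the Christoffel terms contracting, 1 controls the term
    quadratic in \<open>r\<close>, and \<epsilon>/2 yields the speed bound \<epsilon>.\<close>
  define \<delta> where "\<delta> = Min {R/4, 1, 1/(32 * C), \<epsilon>/2}"
  have \<delta>: "\<delta> > 0" "\<delta> \<le> R/4" "\<delta> \<le> 1" "\<delta> \<le> 1/(32 * C)" "\<delta> \<le> \<epsilon>/2"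
    using assms C unfolding \<delta>_def by auto
  have "\<exists>x x'. geodesic S G x x' \<and> x 0 = a \<and> x 1 = b \<and> transportable G x x' \<and>
       (\<forall>t\<in>{0..1}. x t \<in> ?K \<and> norm (x' t) \<le> \<epsilon>)"
    if a: "a \<in> cball x0 (R/2)" and r\<delta>: "norm (b - a) \<le> \<delta>" for a b
  proof -
    define r where "r = norm (b - a)"
    have "C * r \<le> C * \<delta>" using r\<delta> C(1) by (simp add: r_def)
    also have "\<dots> \<le> 1/32" using \<delta>(4) C(1) by (simp add: field_simps)
    finally have r: "r \<ge> 0" "r \<le> R/4" "r \<le> 1" "C * r \<le> 1/32" "2 * r \<le> \<epsilon>"
      using r\<delta> \<delta> by (auto simp: r_def)
    define X where "X u t = a + integral {0..t} u" for u and t :: real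
    define k where "k u t = integral {0..t} (\<lambda>s. \<Gamma> (X u s) (u s) (u s))" for u and t :: real
    \<comment> \<open>The constant term is chosen so that \<open>H u\<close> has integral
      \<open>b - a\<close>; hence a fixed point gives a curve ending exactly at
      \<open>b\<close>.\<close>
    define H where "H u t = (b - a) + integral {0..1} (k u) - k u t" for u t
    have X: "continuous_on {0..1} (X u)" if "continuous_on {0..1} u" for u
      unfolding X_def by (intro continuous_intros indefinite_integral_continuous_1 integrable_continuous_interval that)
    have XK: "X u t \<in> ?K" if u: "continuous_on {0..1} u" "\<And>t. t \<in> {0..1} \<Longrightarrow> norm (u t) \<le> 2 * r" and t: "t \<in> {0..1}" for u t
    proof -
      have "norm (integral {0..t} u) \<le> 2 * r" by (rule integral_norm_le[OF u t])
      then have "dist a (X u t) \<le> R/2" using r by (simp add: X_def dist_norm)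
      then show ?thesis using a dist_triangle[of x0 "X u t" a] by simp
    qed
    have ci: "continuous_on {0..1} (\<lambda>s. \<Gamma> (X u s) (u s) (u s))"
      if u: "continuous_on {0..1} u" "\<And>t. t \<in> {0..1} \<Longrightarrow> norm (u t) \<le> 2 * r" for u
      by (intro continuous_on_christoffel X u(1)) (use XK[OF u] assms(2) in blast)
    have k: "continuous_on {0..1} (k u)"
      if u: "continuous_on {0..1} u" "\<And>t. t \<in> {0..1} \<Longrightarrow> norm (u t) \<le> 2 * r" for u
      unfolding k_def by (intro indefinite_integral_continuous_1 integrable_continuous_interval ci[OF u])
    have "\<exists>u. continuous_on {0..1} u \<and> (\<forall>t\<in>{0..1}. norm (u t) \<le> 2 * r) \<and> (\<forall>t\<in>{0..1}. u t = H u t)"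
    proof (rule integral_equation_solution)
      show "0 \<le> 2 * r" using r by simp
      fix u :: "real \<Rightarrow> 'e" assume u: "continuous_on {0..1} u" "\<And>t. t \<in> {0..1} \<Longrightarrow> norm (u t) \<le> 2 * r"
      have "norm (\<Gamma> (X u s) (u s) (u s)) \<le> r / 2" if s: "s \<in> {0..1}" for s
      proof -
        have "norm (\<Gamma> (X u s) (u s) (u s)) \<le> C * norm (u s) * norm (u s)"
          by (rule C(2)[OF XK[OF u s]])
        also have "\<dots> \<le> C * (2 * r) * (2 * r)"
          using u(2)[OF s] r C(1) by (intro mult_mono mult_left_mono) auto
        also have "\<dots> = 4 * (C * r) * r" by simp
        also have "\<dots> \<le> 4 * (1/32) * r" using r by (intro mult_right_mono mult_left_mono) auto
        finally show ?thesis using r(1) by simp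
      qed
      then have kb: "norm (k u t) \<le> r/2" if "t \<in> {0..1}" for t
        unfolding k_def using integral_norm_le[OF ci[OF u] _ that] by blast
      have ikb: "norm (integral {0..1} (k u)) \<le> r/2"
        by (rule integral_norm_le[OF k[OF u] kb]) auto
      have "norm (H u t) \<le> 2 * r" if "t \<in> {0..1}" for t
      proof -
        have "norm (H u t) \<le> norm (b - a) + norm (integral {0..1} (k u)) + norm (k u t)"
          unfolding H_def by (meson add_mono norm_triangle_ineq norm_triangle_ineq4 order_refl order_trans)
        then show ?thesis using kb[OF that] ikb r_def by simp
      qed
      moreover have "continuous_on {0..1} (H u)"
        unfolding H_def by (intro continuous_intros k[OF u])
      ultimately show "continuous_on {0..1} (H u) \<and> (\<forall>t\<in>{0..1}. norm (H u t) \<le> 2 * r)" by blast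
    next
      fix u v :: "real \<Rightarrow> 'e" and d
      assume u: "continuous_on {0..1} u" "\<And>t. t \<in> {0..1} \<Longrightarrow> norm (u t) \<le> 2 * r"
        and v: "continuous_on {0..1} v" "\<And>t. t \<in> {0..1} \<Longrightarrow> norm (v t) \<le> 2 * r"
        and d: "\<And>t. t \<in> {0..1} \<Longrightarrow> norm (u t - v t) \<le> d"
      have d0: "d \<ge> 0" using order_trans[OF norm_ge_zero d[of 0]] by simp
      have Xd: "norm (X u t - X v t) \<le> d" if t: "t \<in> {0..1}" for t
      proof -
        have "X u t - X v t = integral {0..t} (\<lambda>s. u s - v s)"
        proof -
          have "{0..t} \<subseteq> {0..1}" using t by auto
          then have "u integrable_on {0..t}" "v integrable_on {0..t}"
            using u(1) v(1) continuous_on_subset integrable_continuous_interval by blast+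
          then show ?thesis unfolding X_def by (simp add: integral_diff)
        qed
        then show ?thesis
          using integral_norm_le[OF continuous_on_diff[OF u(1) v(1)] d t] by simp
      qed
      have \<Gamma>d: "norm (\<Gamma> (X u s) (u s) (u s) - \<Gamma> (X v s) (v s) (v s)) \<le> d/4" if s: "s \<in> {0..1}" for s
      proof -
        have m: "X u s \<in> ?K" "X v s \<in> ?K" using XK u v s by blast+
        then have mS: "X u s \<in> S" "X v s \<in> S" using assms(2) by auto
        note us = u(2)[OF s] v(2)[OF s] d[OF s] Xd[OF s]
        have eq: "\<Gamma> (X u s) (u s) (u s) - \<Gamma> (X v s) (v s) (v s) =
           (\<Gamma> (X u s) (u s) (u s) - \<Gamma> (X v s) (u s) (u s)) + \<Gamma> (X v s) (u s - v s) (u s) + \<Gamma> (X v s) (v s) (u s - v s)"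
          by (simp add: christoffel_bilinear_simps mS)
        have "norm (\<Gamma> (X u s) (u s) (u s) - \<Gamma> (X v s) (v s) (v s)) \<le>
           norm (\<Gamma> (X u s) (u s) (u s) - \<Gamma> (X v s) (u s) (u s)) + norm (\<Gamma> (X v s) (u s - v s) (u s))
           + norm (\<Gamma> (X v s) (v s) (u s - v s))"
          by (subst eq) (rule norm_triangle3)
        also have "\<dots> \<le> C * d * (2 * r) * (2 * r) + C * d * (2 * r) + C * (2 * r) * d"
        proof -
          note nn = norm_ge_zero[of "X u s - X v s"] norm_ge_zero[of "u s"] norm_ge_zero[of "v s"] norm_ge_zero[of "u s - v s"]
          have "norm (\<Gamma> (X u s) (u s) (u s) - \<Gamma> (X v s) (u s) (u s)) \<le> C * d * (2 * r) * (2 * r)"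
            using C(3)[OF m, of "u s" "u s"] mult_mono4[OF _ nn(1,2,2) us(4,1,1), of C] C(1) by linarith
          moreover have "norm (\<Gamma> (X v s) (u s - v s) (u s)) \<le> C * d * (2 * r)"
            using C(2)[OF m(2), of "u s - v s" "u s"] mult_mono3[OF _ nn(4,2) us(3,1), of C] C(1) by linarith
          moreover have "norm (\<Gamma> (X v s) (v s) (u s - v s)) \<le> C * (2 * r) * d"
            using C(2)[OF m(2), of "v s" "u s - v s"] mult_mono3[OF _ nn(3,4) us(2,3), of C] C(1) by linarith
          ultimately show ?thesis by linarith
        qed
        also have "\<dots> = (4 * (C * r) * r + 4 * (C * r)) * d" by (simp add: algebra_simps)
        also have "\<dots> \<le> (4 * (1/32) * 1 + 4 * (1/32)) * d"
        proof -
          have "C * r * r \<le> 1/32 * 1" using r C(1) by (intro mult_mono) auto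
          then show ?thesis using r(4) d0 by (intro mult_right_mono) auto
        qed
        finally show ?thesis by simp
      qed
      have kd: "norm (k u t - k v t) \<le> d/4" if t: "t \<in> {0..1}" for t
      proof -
        have "k u t - k v t = integral {0..t} (\<lambda>s. \<Gamma> (X u s) (u s) (u s) - \<Gamma> (X v s) (v s) (v s))"
        proof -
          have "{0..t} \<subseteq> {0..1}" using t by auto
          then have "(\<lambda>s. \<Gamma> (X u s) (u s) (u s)) integrable_on {0..t}" "(\<lambda>s. \<Gamma> (X v s) (v s) (v s)) integrable_on {0..t}"
            using continuous_on_subset[OF ci[OF u]] continuous_on_subset[OF ci[OF v]] integrable_continuous_interval by blast+
          then show ?thesis unfolding k_def by (simp add: integral_diff)
        qed
        then show ?thesis
          using integral_norm_le[OF continuous_on_diff[OF ci[OF u] ci[OF v]] \<Gamma>d t] by simp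
      qed
      have ikd: "norm (integral {0..1} (k u) - integral {0..1} (k v)) \<le> d/4"
      proof -
        have "integral {0..1} (k u) - integral {0..1} (k v) = integral {0..1} (\<lambda>s. k u s - k v s)"
          by (rule integral_diff[OF integrable_continuous_interval[OF k[OF u]] integrable_continuous_interval[OF k[OF v]], symmetric])
        then show ?thesis
          using integral_norm_le[OF continuous_on_diff[OF k[OF u] k[OF v]] kd, of 1] by simp
      qed
      show "\<forall>t\<in>{0..1}. norm (H u t - H v t) \<le> d / 2"
      proof
        fix t :: real assume t: "t \<in> {0..1}"
        have "H u t - H v t = (integral {0..1} (k u) - integral {0..1} (k v)) - (k u t - k v t)"
          by (simp add: H_def)
        then show "norm (H u t - H v t) \<le> d / 2"
          using norm_triangle_ineq4[of "integral {0..1} (k u) - integral {0..1} (k v)" "k u t - k v t"] ikd kd[OF t] by simp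
      qed
    qed
    then obtain u where u: "continuous_on {0..1} u" "\<And>t. t \<in> {0..1} \<Longrightarrow> norm (u t) \<le> 2 * r" "\<And>t. t \<in> {0..1} \<Longrightarrow> u t = H u t"
      by blast
    have dX: "(X u has_vector_derivative u t) (at t within {0..1})" if "t \<in> {0..1}" for t
    proof -
      have "(X u has_vector_derivative 0 + u t) (at t within {0..1})"
        unfolding X_def by (intro has_vector_derivative_add has_vector_derivative_const integral_has_vector_derivative u that)
      then show ?thesis by simp
    qed
    have du: "(u has_vector_derivative - \<Gamma> (X u t) (u t) (u t)) (at t within {0..1})" if t: "t \<in> {0..1}" for t
    proof -
      have "(H u has_vector_derivative 0 - \<Gamma> (X u t) (u t) (u t)) (at t within {0..1})"
        unfolding H_def k_def
        by (intro has_vector_derivative_diff has_vector_derivative_const integral_has_vector_derivative ci u t)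
      then show ?thesis using u(3) t by (auto intro: has_vector_derivative_transform)
    qed
    have "geodesic S G (X u) u"
      unfolding geodesic_def using dX du XK[OF u(1,2)] assms(2) by blast
    moreover have "X u 0 = a" by (simp add: X_def)
    moreover have "X u 1 = b"
    proof -
      have "integral {0..1} u = integral {0..1} (H u)" by (rule integral_cong) (rule u(3))
      also have "\<dots> = (b - a) + integral {0..1} (k u) - integral {0..1} (k u)"
        unfolding H_def by (subst integral_diff[OF integrable_const_ivl integrable_continuous_interval[OF k[OF u(1,2)]]]) auto
      finally show ?thesis by (simp add: X_def)
    qed
    moreover have "transportable G (X u) u"
    proof (rule ex_parallel[OF X[OF u(1)] u(1)])
      show "X u ` {0..1} \<subseteq> S" using XK[OF u(1,2)] assms(2) by blast
      fix t :: real and v assume t: "t \<in> {0..1}"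
      have "norm (\<Gamma> (X u t) (u t) v) \<le> C * norm (u t) * norm v"
        by (rule C(2)[OF XK[OF u(1,2) t]])
      also have "\<dots> \<le> C * (2 * r) * norm v"
        using u(2)[OF t] C(1) by (intro mult_right_mono mult_left_mono) auto
      also have "\<dots> = 2 * (C * r) * norm v" by simp
      also have "\<dots> \<le> 2 * (1/32) * norm v" using r by (intro mult_right_mono mult_left_mono) auto
      finally show "norm (\<Gamma> (X u t) (u t) v) \<le> norm v / 2" using norm_ge_zero[of v] by linarith
    qed
    moreover have "\<forall>t\<in>{0..1}. X u t \<in> ?K \<and> norm (u t) \<le> \<epsilon>"
      using XK[OF u(1,2)] u(2) r(5) by (meson order_trans)
    ultimately show ?thesis by blast
  qed
  then show ?thesis using \<delta>(1) by blast
qed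

end

section \<open>Short geodesics minimise the energy\<close>

text \<open>Cauchy-Schwarz, from the nonnegative integral of the squared deviation of
  \<open>f\<close> from its mean.\<close>

lemma integral_square_le:
  fixes f :: "real \<Rightarrow> real"
  assumes "continuous_on {0..1} f"
  shows "(integral {0..1} f)\<^sup>2 \<le> integral {0..1} (\<lambda>t. (f t)\<^sup>2)"
proof -
  define m where "m = integral {0..1} f"
  have i: "(f has_integral m) {0..1}" "((\<lambda>t. (f t)\<^sup>2) has_integral integral {0..1} (\<lambda>t. (f t)\<^sup>2)) {0..1}"
    unfolding m_def by (intro integrable_integral integrable_continuous_interval continuous_intros assms)+
  have c: "((\<lambda>t::real. m\<^sup>2) has_integral m\<^sup>2) {0..1}" using has_integral_const_real[of "m\<^sup>2" 0 1] by simp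
  have "((\<lambda>t. (f t)\<^sup>2 - 2 * m * f t + m\<^sup>2) has_integral (integral {0..1} (\<lambda>t. (f t)\<^sup>2) - 2 * m * m + m\<^sup>2)) {0..1}"
    by (intro has_integral_add has_integral_diff i c has_integral_mult_right)
  then have "0 \<le> integral {0..1} (\<lambda>t. (f t)\<^sup>2) - 2 * m * m + m\<^sup>2"
  proof (rule has_integral_nonneg)
    fix t
    have "(f t)\<^sup>2 - 2 * m * f t + m\<^sup>2 = (f t - m)\<^sup>2" by (simp add: power2_diff)
    then show "0 \<le> (f t)\<^sup>2 - 2 * m * f t + m\<^sup>2" by simp
  qed
  then show ?thesis by (simp add: m_def power2_eq_square)
qed

lemma has_vector_derivative_compose:
  assumes "(x has_vector_derivative x') (at t within T)" "(f has_derivative blinfun_apply f') (at (x t))"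
  shows "((\<lambda>s. f (x s)) has_vector_derivative blinfun_apply f' x') (at t within T)"
  using has_derivative_compose[OF assms(1)[unfolded has_vector_derivative_def] assms(2)]
  by (simp add: has_vector_derivative_def blinfun.bilinear_simps)

lemma has_vector_derivative_blinfun_apply:
  assumes "(f has_vector_derivative f') (at t within T)" "(v has_vector_derivative v') (at t within T)"
  shows "((\<lambda>s. blinfun_apply (f s) (v s)) has_vector_derivative (blinfun_apply (f t) v' + blinfun_apply f' (v t))) (at t within T)"
  by (rule bounded_bilinear.has_vector_derivative[OF bounded_bilinear_blinfun_apply assms])

lemma geodesicD:
  assumes "geodesic S G x x'" "t \<in> {0..1}"
  shows "x t \<in> S" "(x has_vector_derivative x' t) (at t within {0..1})"
    "(x' has_vector_derivative - christoffel G (x t) (x' t) (x' t)) (at t within {0..1})"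
  using assms unfolding geodesic_def by auto

lemma geodesic_continuous:
  assumes "geodesic S G x x'"
  shows "continuous_on {0..1} x" "continuous_on {0..1} x'" "x ` {0..1} \<subseteq> S"
proof -
  show "continuous_on {0..1} x" by (rule continuous_on_vector_derivative[OF geodesicD(2)[OF assms]])
  show "continuous_on {0..1} x'" by (rule continuous_on_vector_derivative[OF geodesicD(3)[OF assms]])
  show "x ` {0..1} \<subseteq> S" using geodesicD(1)[OF assms] by (rule image_subsetI)
qed

context chart_metric
begin

lemma continuous_on_bform:
  assumes "continuous_on T x" "x ` T \<subseteq> S"
  shows "continuous_on T (\<lambda>t. bform G (x t))" "continuous_on T (\<lambda>t. bform1 G (x t))" "continuous_on T (\<lambda>t. bform2 G (x t))"
  using continuous_on_compose2[OF cont_bform(1) assms] continuous_on_compose2[OF cont_bform(2) assms]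
    continuous_on_compose2[OF cont_bform(3) assms] by auto

lemma continuous_on_G:
  assumes "continuous_on T x" "continuous_on T a" "continuous_on T b" "x ` T \<subseteq> S"
  shows "continuous_on T (\<lambda>t. G (x t) (a t) (b t))"
proof -
  have "continuous_on T (\<lambda>t. bform G (x t) (a t) (b t))"
    by (intro continuous_intros continuous_on_bform assms)
  moreover have "bform G (x t) (a t) (b t) = G (x t) (a t) (b t)" if "t \<in> T" for t
    using assms(4) that by auto
  ultimately show ?thesis by (simp cong: continuous_on_cong_simp)
qed

lemma G_curve_derivative:
  assumes "t \<in> T" "\<And>s. s \<in> T \<Longrightarrow> x s \<in> S"
    and "(x has_vector_derivative x') (at t within T)" "(a has_vector_derivative a') (at t within T)"
    "(b has_vector_derivative b') (at t within T)"
  shows "((\<lambda>s. G (x s) (a s) (b s)) has_real_derivative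
     bform1 G (x t) x' (a t) (b t) + G (x t) a' (b t) + G (x t) (a t) b') (at t within T)"
proof -
  have "((\<lambda>s. bform G (x s)) has_vector_derivative bform1 G (x t) x') (at t within T)"
    by (rule has_vector_derivative_compose[OF assms(3) bform_deriv]) (rule assms(2)[OF assms(1)])
  from has_vector_derivative_blinfun_apply[OF has_vector_derivative_blinfun_apply[OF this assms(4)] assms(5)]
  have "((\<lambda>s. bform G (x s) (a s) (b s)) has_vector_derivative
     bform1 G (x t) x' (a t) (b t) + G (x t) a' (b t) + G (x t) (a t) b') (at t within T)"
    using assms(1,2) by (simp add: blinfun.bilinear_simps add_ac)
  then have "((\<lambda>s. G (x s) (a s) (b s)) has_vector_derivative
     bform1 G (x t) x' (a t) (b t) + G (x t) a' (b t) + G (x t) (a t) b') (at t within T)"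
    by (rule has_vector_derivative_transform[OF assms(1), rotated]) (use assms(2) in simp)
  then show ?thesis by (simp add: has_real_derivative_iff_has_vector_derivative)
qed

lemma bform1_curve_derivative:
  assumes "x t \<in> S" "(x has_vector_derivative x') (at t within T)" "(u has_vector_derivative u') (at t within T)"
    "(a has_vector_derivative a') (at t within T)" "(b has_vector_derivative b') (at t within T)"
  shows "((\<lambda>s. bform1 G (x s) (u s) (a s) (b s)) has_vector_derivative
     bform2 G (x t) x' (u t) (a t) (b t) + bform1 G (x t) u' (a t) (b t)
      + bform1 G (x t) (u t) a' (b t) + bform1 G (x t) (u t) (a t) b') (at t within T)"
proof -
  have "((\<lambda>s. bform1 G (x s)) has_vector_derivative bform2 G (x t) x') (at t within T)"
    by (rule has_vector_derivative_compose[OF assms(2) bform1_deriv]) (rule assms(1))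
  from has_vector_derivative_blinfun_apply[OF has_vector_derivative_blinfun_apply[OF
      has_vector_derivative_blinfun_apply[OF this assms(3)] assms(4)] assms(5)]
  show ?thesis by (simp add: blinfun.bilinear_simps add_ac)
qed

lemma bform_curve_derivative:
  assumes "x t \<in> S" "(x has_vector_derivative x') (at t within T)"
    "(a has_vector_derivative a') (at t within T)" "(b has_vector_derivative b') (at t within T)"
  shows "((\<lambda>s. bform G (x s) (a s) (b s)) has_vector_derivative
     bform1 G (x t) x' (a t) (b t) + bform G (x t) a' (b t) + bform G (x t) (a t) b') (at t within T)"
proof -
  have "((\<lambda>s. bform G (x s)) has_vector_derivative bform1 G (x t) x') (at t within T)"
    by (rule has_vector_derivative_compose[OF assms(2) bform_deriv]) (rule assms(1))
  from has_vector_derivative_blinfun_apply[OF has_vector_derivative_blinfun_apply[OF this assms(3)] assms(4)]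
  show ?thesis by (simp add: blinfun.bilinear_simps add_ac)
qed

text \<open>Along a geodesic the integrand of the first variation of energy is an exact derivative,
  so only the ends contribute.\<close>

lemma geodesic_first_variation:
  assumes "geodesic S G x x'" "t \<in> {0..1}" "(w has_vector_derivative w') (at t within {0..1})"
  shows "((\<lambda>s. 2 * G (x s) (x' s) (w s)) has_real_derivative
    bform1 G (x t) (w t) (x' t) (x' t) + 2 * G (x t) (x' t) w') (at t within {0..1})"
proof -
  note g = geodesicD[OF assms(1)] geodesicD[OF assms(1,2)]
  have "((\<lambda>s. G (x s) (x' s) (w s)) has_real_derivative
     bform1 G (x t) (x' t) (x' t) (w t) + G (x t) (- \<Gamma> (x t) (x' t) (x' t)) (w t) + G (x t) (x' t) w') (at t within {0..1})"
    by (rule G_curve_derivative[OF assms(2) g(1,5,6) assms(3)])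
  from DERIV_cmult[OF this, of 2]
  show ?thesis
    by (rule DERIV_cong)
      (use christoffel_koszul[OF g(4), of "x' t" "x' t" "w t"] g(4) in \<open>simp add: G_bilinear_simps koszul_def field_simps\<close>)
qed

text \<open>The quadratic bound is the mean value inequality on the segment for
  \<open>bform G z - bform1 G x z\<close>, whose derivative is in turn bounded by a multiple of the
  distance.\<close>

lemma taylor_bounds:
  assumes "cball x0 R \<subseteq> S" and C: "\<And>x. x \<in> cball x0 R \<Longrightarrow> norm (bform1 G x) \<le> C \<and> norm (bform2 G x) \<le> C"
    and "x \<in> cball x0 R" "y \<in> cball x0 R"
  shows "norm (bform G y - bform G x) \<le> C * norm (y - x)"
    "norm (bform G y - bform G x - bform1 G x (y - x)) \<le> C * (norm (y - x))\<^sup>2"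
proof -
  let ?K = "cball x0 R"
  have "norm (bform1 G z - bform1 G x) \<le> C * norm (z - x)" if "z \<in> ?K" for z
    using that assms
    by (auto intro!: differentiable_bound[of ?K _ "\<lambda>x. blinfun_apply (bform2 G x)"]
       has_derivative_at_withinI bform1_deriv simp flip: norm_blinfun.rep_eq)
  moreover have "norm (z - x) \<le> norm (y - x)" if "z \<in> closed_segment x y" for z
    using segment_bound(1)[OF that] .
  moreover have sub: "closed_segment x y \<subseteq> ?K"
    using assms(3,4) by (intro closed_segment_subset convex_cball)
  moreover have C0: "0 \<le> C" using C[OF assms(3)] norm_ge_zero order_trans by blast
  ultimately have 1: "norm (bform1 G z - bform1 G x) \<le> C * norm (y - x)" if "z \<in> closed_segment x y" for z
    using that by (meson mult_left_mono order_trans subset_iff)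
  show "norm (bform G y - bform G x) \<le> C * norm (y - x)"
    using assms
    by (auto intro!: differentiable_bound[of ?K _ "\<lambda>x. blinfun_apply (bform1 G x)"]
       has_derivative_at_withinI bform_deriv simp flip: norm_blinfun.rep_eq)
  have "norm ((bform G y - bform1 G x y) - (bform G x - bform1 G x x)) \<le> (C * norm (y - x)) * norm (y - x)"
  proof (rule differentiable_bound[of "closed_segment x y" "\<lambda>z. bform G z - bform1 G x z" "\<lambda>z. blinfun_apply (bform1 G z - bform1 G x)"])
    fix z assume z: "z \<in> closed_segment x y"
    then have "z \<in> S" using sub assms(1) by blast
    then show "((\<lambda>z. bform G z - bform1 G x z) has_derivative blinfun_apply (bform1 G z - bform1 G x)) (at z within closed_segment x y)"
      by (auto intro!: derivative_eq_intros has_derivative_at_withinI[OF bform_deriv] simp: blinfun.bilinear_simps)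
    show "onorm (blinfun_apply (bform1 G z - bform1 G x)) \<le> C * norm (y - x)"
      using 1[OF z] by (simp flip: norm_blinfun.rep_eq)
  qed auto
  then show "norm (bform G y - bform G x - bform1 G x (y - x)) \<le> C * (norm (y - x))\<^sup>2"
    by (simp add: blinfun.bilinear_simps power2_eq_square algebra_simps)
qed

text \<open>Comparing the energy of a curve \<open>y\<close> with that of a short geodesic \<open>x\<close>: the terms of second order
  in \<open>y - x\<close> are dominated by the norm of its derivative.\<close>

lemma geodesic_almost_minimal:
  assumes sub: "cball x0 R \<subseteq> S"
  shows "\<exists>\<epsilon>>0. \<exists>C>0. \<forall>x x' y y'. geodesic S G x x' \<longrightarrow> (\<forall>t\<in>{0..1}. x t \<in> cball x0 R \<and> norm (x' t) \<le> \<epsilon>) \<longrightarrow>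
    (\<forall>t\<in>{0..1}. y t \<in> cball x0 R \<and> (y has_vector_derivative y' t) (at t within {0..1})) \<longrightarrow> continuous_on {0..1} y' \<longrightarrow>
    energy G x x' \<le> energy G y y' + C * (norm (y 0 - x 0) + norm (y 1 - x 1) + (norm (y 0 - x 0))\<^sup>2)"
proof -
  let ?K = "cball x0 R"
  obtain l where l: "l > 0" "\<And>x a. x \<in> ?K \<Longrightarrow> l * (norm a)\<^sup>2 \<le> G x a a"
    using ex_lower_bound[OF compact_cball sub] by blast
  obtain C where C: "C > 0" "\<And>x. x \<in> ?K \<Longrightarrow> norm (bform G x) \<le> C"
     "\<And>x. x \<in> ?K \<Longrightarrow> norm (bform1 G x) \<le> C \<and> norm (bform2 G x) \<le> C"
    using ex_upper_bound[OF compact_cball sub] by blast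
  \<comment> \<open>The factor 5 is a budget taken from coercivity: one part pays for the mixed term
    of \<open>h\<close> and \<open>h'\<close>, the other four cancel after integration against the
    bound \<open>hle\<close> on \<open>h\<close>.\<close>
  define \<epsilon> where "\<epsilon> = min 1 (l / (5 * C))"
  have \<epsilon>: "\<epsilon> > 0" "\<epsilon> \<le> 1" "5 * (C * \<epsilon>) \<le> l"
  proof -
    have "\<epsilon> \<le> l / (5 * C)" unfolding \<epsilon>_def by simp
    then show "5 * (C * \<epsilon>) \<le> l" using C(1) by (simp add: field_simps)
  qed (use l C in \<open>auto simp: \<epsilon>_def\<close>)
  have "energy G x x' \<le> energy G y y' + (4 * C) * (norm (y 0 - x 0) + norm (y 1 - x 1) + (norm (y 0 - x 0))\<^sup>2)"
    if geo: "geodesic S G x x'" and xK: "\<And>t. t \<in> {0..1} \<Longrightarrow> x t \<in> ?K \<and> norm (x' t) \<le> \<epsilon>"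
      and y: "\<And>t. t \<in> {0..1} \<Longrightarrow> y t \<in> ?K \<and> (y has_vector_derivative y' t) (at t within {0..1})"
      and cy': "continuous_on {0..1} y'" for x x' y y'
  proof -
    define h where "h t = y t - x t" for t
    define h' where "h' t = y' t - x' t" for t
    note gc = geodesic_continuous[OF geo]
    have cy: "continuous_on {0..1} y" using y by (intro continuous_on_vector_derivative[of _ y y']) auto
    have yS: "y ` {0..1} \<subseteq> S" using y sub by blast
    have dh: "(h has_vector_derivative h' t) (at t within {0..1})" if "t \<in> {0..1}" for t
      unfolding h_def h'_def using y[OF that] geodesicD(2)[OF geo that] by (intro has_vector_derivative_diff) auto
    have ch': "continuous_on {0..1} h'" unfolding h'_def by (intro continuous_intros cy' gc)
    have ch: "continuous_on {0..1} h" unfolding h_def by (intro continuous_intros cy gc)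
    define Q where "Q = integral {0..1} (\<lambda>t. (norm (h' t))\<^sup>2)"
    \<comment> \<open>The part linear in \<open>h\<close>, which integrates to boundary terms
      because \<open>x\<close> is a geodesic.\<close>
    define \<psi> where "\<psi> t = bform1 G (x t) (h t) (x' t) (x' t) + 2 * G (x t) (x' t) (h' t)" for t
    define b where "b = 2 * G (x 1) (x' 1) (h 1) - 2 * G (x 0) (x' 0) (h 0)"
    have \<psi>: "(\<psi> has_integral b) {0..1}"
      unfolding \<psi>_def b_def
      by (rule fundamental_theorem_of_calculus)
        (use geodesic_first_variation[OF geo _ dh] in \<open>auto simp: has_real_derivative_iff_has_vector_derivative\<close>)
    \<comment> \<open>The ends of the two curves need not agree, so the starting value of
      \<open>h\<close> survives into the final estimate.\<close>
    have hle: "(norm (h t))\<^sup>2 \<le> 2 * (norm (h 0))\<^sup>2 + 2 * Q" if t: "t \<in> {0..1}" for t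
    proof -
      have "(h' has_integral (h t - h 0)) {0..t}"
        using t by (intro fundamental_theorem_of_calculus) (auto intro!: has_vector_derivative_within_subset[OF dh])
      moreover have "norm (integral {0..t} h') \<le> integral {0..t} (\<lambda>s. norm (h' s))"
        using t by (intro Henstock_Kurzweil_Integration.integral_norm_bound_integral integrable_continuous_interval
            continuous_intros continuous_on_subset[OF ch']) auto
      moreover have "integral {0..t} (\<lambda>s. norm (h' s)) \<le> integral {0..1} (\<lambda>s. norm (h' s))"
        using t by (intro integral_subset_le integrable_continuous_interval continuous_intros continuous_on_subset[OF ch']) auto
      ultimately have "norm (h t - h 0) \<le> integral {0..1} (\<lambda>s. norm (h' s))"
        by (simp add: integral_unique)
      then have "(norm (h t - h 0))\<^sup>2 \<le> (integral {0..1} (\<lambda>s. norm (h' s)))\<^sup>2" by (simp add: power_mono)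
      also have "\<dots> \<le> Q" unfolding Q_def by (intro integral_square_le continuous_intros ch')
      finally have 1: "(norm (h t - h 0))\<^sup>2 \<le> Q" .
      have "norm (h t) \<le> norm (h 0) + norm (h t - h 0)" by (metis norm_triangle_sub)
      then have "(norm (h t))\<^sup>2 \<le> (norm (h 0) + norm (h t - h 0))\<^sup>2" by (simp add: power_mono)
      also have "\<dots> \<le> 2 * (norm (h 0))\<^sup>2 + 2 * (norm (h t - h 0))\<^sup>2"
        using sum_squares_bound[of "norm (h 0)" "norm (h t - h 0)"] by (simp add: power2_sum)
      finally show ?thesis using 1 by simp
    qed
    have pw: "G (y t) (y' t) (y' t) - G (x t) (x' t) (x' t) \<ge>
       \<psi> t + 4 * (C * \<epsilon>) * (norm (h' t))\<^sup>2 - 2 * (C * \<epsilon>) * (2 * (norm (h 0))\<^sup>2 + 2 * Q)" if t: "t \<in> {0..1}" for t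
    proof -
      have m: "x t \<in> ?K" "y t \<in> ?K" "x t \<in> S" "y t \<in> S" using xK y t sub by auto
      \<comment> \<open>\<open>A\<close> and \<open>B\<close> are the Taylor remainders of order
        zero and one of the form, of sizes \<open>h\<close> and \<open>h\<close> squared; with them
        the difference of the densities has an exact expansion.\<close>
      define A where "A = bform G (y t) - bform G (x t)"
      define B where "B = bform G (y t) - bform G (x t) - bform1 G (x t) (y t - x t)"
      have AB: "norm A \<le> C * norm (h t)" "norm B \<le> C * (norm (h t))\<^sup>2"
        unfolding A_def B_def h_def using taylor_bounds[OF sub C(3) m(1,2)] by auto
      have nx: "norm (x' t) \<le> \<epsilon>" using xK t by blast
      have yh: "y' t = x' t + h' t" by (simp add: h'_def)
      have "G (y t) (y' t) (y' t) - G (x t) (x' t) (x' t) =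
         \<psi> t + G (y t) (h' t) (h' t) + 2 * A (x' t) (h' t) + B (x' t) (x' t)"
        unfolding \<psi>_def A_def B_def yh h_def using m sym_G[of "y t" "h' t" "x' t"] by (simp add: blinfun.bilinear_simps G_bilinear_simps)
      moreover have "G (y t) (h' t) (h' t) \<ge> 5 * (C * \<epsilon>) * (norm (h' t))\<^sup>2"
        using l(2)[OF m(2), of "h' t"] mult_right_mono[OF \<epsilon>(3), of "(norm (h' t))\<^sup>2"] by simp
      moreover have "2 * \<bar>A (x' t) (h' t)\<bar> \<le> C * \<epsilon> * ((norm (h t))\<^sup>2 + (norm (h' t))\<^sup>2)"
      proof -
        have "\<bar>A (x' t) (h' t)\<bar> \<le> norm A * norm (x' t) * norm (h' t)" using norm_blinfun_apply2[of A] by simp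
        also have "\<dots> \<le> (C * norm (h t)) * \<epsilon> * norm (h' t)"
          using AB(1) nx C(1) \<epsilon>(1) by (intro mult_mono) auto
        finally have "2 * \<bar>A (x' t) (h' t)\<bar> \<le> C * \<epsilon> * (2 * norm (h t) * norm (h' t))" by (simp add: mult_ac)
        also have "\<dots> \<le> C * \<epsilon> * ((norm (h t))\<^sup>2 + (norm (h' t))\<^sup>2)"
          using C(1) \<epsilon>(1) by (intro mult_left_mono sum_squares_bound) auto
        finally show ?thesis .
      qed
      moreover have "\<bar>B (x' t) (x' t)\<bar> \<le> C * \<epsilon> * (norm (h t))\<^sup>2"
      proof -
        have "\<bar>B (x' t) (x' t)\<bar> \<le> norm B * norm (x' t) * norm (x' t)" using norm_blinfun_apply2[of B] by simp
        also have "\<dots> \<le> (C * (norm (h t))\<^sup>2) * \<epsilon> * 1"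
          using AB(2) nx C(1) \<epsilon>(1,2) by (intro mult_mono) auto
        finally show ?thesis by (simp add: mult_ac)
      qed
      moreover have "2 * (C * \<epsilon>) * (norm (h t))\<^sup>2 \<le> 2 * (C * \<epsilon>) * (2 * (norm (h 0))\<^sup>2 + 2 * Q)"
        using hle[OF t] C(1) \<epsilon>(1) by (intro mult_left_mono) auto
      moreover define p q where "p = C * \<epsilon> * (norm (h' t))\<^sup>2" and "q = C * \<epsilon> * (norm (h t))\<^sup>2"
      moreover have "5 * (C * \<epsilon>) * (norm (h' t))\<^sup>2 = 5 * p" "4 * (C * \<epsilon>) * (norm (h' t))\<^sup>2 = 4 * p"
        "2 * (C * \<epsilon>) * (norm (h t))\<^sup>2 = 2 * q" "C * \<epsilon> * ((norm (h t))\<^sup>2 + (norm (h' t))\<^sup>2) = q + p"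
        unfolding p_def q_def by (simp_all add: distrib_left)
      ultimately show ?thesis by linarith
    qed
    have iy: "((\<lambda>t. G (y t) (y' t) (y' t)) has_integral energy G y y') {0..1}"
      unfolding energy_def by (intro integrable_integral integrable_continuous_interval continuous_on_G cy cy' yS)
    have ix: "((\<lambda>t. G (x t) (x' t) (x' t)) has_integral energy G x x') {0..1}"
      unfolding energy_def by (intro integrable_integral integrable_continuous_interval continuous_on_G gc)
    have iQ: "((\<lambda>t. (norm (h' t))\<^sup>2) has_integral Q) {0..1}"
      unfolding Q_def by (intro integrable_integral integrable_continuous_interval continuous_intros ch')
    have ic: "((\<lambda>t::real. 2 * (C * \<epsilon>) * (2 * (norm (h 0))\<^sup>2 + 2 * Q)) has_integral 2 * (C * \<epsilon>) * (2 * (norm (h 0))\<^sup>2 + 2 * Q)) {0..1}"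
      using has_integral_const_real[of "2 * (C * \<epsilon>) * (2 * (norm (h 0))\<^sup>2 + 2 * Q)" 0 1] by simp
    have "b + 4 * (C * \<epsilon>) * Q - 2 * (C * \<epsilon>) * (2 * (norm (h 0))\<^sup>2 + 2 * Q) \<le> energy G y y' - energy G x x'"
      by (rule has_integral_le[OF has_integral_diff[OF has_integral_add[OF \<psi> has_integral_mult_right[OF iQ]] ic] has_integral_diff[OF iy ix]])
        (use pw in auto)
    then have 1: "energy G x x' \<le> energy G y y' - b + 4 * (C * \<epsilon>) * (norm (h 0))\<^sup>2"
      by (simp add: algebra_simps)
    have bb: "\<bar>2 * G (x t) (x' t) (h t)\<bar> \<le> 2 * C * norm (h t)" if t: "t \<in> {0..1}" for t
    proof -
      have "\<bar>G (x t) (x' t) (h t)\<bar> \<le> norm (bform G (x t)) * norm (x' t) * norm (h t)"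
        using norm_blinfun_apply2[of "bform G (x t)" "x' t" "h t"] xK[OF t] sub by (simp add: subset_iff)
      also have "\<dots> \<le> C * 1 * norm (h t)"
        using xK[OF t] C(1,2) \<epsilon>(2) by (intro mult_mono) auto
      finally show ?thesis by simp
    qed
    have "C * \<epsilon> * (norm (h 0))\<^sup>2 \<le> C * 1 * (norm (h 0))\<^sup>2"
      using C(1) \<epsilon> by (intro mult_right_mono mult_left_mono) auto
    moreover have "\<bar>b\<bar> \<le> 2 * C * norm (h 1) + 2 * C * norm (h 0)"
      using bb[of 0] bb[of 1] unfolding b_def by simp
    moreover have "0 \<le> C * norm (h 0)" "0 \<le> C * norm (h 1)" using C(1) by auto
    ultimately have "energy G x x' \<le> energy G y y' + (4 * C) * (norm (h 0) + norm (h 1) + (norm (h 0))\<^sup>2)"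
      using 1 by (simp add: algebra_simps abs_le_iff)
    then show ?thesis by (simp add: h_def)
  qed
  then show ?thesis using \<epsilon>(1) C(1) by (intro exI[of _ \<epsilon>] conjI exI[of _ "4 * C"]) auto
qed

end

section \<open>The second variation of the energy\<close>

lemma slice_continuous:
  assumes "continuous_on (J \<times> {0..1}) (\<lambda>(s, t). F s t)" "s \<in> J"
  shows "continuous_on {0..1::real} (F s)"
proof -
  have "continuous_on {0..1} (\<lambda>t. (\<lambda>(s, t). F s t) (s, t))"
    by (rule continuous_on_compose2[OF assms(1)]) (use assms(2) in \<open>auto intro: continuous_intros\<close>)
  then show ?thesis by simp
qed

text \<open>A variation of the geodesic \<open>x\<close> in the direction \<open>V\<close> whose endpoints move along given curves
  \<open>p\<close> and \<open>q\<close>.\<close>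

locale variation = chart_metric S G for S :: "'e::euclidean_space set" and G +
  fixes x x' V V' p p' p'' q q' q'' :: "real \<Rightarrow> 'e" and r :: real
  assumes geo: "geodesic S G x x'"
    and dV: "t \<in> {0..1} \<Longrightarrow> (V has_vector_derivative V' t) (at t within {0..1})"
    and cV': "continuous_on {0..1} V'"
    and r: "r > 0"
    and dp: "\<bar>s\<bar> < r \<Longrightarrow> (p has_vector_derivative p' s) (at s)"
      "\<bar>s\<bar> < r \<Longrightarrow> (p' has_vector_derivative p'' s) (at s)" "continuous_on {-r<..<r} p''"
    and dq: "\<bar>s\<bar> < r \<Longrightarrow> (q has_vector_derivative q' s) (at s)"
      "\<bar>s\<bar> < r \<Longrightarrow> (q' has_vector_derivative q'' s) (at s)" "continuous_on {-r<..<r} q''"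
    and ends: "p 0 = x 0" "p' 0 = V 0" "q 0 = x 1" "q' 0 = V 1"
begin

text \<open>The linear variation \<open>x + s V\<close>, corrected by interpolating between the
  deviations of \<open>p\<close> and \<open>q\<close> from their tangents at 0. This keeps the
  variation field \<open>V\<close> and lets the ends run exactly along \<open>p\<close> and
  \<open>q\<close>. \<open>Y\<close> is the derivative in \<open>t\<close>; the suffixes 1 and 2
  count derivatives in \<open>s\<close>.\<close>

definition "X s t = (x t - (1 - t) *\<^sub>R p 0 - t *\<^sub>R q 0) + s *\<^sub>R (V t - (1 - t) *\<^sub>R p' 0 - t *\<^sub>R q' 0)
  + (1 - t) *\<^sub>R p s + t *\<^sub>R q s"
definition "Y s t = (x' t + p 0 - q 0) + s *\<^sub>R (V' t + p' 0 - q' 0) + (q s - p s)"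
definition "X1 s t = (V t - (1 - t) *\<^sub>R p' 0 - t *\<^sub>R q' 0) + (1 - t) *\<^sub>R p' s + t *\<^sub>R q' s"
definition "Y1 s t = (V' t + p' 0 - q' 0) + (q' s - p' s)"
definition "X2 s t = (1 - t) *\<^sub>R p'' s + t *\<^sub>R q'' s"
definition "Y2 s t = q'' s - p'' s" for s t :: real

lemma X_simps:
  "X 0 t = x t" "Y 0 t = x' t" "X1 0 t = V t" "Y1 0 t = V' t"
  "X s 0 = p s" "X s 1 = q s"
  unfolding X_def Y_def X1_def Y1_def using ends by (simp_all add: algebra_simps)

lemma X_deriv_t: "t \<in> {0..1} \<Longrightarrow> (X s has_vector_derivative Y s t) (at t within {0..1})"
  unfolding X_def Y_def using geodesicD(2)[OF geo, of t] dV[of t]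
  by (auto intro!: derivative_eq_intros simp: has_vector_derivative_def algebra_simps)

lemma X_deriv_s:
  assumes "\<bar>s\<bar> < r"
  shows "((\<lambda>s. X s t) has_vector_derivative X1 s t) (at s within J)"
    "((\<lambda>s. Y s t) has_vector_derivative Y1 s t) (at s within J)"
    "((\<lambda>s. X1 s t) has_vector_derivative X2 s t) (at s within J)"
    "((\<lambda>s. Y1 s t) has_vector_derivative Y2 s t) (at s within J)"
  unfolding X_def Y_def X1_def Y1_def X2_def Y2_def
  using dp(1,2)[OF assms, THEN has_vector_derivative_at_within, of J]
    dq(1,2)[OF assms, THEN has_vector_derivative_at_within, of J]
  by (auto intro!: derivative_eq_intros simp: has_vector_derivative_def algebra_simps)

lemma cV: "continuous_on {0..1} V"
  by (rule continuous_on_vector_derivative[OF dV])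

lemma cpq: "continuous_on {-r<..<r} p" "continuous_on {-r<..<r} p'" "continuous_on {-r<..<r} q" "continuous_on {-r<..<r} q'"
proof -
  have "continuous_on {-r<..<r} f" if "\<And>s. \<bar>s\<bar> < r \<Longrightarrow> (f has_vector_derivative f' s) (at s)" for f f' :: "real \<Rightarrow> 'e"
    using has_vector_derivative_continuous[OF that] by (intro continuous_at_imp_continuous_on) auto
  from this[OF dp(1)] this[OF dp(2)] this[OF dq(1)] this[OF dq(2)]
  show "continuous_on {-r<..<r} p" "continuous_on {-r<..<r} p'" "continuous_on {-r<..<r} q" "continuous_on {-r<..<r} q'" by auto
qed

lemma joint_continuity:
  assumes "J \<subseteq> {-r<..<r}"
  shows "continuous_on (J \<times> {0..1}) (\<lambda>z. X (fst z) (snd z))" "continuous_on (J \<times> {0..1}) (\<lambda>z. Y (fst z) (snd z))"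
    "continuous_on (J \<times> {0..1}) (\<lambda>z. X1 (fst z) (snd z))" "continuous_on (J \<times> {0..1}) (\<lambda>z. Y1 (fst z) (snd z))"
    "continuous_on (J \<times> {0..1}) (\<lambda>z. X2 (fst z) (snd z))" "continuous_on (J \<times> {0..1}) (\<lambda>z. Y2 (fst z) (snd z))"
proof -
  have 1: "continuous_on (J \<times> {0..1}) (\<lambda>z. f (fst z))" if "continuous_on {-r<..<r} f" for f :: "real \<Rightarrow> 'e"
    by (rule continuous_on_compose2[OF that]) (use assms in \<open>auto intro: continuous_intros\<close>)
  have 2: "continuous_on (J \<times> {0..1}) (\<lambda>z. f (snd z))" if "continuous_on {0..1} f" for f :: "real \<Rightarrow> 'e"
    by (rule continuous_on_compose2[OF that]) (auto intro: continuous_intros)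
  note c = cpq[THEN 1] dp(3)[THEN 1] dq(3)[THEN 1] geodesic_continuous(1,2)[OF geo, THEN 2] cV[THEN 2] cV'[THEN 2]
  show "continuous_on (J \<times> {0..1}) (\<lambda>z. X (fst z) (snd z))" unfolding X_def by (intro continuous_intros c)
  show "continuous_on (J \<times> {0..1}) (\<lambda>z. Y (fst z) (snd z))" unfolding Y_def by (intro continuous_intros c)
  show "continuous_on (J \<times> {0..1}) (\<lambda>z. X1 (fst z) (snd z))" unfolding X1_def by (intro continuous_intros c)
  show "continuous_on (J \<times> {0..1}) (\<lambda>z. Y1 (fst z) (snd z))" unfolding Y1_def by (intro continuous_intros c)
  show "continuous_on (J \<times> {0..1}) (\<lambda>z. X2 (fst z) (snd z))" unfolding X2_def by (intro continuous_intros c)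
  show "continuous_on (J \<times> {0..1}) (\<lambda>z. Y2 (fst z) (snd z))" unfolding Y2_def by (intro continuous_intros c)
qed

lemma Y_continuous: "\<bar>s\<bar> < r \<Longrightarrow> continuous_on {0..1} (Y s)"
  unfolding Y_def by (intro continuous_intros geodesic_continuous(2)[OF geo] cV')

text \<open>The compact image of \<open>x\<close> has a neighbourhood of positive width
  \<open>d\<close> in \<open>S\<close>, and \<open>m s\<close> bounds the displacement uniformly in
  \<open>t\<close>.\<close>

lemma ex_variation_in_S: "\<exists>e>0. e \<le> r \<and> (\<forall>s. \<bar>s\<bar> < e \<longrightarrow> (\<forall>t\<in>{0..1}. X s t \<in> S))"
proof -
  note gc = geodesic_continuous[OF geo]
  have "compact (x ` {0..1})" by (rule compact_continuous_image[OF gc(1) compact_Icc])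
  then obtain d where d: "d > 0" "(\<Union>z\<in>x ` {0..1}. ball z d) \<subseteq> S"
    using compact_subset_open_imp_ball_epsilon_subset[OF _ open_S gc(3)] by blast
  have "continuous_on {0..1} (\<lambda>t. V t - (1 - t) *\<^sub>R p' 0 - t *\<^sub>R q' 0)" by (intro continuous_intros cV)
  from compact_continuous_image[OF this compact_Icc]
  obtain B where B: "\<And>t. t \<in> {0..1} \<Longrightarrow> norm (V t - (1 - t) *\<^sub>R p' 0 - t *\<^sub>R q' 0) \<le> B"
    by (metis (no_types, lifting) bounded_iff compact_imp_bounded imageI)
  define m where "m s = \<bar>s\<bar> * B + norm (p s - p 0) + norm (q s - q 0)" for s
  have "isCont p 0" "isCont q 0" using dp(1)[of 0] dq(1)[of 0] r has_vector_derivative_continuous by auto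
  then have "(m \<longlongrightarrow> \<bar>0\<bar> * B + norm (p 0 - p 0) + norm (q 0 - q 0)) (at 0)"
    unfolding m_def isCont_def by (intro tendsto_intros)
  then have "eventually (\<lambda>s. m s < d) (at 0)" using d(1) by (intro order_tendstoD) auto
  then obtain e0 where e0: "e0 > 0" "\<And>s. s \<noteq> 0 \<Longrightarrow> \<bar>s\<bar> < e0 \<Longrightarrow> m s < d"
    unfolding eventually_at by (auto simp: dist_norm)
  have md: "m s < d" if "\<bar>s\<bar> < e0" for s using e0(2)[OF _ that] d(1) by (cases "s = 0") (auto simp: m_def)
  have "X s t \<in> S" if s: "\<bar>s\<bar> < e0" and t: "t \<in> {0..1}" for s t
  proof -
    have "X s t - x t = s *\<^sub>R (V t - (1 - t) *\<^sub>R p' 0 - t *\<^sub>R q' 0) + (1 - t) *\<^sub>R (p s - p 0) + t *\<^sub>R (q s - q 0)"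
      unfolding X_def by (simp add: algebra_simps)
    then have "norm (X s t - x t) \<le> norm (s *\<^sub>R (V t - (1 - t) *\<^sub>R p' 0 - t *\<^sub>R q' 0)) + norm ((1 - t) *\<^sub>R (p s - p 0)) + norm (t *\<^sub>R (q s - q 0))"
      by (metis norm_triangle3)
    also have "\<dots> \<le> m s"
      unfolding m_def norm_scaleR using B[OF t] t
      by (intro add_mono mult_left_mono) (auto intro: mult_left_le_one_le)
    finally have "X s t \<in> ball (x t) d" using md[OF s] by (simp add: dist_norm norm_minus_commute)
    then show ?thesis using d(2) t by blast
  qed
  then show ?thesis using e0(1) r by (intro exI[of _ "min e0 r"]) auto
qed

text \<open>\<open>F1\<close> and \<open>F2\<close> are the derivatives in \<open>s\<close> of this
  energy density, with all product rule terms written out for the comparison with curvature.\<close>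

definition "F0 s t = bform G (X s t) (Y s t) (Y s t)"
definition "F1 s t = bform1 G (X s t) (X1 s t) (Y s t) (Y s t) + bform G (X s t) (Y1 s t) (Y s t) + bform G (X s t) (Y s t) (Y1 s t)"
definition "F2 s t =
    (bform2 G (X s t) (X1 s t) (X1 s t) (Y s t) (Y s t) + bform1 G (X s t) (X2 s t) (Y s t) (Y s t)
      + bform1 G (X s t) (X1 s t) (Y1 s t) (Y s t) + bform1 G (X s t) (X1 s t) (Y s t) (Y1 s t))
  + (bform1 G (X s t) (X1 s t) (Y1 s t) (Y s t) + bform G (X s t) (Y2 s t) (Y s t) + bform G (X s t) (Y1 s t) (Y1 s t))
  + (bform1 G (X s t) (X1 s t) (Y s t) (Y1 s t) + bform G (X s t) (Y1 s t) (Y1 s t) + bform G (X s t) (Y s t) (Y2 s t))"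

lemma F_deriv:
  assumes "\<bar>s\<bar> < r" "X s t \<in> S"
  shows "((\<lambda>s. F0 s t) has_vector_derivative F1 s t) (at s within J)"
    "((\<lambda>s. F1 s t) has_vector_derivative F2 s t) (at s within J)"
  unfolding F0_def F1_def F2_def
  by (intro has_vector_derivative_add bform_curve_derivative[where x = "\<lambda>s. X s t", OF assms(2)]
       bform1_curve_derivative[where x = "\<lambda>s. X s t", OF assms(2)] X_deriv_s assms)+

lemma F_continuous:
  assumes J: "J \<subseteq> {-r<..<r}" and S: "\<And>s t. s \<in> J \<Longrightarrow> t \<in> {0..1} \<Longrightarrow> X s t \<in> S"
  shows "continuous_on (J \<times> {0..1}) (\<lambda>(s, t). F0 s t)" "continuous_on (J \<times> {0..1}) (\<lambda>(s, t). F1 s t)"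
    "continuous_on (J \<times> {0..1}) (\<lambda>(s, t). F2 s t)"
proof -
  have "(\<lambda>z. X (fst z) (snd z)) ` (J \<times> {0..1}) \<subseteq> S" using S by auto
  note c = joint_continuity[OF J] continuous_on_bform[OF joint_continuity(1)[OF J] this]
  show "continuous_on (J \<times> {0..1}) (\<lambda>(s, t). F0 s t)"
    unfolding F0_def split_beta by (intro continuous_intros c)
  show "continuous_on (J \<times> {0..1}) (\<lambda>(s, t). F1 s t)"
    unfolding F1_def split_beta by (intro continuous_intros c)
  show "continuous_on (J \<times> {0..1}) (\<lambda>(s, t). F2 s t)"
    unfolding F2_def split_beta by (intro continuous_intros c)
qed

lemma energy_deriv:
  assumes e: "e \<le> r" "\<And>s t. \<bar>s\<bar> < e \<Longrightarrow> t \<in> {0..1} \<Longrightarrow> X s t \<in> S" and s: "\<bar>s\<bar> < e"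
  shows "((\<lambda>s. energy G (X s) (Y s)) has_real_derivative integral {0..1} (F1 s)) (at s)"
    "((\<lambda>s. integral {0..1} (F1 s)) has_real_derivative integral {0..1} (F2 s)) (at s)"
proof -
  define J where "J = {-e<..<e}"
  have J: "J \<subseteq> {-r<..<r}" "s \<in> J" "convex J" "open J" using e s by (auto simp: J_def)
  have JS: "\<And>s t. s \<in> J \<Longrightarrow> t \<in> {0..1} \<Longrightarrow> X s t \<in> S" using e by (auto simp: J_def)
  note c = F_continuous[OF J(1) JS]
  have "((\<lambda>s. integral (cbox 0 1) (F0 s)) has_vector_derivative integral (cbox 0 1) (F1 s)) (at s within J)"
  proof (rule leibniz_rule_vector_derivative[OF _ _ _ J(2,3)])
    show "((\<lambda>s. F0 s t) has_vector_derivative F1 s t) (at s within J)" if "s \<in> J" "t \<in> cbox 0 1" for s t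
      using that e(1) by (intro F_deriv(1) JS) (auto simp: J_def)
    show "F0 s integrable_on cbox 0 1" if "s \<in> J" for s
      using slice_continuous[OF c(1) that] integrable_continuous_interval by (simp add: cbox_interval)
    show "continuous_on (J \<times> cbox 0 1) (\<lambda>(s, t). F1 s t)" using c(2) by (simp add: cbox_interval)
  qed
  then have d: "((\<lambda>s. integral {0..1} (F0 s)) has_real_derivative integral {0..1} (F1 s)) (at s)"
    using at_within_open[OF J(2,4)] by (simp add: has_real_derivative_iff_has_vector_derivative cbox_interval)
  show "((\<lambda>s. energy G (X s) (Y s)) has_real_derivative integral {0..1} (F1 s)) (at s)"
  proof (rule has_field_derivative_transform_within_open[OF d J(4,2)])
    fix s' assume "s' \<in> J"
    then show "integral {0..1} (F0 s') = energy G (X s') (Y s')"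
      unfolding energy_def F0_def by (intro integral_cong) (simp add: JS)
  qed
  have "((\<lambda>s. integral (cbox 0 1) (F1 s)) has_vector_derivative integral (cbox 0 1) (F2 s)) (at s within J)"
  proof (rule leibniz_rule_vector_derivative[OF _ _ _ J(2,3)])
    show "((\<lambda>s. F1 s t) has_vector_derivative F2 s t) (at s within J)" if "s \<in> J" "t \<in> cbox 0 1" for s t
      using that e(1) by (intro F_deriv(2) JS) (auto simp: J_def)
    show "F1 s integrable_on cbox 0 1" if "s \<in> J" for s
      using slice_continuous[OF c(2) that] integrable_continuous_interval by (simp add: cbox_interval)
    show "continuous_on (J \<times> cbox 0 1) (\<lambda>(s, t). F2 s t)" using c(3) by (simp add: cbox_interval)
  qed
  then show "((\<lambda>s. integral {0..1} (F1 s)) has_real_derivative integral {0..1} (F2 s)) (at s)"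
    using at_within_open[OF J(2,4)] by (simp add: has_real_derivative_iff_has_vector_derivative cbox_interval)
qed

lemma first_variation:
  "integral {0..1} (F1 0) = 2 * G (x 1) (x' 1) (V 1) - 2 * G (x 0) (x' 0) (V 0)"
proof (rule integral_unique, rule fundamental_theorem_of_calculus)
  fix t :: real assume t: "t \<in> {0..1}"
  have "F1 0 t = bform1 G (x t) (V t) (x' t) (x' t) + 2 * G (x t) (x' t) (V' t)"
    unfolding F1_def X_simps using geodesicD(1)[OF geo t] sym_G[of "x t" "V' t"] by simp
  then show "((\<lambda>t. 2 * G (x t) (x' t) (V t)) has_vector_derivative F1 0 t) (at t within {0..1})"
    using geodesic_first_variation[OF geo t dV[OF t]] by (simp add: has_real_derivative_iff_has_vector_derivative)
qed simp

text \<open>From half the second derivative of the density two exact derivatives along the geodesic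
  are subtracted: half the first variation integrand for the acceleration \<open>W\<close> of the
  variation, and the derivative \<open>E\<close> of the Koszul term \<open>K\<close>. Their boundary
  values add up to the covariant accelerations of the end curves paired with the velocity; what
  remains is the curvature integrand.\<close>

lemma second_variation:
  "((\<lambda>t. G (x t) (V' t + \<Gamma> (x t) (x' t) (V t)) (V' t + \<Gamma> (x t) (x' t) (V t)) - Rm G (x t) (V t) (x' t))
     has_integral (integral {0..1} (F2 0) / 2 - (G (x 1) (x' 1) (q'' 0 + \<Gamma> (x 1) (V 1) (V 1))
        - G (x 0) (x' 0) (p'' 0 + \<Gamma> (x 0) (V 0) (V 0))))) {0..1}"
proof -
  obtain e where e: "e > 0" "e \<le> r" "\<And>s t. \<bar>s\<bar> < e \<Longrightarrow> t \<in> {0..1} \<Longrightarrow> X s t \<in> S"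
    using ex_variation_in_S by auto
  define J where "J = {-e<..<e}"
  have J: "J \<subseteq> {-r<..<r}" "0 \<in> J" using e by (auto simp: J_def)
  have JS: "\<And>s t. s \<in> J \<Longrightarrow> t \<in> {0..1} \<Longrightarrow> X s t \<in> S" using e by (auto simp: J_def)
  have "continuous_on {0..1} (F2 0)" by (rule slice_continuous[OF F_continuous(3)[OF J(1) JS] J(2)])
  then have F2: "(F2 0 has_integral integral {0..1} (F2 0)) {0..1}"
    by (intro integrable_integral integrable_continuous_interval)
  define W where "W t = X2 0 t" for t
  have dW: "(W has_vector_derivative Y2 0 t) (at t within {0..1})" for t
    unfolding W_def X2_def Y2_def by (auto intro!: derivative_eq_intros simp: has_vector_derivative_def algebra_simps)
  define K where "K t = koszul G (x t) (V t) (V t) (x' t)" for t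
  define E where "E t = dkoszul G (x t) (x' t) (V t) (V t) (x' t) + 2 * koszul G (x t) (V t) (V' t) (x' t)
     - koszul G (x t) (V t) (V t) (\<Gamma> (x t) (x' t) (x' t))" for t
  have dK: "(K has_vector_derivative E t) (at t within {0..1})" if t: "t \<in> {0..1}" for t
  proof -
    note g = geodesicD[OF geo t] and d = dV[OF t]
    have "(K has_vector_derivative (
      ((bform2 G (x t) (x' t) (V t) (V t) (x' t) + bform1 G (x t) (V' t) (V t) (x' t) + bform1 G (x t) (V t) (V' t) (x' t)
        + bform1 G (x t) (V t) (V t) (- \<Gamma> (x t) (x' t) (x' t)))
      + (bform2 G (x t) (x' t) (V t) (V t) (x' t) + bform1 G (x t) (V' t) (V t) (x' t) + bform1 G (x t) (V t) (V' t) (x' t)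
        + bform1 G (x t) (V t) (V t) (- \<Gamma> (x t) (x' t) (x' t)))
      - (bform2 G (x t) (x' t) (x' t) (V t) (V t) + bform1 G (x t) (- \<Gamma> (x t) (x' t) (x' t)) (V t) (V t)
        + bform1 G (x t) (x' t) (V' t) (V t) + bform1 G (x t) (x' t) (V t) (V' t))) / 2)) (at t within {0..1})"
      unfolding K_def koszul_def
      by (intro has_vector_derivative_divide has_vector_derivative_diff has_vector_derivative_add
          bform1_curve_derivative g d)
    then show ?thesis
      by (rule has_vector_derivative_eq_rhs)
        (use bform1_sym[OF g(1), of "x' t" "V' t" "V t"] in
          \<open>simp add: E_def dkoszul_def koszul_def blinfun.bilinear_simps field_simps\<close>)
  qed
  have K: "(E has_integral K 1 - K 0) {0..1}"
    by (rule fundamental_theorem_of_calculus[OF _ dK]) auto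
  have W: "((\<lambda>t. bform1 G (x t) (W t) (x' t) (x' t) + 2 * G (x t) (x' t) (Y2 0 t)) has_integral
     (2 * G (x 1) (x' 1) (W 1) - 2 * G (x 0) (x' 0) (W 0))) {0..1}"
    by (rule fundamental_theorem_of_calculus)
      (use geodesic_first_variation[OF geo _ dW] in \<open>auto simp: has_real_derivative_iff_has_vector_derivative\<close>)
  have 1: "((\<lambda>t. F2 0 t / 2 - (bform1 G (x t) (W t) (x' t) (x' t) + 2 * G (x t) (x' t) (Y2 0 t)) / 2 - E t) has_integral
     (integral {0..1} (F2 0) / 2 - (2 * G (x 1) (x' 1) (W 1) - 2 * G (x 0) (x' 0) (W 0)) / 2 - (K 1 - K 0))) {0..1}"
    by (intro has_integral_diff has_integral_divide F2 W K)
  have 2: "integral {0..1} (F2 0) / 2 - (2 * G (x 1) (x' 1) (W 1) - 2 * G (x 0) (x' 0) (W 0)) / 2 - (K 1 - K 0)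
     = integral {0..1} (F2 0) / 2 - (G (x 1) (x' 1) (q'' 0 + \<Gamma> (x 1) (V 1) (V 1))
        - G (x 0) (x' 0) (p'' 0 + \<Gamma> (x 0) (V 0) (V 0)))"
  proof -
    have xS: "x 0 \<in> S" "x 1 \<in> S" using geodesicD(1)[OF geo] by auto
    have "K 0 = G (x 0) (x' 0) (\<Gamma> (x 0) (V 0) (V 0))" "K 1 = G (x 1) (x' 1) (\<Gamma> (x 1) (V 1) (V 1))"
      unfolding K_def using xS by (metis christoffel_koszul sym_G)+
    then show ?thesis using xS by (simp add: W_def X2_def G_bilinear_simps diff_divide_distrib)
  qed
  have 3: "F2 0 t / 2 - (bform1 G (x t) (W t) (x' t) (x' t) + 2 * G (x t) (x' t) (Y2 0 t)) / 2 - E t =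
     G (x t) (V' t + \<Gamma> (x t) (x' t) (V t)) (V' t + \<Gamma> (x t) (x' t) (V t)) - Rm G (x t) (V t) (x' t)"
    if t: "t \<in> {0..1}" for t
  proof -
    note xS = geodesicD(1)[OF geo t]
    show ?thesis
      using second_variation_identity[OF xS, of "V t" "x' t" "V' t"] xS
        bform1_sym[OF xS, of "V t" "x' t" "V' t"] sym_G[OF xS, of "x' t" "Y2 0 t"]
      unfolding F2_def X_simps W_def E_def by (simp add: field_simps)
  qed
  show ?thesis by (rule has_integral_eq[OF 3 1[unfolded 2]])
qed

text \<open>Hides the explicit variation, so that the argument on chains sees only energies, their
  derivatives and the moving ends.\<close>

lemma ex_variation:
  "\<exists>X Y e f1 f2. 0 < e \<and> e \<le> r \<and>
    (\<forall>s. \<bar>s\<bar> < e \<longrightarrow> (\<forall>t\<in>{0..1}. X s t \<in> S \<and> (X s has_vector_derivative Y s t) (at t within {0..1})) \<and>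
       continuous_on {0..1} (Y s) \<and> X s 0 = p s \<and> X s 1 = q s \<and>
       ((\<lambda>s. energy G (X s) (Y s)) has_real_derivative f1 s) (at s)) \<and>
    (f1 has_real_derivative f2) (at 0) \<and> energy G (X 0) (Y 0) = energy G x x' \<and>
    f1 0 = 2 * G (x 1) (x' 1) (V 1) - 2 * G (x 0) (x' 0) (V 0) \<and>
    ((\<lambda>t. G (x t) (V' t + \<Gamma> (x t) (x' t) (V t)) (V' t + \<Gamma> (x t) (x' t) (V t)) - Rm G (x t) (V t) (x' t))
     has_integral (f2 / 2 - (G (x 1) (x' 1) (q'' 0 + \<Gamma> (x 1) (V 1) (V 1))
        - G (x 0) (x' 0) (p'' 0 + \<Gamma> (x 0) (V 0) (V 0))))) {0..1}"
proof -
  obtain e where e: "e > 0" "e \<le> r" "\<And>s t. \<bar>s\<bar> < e \<Longrightarrow> t \<in> {0..1} \<Longrightarrow> X s t \<in> S"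
    using ex_variation_in_S by auto
  have Y: "continuous_on {0..1} (Y s)" if "\<bar>s\<bar> < e" for s using Y_continuous that e(2) by simp
  have 0: "energy G (X 0) (Y 0) = energy G x x'" by (simp add: energy_def X_simps)
  note ed = energy_deriv[OF e(2,3)]
  have "\<bar>0\<bar> < e" using e(1) by simp
  note ed0 = ed(2)[OF _ _ this, simplified]
  show ?thesis
    by (rule exI[of _ X], rule exI[of _ Y], rule exI[of _ e], rule exI[of _ "\<lambda>s. integral {0..1} (F1 s)"],
        rule exI[of _ "integral {0..1} (F2 0)"], intro conjI allI impI ballI)
      (use e X_deriv_t Y 0 ed(1) ed0 first_variation second_variation in \<open>simp_all add: X_simps\<close>)
qed

end

section \<open>Charts and tangent vectors\<close>

locale manifold =
  fixes A :: "('m::{t2_space,second_countable_topology}, 'e::euclidean_space) chart set"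
  assumes atlas: "smooth_structure A"
begin

definition overlap :: "('m, 'e) chart \<Rightarrow> ('m, 'e) chart \<Rightarrow> 'e set" where
  "overlap c d = coord c ` (cdom c \<inter> cdom d)"

lemma chart_facts:
  assumes "c \<in> A"
  shows "open (cdom c)" "open (cimg c)" "continuous_on (cdom c) (coord c)" "continuous_on (cimg c) (param c)"
    "\<And>p. p \<in> cdom c \<Longrightarrow> param c (coord c p) = p" "\<And>x. x \<in> cimg c \<Longrightarrow> coord c (param c x) = x"
    "\<And>x. x \<in> cimg c \<Longrightarrow> param c x \<in> cdom c"
proof -
  have h: "is_chart c" using assms atlas unfolding smooth_structure_def by blast
  then show "open (cdom c)" "open (cimg c)" unfolding is_chart_def by auto
  have h: "homeomorphism (cdom c) (cimg c) (coord c) (param c)" using h unfolding is_chart_def by blast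
  show "continuous_on (cdom c) (coord c)" "continuous_on (cimg c) (param c)"
    "\<And>p. p \<in> cdom c \<Longrightarrow> param c (coord c p) = p" "\<And>x. x \<in> cimg c \<Longrightarrow> coord c (param c x) = x"
    "\<And>x. x \<in> cimg c \<Longrightarrow> param c x \<in> cdom c"
    using h unfolding homeomorphism_def by auto
qed

lemma ex_chart: "\<exists>c\<in>A. p \<in> cdom c"
  using atlas unfolding smooth_structure_def by blast

lemma chart_at: "chart_at A p \<in> A" "p \<in> cdom (chart_at A p)"
proof -
  have "chart_at A p \<in> A \<and> p \<in> cdom (chart_at A p)"
    unfolding chart_at_def using ex_chart[of p] by (intro someI_ex[of "\<lambda>c. c \<in> A \<and> p \<in> cdom c"]) blast
  then show "chart_at A p \<in> A" "p \<in> cdom (chart_at A p)" by auto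
qed

lemma open_coord_image:
  assumes "c \<in> A" "open V"
  shows "open (coord c ` (cdom c \<inter> V))"
proof -
  have "coord c ` (cdom c \<inter> V) = cimg c \<inter> param c -` V"
    using chart_facts[OF assms(1)] by force
  then show ?thesis
    using continuous_on_open_vimage[OF chart_facts(2)[OF assms(1)]] chart_facts(4)[OF assms(1)] assms(2)
    by (metis inf_commute)
qed

lemma open_overlap: "c \<in> A \<Longrightarrow> d \<in> A \<Longrightarrow> open (overlap c d)"
  unfolding overlap_def by (intro open_coord_image chart_facts(1))

lemma overlapI: "p \<in> cdom c \<Longrightarrow> p \<in> cdom d \<Longrightarrow> coord c p \<in> overlap c d"
  unfolding overlap_def by blast

lemma overlap_iff: "c \<in> A \<Longrightarrow> x \<in> overlap c d \<longleftrightarrow> x \<in> cimg c \<and> param c x \<in> cdom d"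
proof -
  assume c: "c \<in> A"
  show ?thesis
  proof
    show "x \<in> overlap c d \<Longrightarrow> x \<in> cimg c \<and> param c x \<in> cdom d"
      unfolding overlap_def using chart_facts(5)[OF c] by auto
    assume x: "x \<in> cimg c \<and> param c x \<in> cdom d"
    then have "coord c (param c x) \<in> overlap c d" by (intro overlapI chart_facts(7)[OF c]) auto
    then show "x \<in> overlap c d" using x chart_facts(6)[OF c] by simp
  qed
qed

lemma transition_smooth:
  assumes "c \<in> A" "d \<in> A" shows "smooth_on (overlap c d) (transition c d)"
proof -
  have "compatible c d" using assms atlas unfolding smooth_structure_def by blast
  then show ?thesis unfolding compatible_def overlap_def by blast
qed

lemma transition_coord: "c \<in> A \<Longrightarrow> p \<in> cdom c \<Longrightarrow> transition c d (coord c p) = coord d p"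
  unfolding transition_def by (simp add: chart_facts)

lemma transition_overlap: "c \<in> A \<Longrightarrow> x \<in> overlap c d \<Longrightarrow> transition c d x \<in> overlap d c"
proof -
  assume c: "c \<in> A" and "x \<in> overlap c d"
  then obtain p where p: "x = coord c p" "p \<in> cdom c" "p \<in> cdom d" unfolding overlap_def by blast
  show "transition c d x \<in> overlap d c"
    unfolding p(1) transition_coord[OF c p(2)] by (rule overlapI[OF p(3,2)])
qed

lemma param_transition: "c \<in> A \<Longrightarrow> d \<in> A \<Longrightarrow> x \<in> overlap c d \<Longrightarrow> param d (transition c d x) = param c x"
  unfolding transition_def by (simp add: overlap_iff chart_facts)

definition tmap :: "('m, 'e) chart \<Rightarrow> ('m, 'e) chart \<Rightarrow> 'm \<Rightarrow> 'e \<Rightarrow>\<^sub>L 'e" where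
  "tmap c d p = dB (transition c d) (coord c p)"

lemma transition_deriv:
  assumes "c \<in> A" "d \<in> A" "p \<in> cdom c" "p \<in> cdom d"
  shows "(transition c d has_derivative blinfun_apply (tmap c d p)) (at (coord c p))"
  unfolding tmap_def
  by (rule smooth_on_has_derivative[OF transition_smooth[OF assms(1,2)] overlapI[OF assms(3,4)]])

lemma D_transition:
  assumes "c \<in> A" "d \<in> A" "p \<in> cdom c" "p \<in> cdom d"
  shows "D (transition c d) (coord c p) = blinfun_apply (tmap c d p)"
  by (rule D_eqI[OF transition_deriv[OF assms]])

text \<open>Chain rule for transition maps on the triple overlap; it makes \<open>tvec_of\<close> a
  tangent vector and the derivatives of opposite transitions inverse to each other.\<close>

lemma tmap_cocycle:
  assumes "c \<in> A" "d \<in> A" "e \<in> A" "p \<in> cdom c" "p \<in> cdom d" "p \<in> cdom e"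
  shows "tmap d e p (tmap c d p a) = tmap c e p a"
proof -
  let ?V = "coord c ` (cdom c \<inter> (cdom d \<inter> cdom e))"
  have op: "open ?V" by (intro open_coord_image assms open_Int chart_facts(1))
  have p: "coord c p \<in> ?V" using assms by blast
  have eq: "transition d e (transition c d y) = transition c e y" if y: "y \<in> ?V" for y
  proof -
    obtain x where x: "y = coord c x" "x \<in> cdom c" "x \<in> cdom d" using y by blast
    show ?thesis
      by (simp add: x(1) transition_coord[OF assms(1) x(2)] transition_coord[OF assms(2) x(3)])
  qed
  have 1: "(transition d e has_derivative blinfun_apply (tmap d e p)) (at (transition c d (coord c p)))"
    using transition_deriv[OF assms(2,3,5,6)] transition_coord[OF assms(1,4)] by simp
  have "((\<lambda>y. transition d e (transition c d y)) has_derivative (\<lambda>a. tmap d e p (tmap c d p a))) (at (coord c p))"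
    by (rule has_derivative_compose[OF transition_deriv[OF assms(1,2,4,5)] 1])
  then have "(transition c e has_derivative (\<lambda>a. tmap d e p (tmap c d p a))) (at (coord c p))"
    by (rule has_derivative_transform_within_open[OF _ op p eq])
  from D_eqI[OF this] show ?thesis using D_transition[OF assms(1,3,4,6)] by metis
qed

lemma tmap_refl: assumes "c \<in> A" "p \<in> cdom c" shows "tmap c c p a = a"
proof -
  have "(transition c c has_derivative (\<lambda>a. a)) (at (coord c p))"
    by (rule has_derivative_transform_within_open[OF has_derivative_ident chart_facts(2)[OF assms(1)]])
      (use assms in \<open>auto simp: transition_coord[OF assms(1), of _ c]\<close>)
  from D_eqI[OF this] show ?thesis using D_transition[OF assms(1,1,2,2)] by metis
qed

lemma tmap_inverse:
  assumes "c \<in> A" "d \<in> A" "p \<in> cdom c" "p \<in> cdom d"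
  shows "tmap d c p (tmap c d p a) = a"
  using tmap_cocycle[of c d c p a] tmap_refl assms by simp

lemma surj_tmap:
  assumes "c \<in> A" "d \<in> A" "p \<in> cdom c" "p \<in> cdom d"
  shows "surj (blinfun_apply (tmap c d p))"
  using tmap_inverse[of d c p] assms by (metis surjI)

lemma tangent_change:
  assumes "v \<in> tangent_space A p" "c \<in> A" "d \<in> A" "p \<in> cdom c" "p \<in> cdom d"
  shows "v d = tmap c d p (v c)"
proof -
  have "v d = D (transition c d) (coord c p) (v c)" using assms unfolding tangent_space_def by blast
  then show ?thesis by (simp add: D_transition assms)
qed

lemma tangentI:
  assumes "\<And>c d. c \<in> A \<Longrightarrow> d \<in> A \<Longrightarrow> p \<in> cdom c \<Longrightarrow> p \<in> cdom d \<Longrightarrow> v d = tmap c d p (v c)"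
    "\<And>c. \<not> (c \<in> A \<and> p \<in> cdom c) \<Longrightarrow> v c = 0"
  shows "v \<in> tangent_space A p"
  unfolding tangent_space_def mem_Collect_eq
proof (intro conjI ballI allI impI)
  fix c d assume "c \<in> A" "d \<in> A" "p \<in> cdom c \<inter> cdom d"
  then show "v d = D (transition c d) (coord c p) (v c)" using assms(1)[of c d] D_transition[of c d p] by simp
qed (use assms(2) in blast)

lemma tangent_zero: "v \<in> tangent_space A p \<Longrightarrow> \<not> (c \<in> A \<and> p \<in> cdom c) \<Longrightarrow> v c = 0"
  unfolding tangent_space_def by blast

lemma tvec_of_apply:
  assumes "c \<in> A" "d \<in> A" "p \<in> cdom c" "p \<in> cdom d"
  shows "tvec_of A c p a d = tmap c d p a"
  using assms D_transition[OF assms] unfolding tvec_of_def by simp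

lemma tvec_of_self: "c \<in> A \<Longrightarrow> p \<in> cdom c \<Longrightarrow> tvec_of A c p a c = a"
  by (simp add: tvec_of_apply tmap_refl)

lemma tvec_of_tangent:
  assumes "c \<in> A" "p \<in> cdom c" shows "tvec_of A c p a \<in> tangent_space A p"
proof (rule tangentI)
  fix d e assume de: "d \<in> A" "e \<in> A" "p \<in> cdom d" "p \<in> cdom e"
  then show "tvec_of A c p a e = tmap d e p (tvec_of A c p a d)"
    using assms by (simp add: tvec_of_apply tmap_cocycle)
next
  fix d assume "\<not> (d \<in> A \<and> p \<in> cdom d)"
  then show "tvec_of A c p a d = 0" unfolding tvec_of_def by (rule if_not_P)
qed

lemma tvec_of_component:
  assumes "v \<in> tangent_space A p" "c \<in> A" "p \<in> cdom c"
  shows "tvec_of A c p (v c) = v"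
proof
  fix d show "tvec_of A c p (v c) d = v d"
  proof (cases "d \<in> A \<and> p \<in> cdom d")
    case True
    then show ?thesis
      using tangent_change[OF assms(1,2) _ assms(3), of d] tvec_of_apply[OF assms(2) _ assms(3), of d] by simp
  next
    case False
    then show ?thesis using tangent_zero[OF assms(1) False] unfolding tvec_of_def by (simp only: if_False)
  qed
qed

lemma tvec_of_change:
  assumes "c \<in> A" "d \<in> A" "p \<in> cdom c" "p \<in> cdom d"
  shows "tvec_of A c p a = tvec_of A d p (tmap c d p a)"
  using tvec_of_component[OF tvec_of_tangent[OF assms(1,3)] assms(2,4)] tvec_of_apply[OF assms] by metis

lemma tangent_eqI:
  assumes "u \<in> tangent_space A p" "v \<in> tangent_space A p" "c \<in> A" "p \<in> cdom c" "u c = v c"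
  shows "u = v"
  using tvec_of_component assms by metis

lemma zero_tangent: "(\<lambda>_. 0) \<in> tangent_space A p"
  by (rule tangentI) auto

lemma tangent_add:
  assumes "u \<in> tangent_space A p" "v \<in> tangent_space A p"
  shows "(\<lambda>c. u c + v c) \<in> tangent_space A p"
proof (rule tangentI)
  fix c d assume h: "c \<in> A" "d \<in> A" "p \<in> cdom c" "p \<in> cdom d"
  show "u d + v d = tmap c d p (u c + v c)"
    using tangent_change[OF assms(1) h] tangent_change[OF assms(2) h] by (simp add: blinfun.add_right)
next
  fix c assume h: "\<not> (c \<in> A \<and> p \<in> cdom c)"
  show "u c + v c = 0" using tangent_zero[OF assms(1) h] tangent_zero[OF assms(2) h] by simp
qed

lemma tangent_scale:
  assumes "u \<in> tangent_space A p"
  shows "(\<lambda>c. r *\<^sub>R u c) \<in> tangent_space A p"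
proof (rule tangentI)
  fix c d assume h: "c \<in> A" "d \<in> A" "p \<in> cdom c" "p \<in> cdom d"
  show "r *\<^sub>R u d = tmap c d p (r *\<^sub>R u c)"
    using tangent_change[OF assms h] by (simp add: blinfun.scaleR_right)
next
  fix c assume h: "\<not> (c \<in> A \<and> p \<in> cdom c)"
  show "r *\<^sub>R u c = 0" using tangent_zero[OF assms h] by simp
qed

lemma tvec_of_add:
  assumes "c \<in> A" "p \<in> cdom c"
  shows "tvec_of A c p (a + b) = (\<lambda>d. tvec_of A c p a d + tvec_of A c p b d)"
  by (rule tangent_eqI[OF _ _ assms]) (simp_all add: assms tangent_add tvec_of_tangent tvec_of_self)

lemma tvec_of_scale:
  assumes "c \<in> A" "p \<in> cdom c"
  shows "tvec_of A c p (r *\<^sub>R a) = (\<lambda>d. r *\<^sub>R tvec_of A c p a d)"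
  by (rule tangent_eqI[OF _ _ assms]) (simp_all add: assms tangent_scale tvec_of_tangent tvec_of_self)

end

section \<open>Metric, curvature, Lie derivative and Hessian in an arbitrary chart\<close>

locale riemannian = manifold A for A :: "('m::{t2_space,second_countable_topology}, 'e::euclidean_space) chart set" +
  fixes g :: "'m \<Rightarrow> ('m, 'e) tvec \<Rightarrow> ('m, 'e) tvec \<Rightarrow> real"
  assumes metric: "riemannian_metric A g"
begin

abbreviation mr :: "('m, 'e) chart \<Rightarrow> 'e \<Rightarrow> 'e \<Rightarrow> 'e \<Rightarrow> real" where
  "mr c \<equiv> metric_rep A g c"

lemma metric_facts:
  assumes "u \<in> tangent_space A p" "v \<in> tangent_space A p"
  shows "g p u v = g p v u" "w \<in> tangent_space A p \<Longrightarrow> g p (\<lambda>c. u c + w c) v = g p u v + g p w v"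
    "g p (\<lambda>c. r *\<^sub>R u c) v = r * g p u v" "u \<noteq> (\<lambda>c. 0) \<Longrightarrow> g p u u > 0"
  using metric assms unfolding riemannian_metric_def by blast+

lemma g_eq:
  assumes "u \<in> tangent_space A p" "v \<in> tangent_space A p" "c \<in> A" "p \<in> cdom c"
  shows "g p u v = mr c (coord c p) (u c) (v c)"
  unfolding metric_rep_def using assms by (simp add: chart_facts tvec_of_component)

lemma chart_metric_mr:
  assumes c: "c \<in> A" shows "chart_metric (cimg c) (mr c)"
proof
  show "open (cimg c)" by (rule chart_facts(2)[OF c])
  fix x assume x: "x \<in> cimg c"
  define p where "p = param c x"
  have p: "p \<in> cdom c" using chart_facts(7)[OF c x] p_def by simp
  note t = tvec_of_tangent[OF c p]
  have e: "mr c x a b = g p (tvec_of A c p a) (tvec_of A c p b)" for a b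
    by (simp add: metric_rep_def p_def)
  show s: "mr c x a b = mr c x b a" for a b unfolding e by (rule metric_facts(1)[OF t t])
  have add: "mr c x (a + a') b = mr c x a b + mr c x a' b" for a a' b
    unfolding e tvec_of_add[OF c p] by (rule metric_facts(2)[OF t t t])
  have scale: "mr c x (r *\<^sub>R a) b = r * mr c x a b" for r a b
    unfolding e tvec_of_scale[OF c p] by (rule metric_facts(3)[OF t t])
  show "bilinear (mr c x)"
    unfolding bilinear_def
  proof (intro conjI allI)
    show "linear (mr c x a)" for a
      by (rule linearI) (use s[of a] add scale in simp_all)
    show "linear (\<lambda>a. mr c x a b)" for b
      by (rule linearI) (use add scale in simp_all)
  qed
  show "mr c x a a > 0" if "a \<noteq> 0" for a
    unfolding e
  proof (rule metric_facts(4)[OF t t])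
    show "tvec_of A c p a \<noteq> (\<lambda>c. 0)" using tvec_of_self[OF c p, of a] that by auto
  qed
next
  show "smooth_on (cimg c) (\<lambda>x. mr c x a b)" for a b
    using metric c unfolding riemannian_metric_def by blast
qed

text \<open>Isometry holds because both representations evaluate \<open>g\<close> on the same two
  tangent vectors.\<close>

lemma chart_change_transition:
  assumes c: "c \<in> A" and d: "d \<in> A"
  shows "chart_change (cimg c) (mr c) (cimg d) (mr d) (overlap c d) (transition c d)"
proof (intro chart_change.intro chart_change_axioms.intro chart_metric_mr c d open_overlap transition_smooth)
  show "overlap c d \<subseteq> cimg c" unfolding overlap_def by blast
  show "transition c d ` overlap c d \<subseteq> cimg d"
    using transition_overlap[OF c] overlap_def by blast
  fix x assume x: "x \<in> overlap c d"
  then obtain p where p: "p \<in> cdom c" "p \<in> cdom d" "x = coord c p" unfolding overlap_def by blast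
  have t: "dB (transition c d) x = tmap c d p" by (simp add: tmap_def p)
  show "surj (blinfun_apply (dB (transition c d) x))" unfolding t by (rule surj_tmap[OF c d p(1,2)])
  show "mr c x a b = mr d (transition c d x) (dB (transition c d) x a) (dB (transition c d) x b)" for a b
    unfolding metric_rep_def param_transition[OF c d x] t
    using p chart_facts(5)[OF c p(1)] tvec_of_change[OF c d p(1,2)] by simp
qed

lemma g_zero: "u \<in> tangent_space A p \<Longrightarrow> g p u (\<lambda>_. 0) = 0"
  using g_eq[OF _ zero_tangent, of u p "chart_at A p"] chart_at[of p]
    chart_metric.G_bilinear_simps(10)[OF chart_metric_mr] by simp

lemma christoffel_change:
  assumes "c \<in> A" "d \<in> A" "p \<in> cdom c" "p \<in> cdom d"
  shows "tmap c d p (christoffel (mr c) (coord c p) a b) =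
    christoffel (mr d) (coord d p) (tmap c d p a) (tmap c d p b) + dB (dB (transition c d)) (coord c p) a b"
  using chart_change.christoffel_pullback[OF chart_change_transition[OF assms(1,2)] overlapI[OF assms(3,4)]]
  by (simp add: transition_coord assms tmap_def)

lemma Rm_change:
  assumes "c \<in> A" "d \<in> A" "p \<in> cdom c" "p \<in> cdom d"
  shows "Rm (mr c) (coord c p) v t = Rm (mr d) (coord d p) (tmap c d p v) (tmap c d p t)"
  using chart_change.Rm_pullback[OF chart_change_transition[OF assms(1,2)] overlapI[OF assms(3,4)]]
  by (simp add: transition_coord assms tmap_def)

text \<open>The definition evaluates in the chart picked by \<open>chart_at\<close>; invariance of
  \<open>Rm\<close> moves the evaluation to the chart of a geodesic piece. The denominator of
  \<open>sec_rep\<close> is 1 for an orthonormal pair.\<close>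

lemma sectional_curvature_chart:
  assumes "orthonormal_pair A g p U V" and c: "c \<in> A" "p \<in> cdom c"
  shows "sectional_curvature A g p U V = Rm (mr c) (coord c p) (U c) (V c)"
proof -
  define d where "d = chart_at A p"
  have d: "d \<in> A" "p \<in> cdom d" using chart_at d_def by auto
  have UV: "U \<in> tangent_space A p" "V \<in> tangent_space A p" "g p U U = 1" "g p V V = 1" "g p U V = 0"
    using assms(1) unfolding orthonormal_pair_def by auto
  have "sectional_curvature A g p U V = sec_rep (mr d) (coord d p) (U d) (V d)"
    by (simp add: sectional_curvature_def Let_def d_def)
  also have "\<dots> = Rm (mr d) (coord d p) (U d) (V d)"
    using UV(3-5) g_eq[OF UV(1,1) d] g_eq[OF UV(2,2) d] g_eq[OF UV(1,2) d] d
    by (intro chart_metric.sec_rep_Rm[OF chart_metric_mr[OF d(1)]]) auto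
  also have "\<dots> = Rm (mr c) (coord c p) (U c) (V c)"
    using Rm_change[OF c(1) d(1) c(2) d(2), of "U c" "V c"]
      tangent_change[OF UV(1) c(1) d(1) c(2) d(2)] tangent_change[OF UV(2) c(1) d(1) c(2) d(2)] by simp
  finally show ?thesis .
qed

lemma field_rep_smooth:
  assumes "smooth_vector_field_on A UNIV X" "c \<in> A"
  shows "smooth_on (cimg c) (field_rep X c)"
  using assms unfolding smooth_vector_field_on_def by force

lemma lie_derivative_chart:
  assumes X: "smooth_vector_field_on A UNIV X" and v: "v \<in> tangent_space A p" and c: "c \<in> A" "p \<in> cdom c"
  shows "lie_derivative_metric A g X p v v =
    bform1 (mr c) (coord c p) (field_rep X c (coord c p)) (v c) (v c)
      + 2 * mr c (coord c p) (dB (field_rep X c) (coord c p) (v c)) (v c)"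
proof -
  define d where "d = chart_at A p"
  have d: "d \<in> A" "p \<in> cdom d" using chart_at d_def by auto
  note cm = chart_metric_mr[OF d(1)]
  have dX: "field_rep X e differentiable (at (coord e p))" if "e \<in> A" "p \<in> cdom e" for e
    using smooth_on_differentiable[OF field_rep_smooth[OF X that(1)]] that(2) by blast
  have in_d: "coord d p \<in> cimg d" using d by blast
  have "lie_derivative_metric A g X p v v =
    bform1 (mr d) (coord d p) (field_rep X d (coord d p)) (v d) (v d)
      + 2 * mr d (coord d p) (dB (field_rep X d) (coord d p) (v d)) (v d)"
    unfolding lie_derivative_metric_def Let_def d_def[symmetric] chart_metric.D_G[OF cm in_d]
    using chart_metric.sym_G[OF cm in_d, of "v d"] by (simp add: dB_apply[OF dX[OF d]])
  also have "\<dots> = bform1 (mr c) (coord c p) (field_rep X c (coord c p)) (v c) (v c)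
      + 2 * mr c (coord c p) (dB (field_rep X c) (coord c p) (v c)) (v c)"
  proof -
    have "field_rep X d (transition c d y) = dB (transition c d) y (field_rep X c y)" if y: "y \<in> overlap c d" for y
    proof -
      obtain q where q: "q \<in> cdom c" "q \<in> cdom d" "y = coord c q" using y unfolding overlap_def by blast
      have "X q \<in> tangent_space A q" using X unfolding smooth_vector_field_on_def by blast
      from tangent_change[OF this c(1) d(1) q(1,2)] show ?thesis
        unfolding field_rep_def param_transition[OF c(1) d(1) y]
        using q chart_facts(5)[OF c(1) q(1)] by (simp add: tmap_def)
    qed
    from chart_change.lie_pullback[OF chart_change_transition[OF c(1) d(1)] overlapI[OF c(2) d(2)] dX[OF c] _ this]
    show ?thesis
      using dX[OF d] tangent_change[OF v c(1) d(1) c(2) d(2)] transition_coord[OF c, of d] by (simp add: tmap_def)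
  qed
  finally show ?thesis .
qed

definition frep :: "('m \<Rightarrow> real) \<Rightarrow> ('m, 'e) chart \<Rightarrow> 'e \<Rightarrow> real" where
  "frep f c = (\<lambda>x. f (param c x))"

lemma frep_smooth: "smooth_function A f \<Longrightarrow> c \<in> A \<Longrightarrow> smooth_on (cimg c) (frep f c)"
  unfolding smooth_function_def frep_def by blast

lemma frep_change:
  assumes "smooth_function A f" "v \<in> tangent_space A p" and c: "c \<in> A" "p \<in> cdom c" and d: "d \<in> A" "p \<in> cdom d"
  shows "dB (frep f c) (coord c p) (v c) = dB (frep f d) (coord d p) (v d)"
    "dB (dB (frep f c)) (coord c p) (v c) (v c) - dB (frep f c) (coord c p) (christoffel (mr c) (coord c p) (v c) (v c))
   = dB (dB (frep f d)) (coord d p) (v d) (v d) - dB (frep f d) (coord d p) (christoffel (mr d) (coord d p) (v d) (v d))"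
proof -
  have "frep f c y = frep f d (transition c d y)" if "y \<in> overlap c d" for y
    unfolding frep_def using param_transition[OF c(1) d(1) that] by simp
  note h = chart_change.hess_pullback[OF chart_change_transition[OF c(1) d(1)] overlapI[OF c(2) d(2)]
      frep_smooth[OF assms(1) c(1)] frep_smooth[OF assms(1) d(1)] this]
  show "dB (frep f c) (coord c p) (v c) = dB (frep f d) (coord d p) (v d)"
    "dB (dB (frep f c)) (coord c p) (v c) (v c) - dB (frep f c) (coord c p) (christoffel (mr c) (coord c p) (v c) (v c))
   = dB (dB (frep f d)) (coord d p) (v d) (v d) - dB (frep f d) (coord d p) (christoffel (mr d) (coord d p) (v d) (v d))"
    using h tangent_change[OF assms(2) c(1) d(1) c(2) d(2)] transition_coord[OF c, of d] by (simp_all add: tmap_def)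
qed

lemma differential_chart:
  assumes f: "smooth_function A f" and v: "v \<in> tangent_space A p" and c: "c \<in> A" "p \<in> cdom c"
  shows "differential A f p v = dB (frep f c) (coord c p) (v c)"
proof -
  define d where "d = chart_at A p"
  have d: "d \<in> A" "p \<in> cdom d" using chart_at d_def by auto
  have "differential A f p v = dB (frep f d) (coord d p) (v d)"
    unfolding differential_def Let_def d_def[symmetric] frep_def[symmetric]
    using smooth_on_D_eq[OF frep_smooth[OF f d(1)]] d by simp
  then show ?thesis using frep_change(1)[OF f v c d] by simp
qed

lemma hessian_chart:
  assumes f: "smooth_function A f" and v: "v \<in> tangent_space A p" and c: "c \<in> A" "p \<in> cdom c"
  shows "hessian A g f p v v = dB (dB (frep f c)) (coord c p) (v c) (v c)
    - dB (frep f c) (coord c p) (christoffel (mr c) (coord c p) (v c) (v c))"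
proof -
  define d where "d = chart_at A p"
  have d: "d \<in> A" "p \<in> cdom d" using chart_at d_def by auto
  have dm: "coord d p \<in> cimg d" using d by blast
  note F = frep_smooth[OF f d(1)]
  note op = chart_facts(2)[OF d(1)]
  have "D (\<lambda>y. D (frep f d) y (v d)) (coord d p) = D (\<lambda>y. dB (frep f d) y (v d)) (coord d p)"
    by (rule D_cong_open[OF op dm]) (use smooth_on_D_eq[OF F] in simp)
  also have "\<dots> = (\<lambda>u. dB (dB (frep f d)) (coord d p) u (v d))"
    by (rule D_eqI) (use smooth_on_has_derivative[OF smooth_on_dB[OF op F] dm] in
        \<open>auto intro!: derivative_eq_intros simp: blinfun.bilinear_simps\<close>)
  finally have "hessian A g f p v v = dB (dB (frep f d)) (coord d p) (v d) (v d)
    - dB (frep f d) (coord d p) (christoffel (mr d) (coord d p) (v d) (v d))"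
    unfolding hessian_def Let_def d_def[symmetric] frep_def[symmetric]
    using smooth_on_D_eq[OF F dm] by (simp add: nabla_rep_def)
  then show ?thesis using frep_change(2)[OF f v c d] by simp
qed

end

section \<open>Minimising chains of geodesics\<close>

text \<open>Subsequences are extracted for one index after the other; later extractions preserve the
  earlier limits.\<close>

lemma finitely_many_convergent_subsequences:
  fixes P :: "nat \<Rightarrow> nat \<Rightarrow> 'm::first_countable_topology"
  assumes "compact (UNIV :: 'm set)"
  shows "\<exists>r L. strict_mono r \<and> (\<forall>i<k. (\<lambda>n. P (r n) i) \<longlonglongrightarrow> L i)"
proof (induction k)
  case 0
  then show ?case by (auto intro!: exI[of _ id] simp: strict_mono_def)
next
  case (Suc k)
  then obtain r L where r: "strict_mono r" "\<forall>i<k. (\<lambda>n. P (r n) i) \<longlonglongrightarrow> L i" by blast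
  have "seq_compact (UNIV :: 'm set)" by (rule compact_imp_seq_compact[OF assms])
  then obtain l s where s: "strict_mono s" "((\<lambda>n. P (r n) k) \<circ> s) \<longlonglongrightarrow> l"
    unfolding seq_compact_def by blast
  have "(\<lambda>n. P ((r \<circ> s) n) i) \<longlonglongrightarrow> (L(k := l)) i" if "i < Suc k" for i
  proof (cases "i = k")
    case True then show ?thesis using s(2) by (simp add: o_def)
  next
    case False
    then have "(\<lambda>n. P (r n) i) \<longlonglongrightarrow> L i" using r(2) that by simp
    from LIMSEQ_subseq_LIMSEQ[OF this s(1)] show ?thesis using False by (simp add: o_def)
  qed
  then show ?case using strict_mono_o[OF r(1) s(1)] by blast
qed

section \<open>Piecewise curves, their subdivision and reachability\<close>

context riemannian
begin

definition seg :: "('m, 'e) chart \<Rightarrow> (real \<Rightarrow> 'e) \<Rightarrow> (real \<Rightarrow> 'e) \<Rightarrow> bool" where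
  "seg c x x' \<longleftrightarrow> c \<in> A \<and> (\<forall>t\<in>{0..1}. x t \<in> cimg c \<and> (x has_vector_derivative x' t) (at t within {0..1})) \<and>
     continuous_on {0..1} x'"

text \<open>Chart and parametrisation are hidden and only the ends and the energy remain, so that
  the competitors of a minimal chain range over all charts.\<close>

definition joins :: "'m \<Rightarrow> 'm \<Rightarrow> real \<Rightarrow> bool" where
  "joins p q E \<longleftrightarrow> (\<exists>c x x'. seg c x x' \<and> param c (x 0) = p \<and> param c (x 1) = q \<and> energy (mr c) x x' = E)"

inductive chain :: "nat \<Rightarrow> 'm \<Rightarrow> 'm \<Rightarrow> real \<Rightarrow> bool" where
  chain_Nil: "chain 0 p p 0"
| chain_Cons: "chain n p q T \<Longrightarrow> joins q r E \<Longrightarrow> chain (Suc n) p r (T + E)"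

lemma segD:
  assumes "seg c x x'"
  shows "c \<in> A" "\<And>t. t \<in> {0..1} \<Longrightarrow> x t \<in> cimg c" "\<And>t. t \<in> {0..1} \<Longrightarrow> (x has_vector_derivative x' t) (at t within {0..1})"
    "continuous_on {0..1} x'" "continuous_on {0..1} x" "x ` {0..1} \<subseteq> cimg c"
proof -
  show "c \<in> A" and 1: "\<And>t. t \<in> {0..1} \<Longrightarrow> x t \<in> cimg c"
    and 2: "\<And>t. t \<in> {0..1} \<Longrightarrow> (x has_vector_derivative x' t) (at t within {0..1})"
    and "continuous_on {0..1} x'"
    using assms unfolding seg_def by blast+
  show "continuous_on {0..1} x" by (rule continuous_on_vector_derivative[OF 2])
  show "x ` {0..1} \<subseteq> cimg c" using 1 by (rule image_subsetI)
qed

lemma energy_integrand_continuous: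
  assumes "seg c x x'"
  shows "continuous_on {0..1} (\<lambda>t. mr c (x t) (x' t) (x' t))"
  by (rule chart_metric.continuous_on_G[OF chart_metric_mr segD(5,4,4,6)]) (use segD[OF assms] assms in auto)

lemma energy_nonneg: "seg c x x' \<Longrightarrow> energy (mr c) x x' \<ge> 0"
  unfolding energy_def
  by (rule integral_nonneg)
    (auto intro!: integrable_continuous_interval energy_integrand_continuous
      chart_metric.G_nonneg[OF chart_metric_mr] segD(1,2))

lemma joins_nonneg: "joins p q E \<Longrightarrow> E \<ge> 0"
  unfolding joins_def using energy_nonneg by blast

text \<open>A transition map is an isometry of the coordinate metrics, so a curve contained in a
  second chart has the same energy there.\<close>

lemma seg_transfer:
  assumes s: "seg c x x'" and d: "d \<in> A" and sub: "\<And>t. t \<in> {0..1} \<Longrightarrow> param c (x t) \<in> cdom d"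
  defines "y \<equiv> \<lambda>t. transition c d (x t)" and "y' \<equiv> \<lambda>t. dB (transition c d) (x t) (x' t)"
  shows "seg d y y'" "energy (mr d) y y' = energy (mr c) x x'"
    "\<And>t. t \<in> {0..1} \<Longrightarrow> param d (y t) = param c (x t)" "\<And>t. t \<in> {0..1} \<Longrightarrow> y t = coord d (param c (x t))"
proof -
  note c = segD(1)[OF s]
  have ov: "x t \<in> overlap c d" if "t \<in> {0..1}" for t
    using overlap_iff[OF c] segD(2)[OF s that] sub[OF that] by blast
  show eq: "param d (y t) = param c (x t)" if "t \<in> {0..1}" for t
    unfolding y_def by (rule param_transition[OF c d ov[OF that]])
  show "y t = coord d (param c (x t))" if "t \<in> {0..1}" for t
    unfolding y_def transition_def ..
  have yd: "y t \<in> cimg d" if "t \<in> {0..1}" for t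
    using transition_overlap[OF c ov[OF that]] overlap_iff[OF d] unfolding y_def by blast
  have der: "(y has_vector_derivative y' t) (at t within {0..1})" if "t \<in> {0..1}" for t
    unfolding y_def y'_def
    by (rule has_vector_derivative_compose[OF segD(3)[OF s that]
        smooth_on_has_derivative[OF transition_smooth[OF c d] ov[OF that]]])
  have "continuous_on (overlap c d) (dB (transition c d))"
    by (intro smooth_on_continuous smooth_on_dB open_overlap transition_smooth c d)
  then have "continuous_on {0..1} (\<lambda>t. dB (transition c d) (x t))"
    by (rule continuous_on_compose2[OF _ segD(5)[OF s]]) (use ov in blast)
  then have "continuous_on {0..1} y'"
    unfolding y'_def by (intro continuous_intros segD(4)[OF s])
  then show "seg d y y'" unfolding seg_def using d yd der by blast
  show "energy (mr d) y y' = energy (mr c) x x'"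
    unfolding energy_def
    by (rule integral_cong)
      (simp add: y_def y'_def chart_change.isometric[OF chart_change_transition[OF c d] ov, symmetric])
qed

text \<open>Rescaling to the unit interval multiplies the squared speed by
  \<open>(b - a)\<^sup>2\<close>, and the change of variables divides by \<open>b - a\<close>; hence
  the single factor.\<close>

lemma seg_restrict:
  assumes s: "seg c x x'" and ab: "0 \<le> a" "a \<le> b" "b \<le> 1"
  defines "y \<equiv> \<lambda>t. x (a + (b - a) * t)" and "y' \<equiv> \<lambda>t. (b - a) *\<^sub>R x' (a + (b - a) * t)"
  shows "seg c y y'" "energy (mr c) y y' = (b - a) * integral {a..b} (\<lambda>t. mr c (x t) (x' t) (x' t))"
proof -
  have mem: "a + (b - a) * t \<in> {0..1}" if "t \<in> {0..1}" for t
  proof -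
    have "0 \<le> (b - a) * t" "(b - a) * t \<le> (b - a) * 1" using that ab mult_left_mono[of t 1 "b - a"] by auto
    then show ?thesis using ab by auto
  qed
  note cm = chart_metric_mr[OF segD(1)[OF s]]
  have "(y has_vector_derivative y' t) (at t within {0..1})" if t: "t \<in> {0..1}" for t
  proof -
    have 1: "((\<lambda>t. a + (b - a) * t) has_vector_derivative (b - a)) (at t within {0..1})"
      by (auto intro!: derivative_eq_intros simp: has_vector_derivative_def)
    have 2: "(x has_vector_derivative x' (a + (b - a) * t)) (at (a + (b - a) * t) within (\<lambda>t. a + (b - a) * t) ` {0..1})"
      using segD(3)[OF s mem[OF t]] by (rule has_vector_derivative_within_subset) (use mem in auto)
    show ?thesis
      using vector_diff_chain_within[OF 1 2] unfolding y_def y'_def by (simp add: o_def)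
  qed
  moreover have "continuous_on {0..1} y'"
    unfolding y'_def
    by (intro continuous_intros continuous_on_compose2[OF segD(4)[OF s]]) (use mem in auto)
  moreover have "y t \<in> cimg c" if "t \<in> {0..1}" for t unfolding y_def by (rule segD(2)[OF s mem[OF that]])
  ultimately show "seg c y y'" unfolding seg_def using segD(1)[OF s] by blast
  let ?f = "\<lambda>t. mr c (x t) (x' t) (x' t)"
  have "energy (mr c) y y' = integral {0..1} (\<lambda>t. (b - a)\<^sup>2 * ?f (a + (b - a) * t))"
    unfolding energy_def y_def y'_def
    by (rule integral_cong) (simp add: chart_metric.G_bilinear_simps[OF cm segD(2)[OF s mem]] power2_eq_square)
  also have "\<dots> = (b - a) * integral {a..b} ?f"
  proof (cases "a = b")
    case True then show ?thesis by simp
  next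
    case False
    then have lt: "0 < b - a" using ab by simp
    have "(?f has_integral integral {a..b} ?f) (cbox a b)"
      unfolding cbox_interval
      by (intro integrable_integral integrable_continuous_interval continuous_on_subset[OF energy_integrand_continuous[OF s]])
        (use ab in auto)
    from has_integral_affinity[OF this, of "b - a" a]
    have "((\<lambda>t. ?f ((b - a) * t + a)) has_integral (1 / (b - a)) * integral {a..b} ?f) ((\<lambda>t. (1 / (b - a)) * t + - ((1 / (b - a)) * a)) ` {a..b})"
      using lt by (simp add: divide_inverse cbox_interval)
    also have "(\<lambda>t. (1 / (b - a)) * t + - ((1 / (b - a)) * a)) ` {a..b} = {0..1}"
    proof -
      have "(\<lambda>t. (1 / (b - a)) * t + - ((1 / (b - a)) * a)) ` {a..b} = {(1 / (b - a)) * a + - ((1 / (b - a)) * a)..(1 / (b - a)) * b + - ((1 / (b - a)) * a)}"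
        using image_affinity_atLeastAtMost[of "1 / (b - a)" "- ((1 / (b - a)) * a)" a b] lt ab by simp
      also have "\<dots> = {0..1}" using lt by (simp add: field_simps flip: diff_divide_distrib)
      finally show ?thesis .
    qed
    finally have "((\<lambda>t. ?f (a + (b - a) * t)) has_integral (1 / (b - a)) * integral {a..b} ?f) {0..1}"
      by (simp add: add.commute)
    from has_integral_mult_right[OF this, of "(b - a)\<^sup>2"]
    show ?thesis using lt by (simp add: integral_unique power2_eq_square field_simps)
  qed
  finally show "energy (mr c) y y' = (b - a) * integral {a..b} ?f" .
qed

lemma chain_append: "chain n q r U \<Longrightarrow> chain m p q T \<Longrightarrow> chain (m + n) p r (T + U)"
proof (induction rule: chain.induct)
  case (chain_Nil p')
  then show ?case by simp
next
  case (chain_Cons n p' q' T' r' E)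
  from chain.chain_Cons[OF chain_Cons.IH[OF chain_Cons.prems] chain_Cons.hyps(2)]
  show ?case by (simp add: add.assoc)
qed

text \<open>By \<open>seg_restrict\<close> each of the \<open>k\<close> equal parts carries 1/k of
  its share of the integral, so the total drops to \<open>E / k\<close> although the curve as a set
  is unchanged.\<close>

lemma joins_subdivide:
  assumes "joins p q E" "k > 0"
  shows "chain k p q (E / k)"
proof -
  obtain c x x' where s: "seg c x x'" "param c (x 0) = p" "param c (x 1) = q" "energy (mr c) x x' = E"
    using assms(1) unfolding joins_def by blast
  let ?f = "\<lambda>t. mr c (x t) (x' t) (x' t)"
  have "chain j p (param c (x (j / k))) (integral {0..j / k} ?f / k)" if "j \<le> k" for j
    using that
  proof (induction j)
    case 0
    then show ?case using chain_Nil s(2) by simp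
  next
    case (Suc j)
    define a where "a = real j / k"
    define b where "b = real (Suc j) / k"
    have ab: "0 \<le> a" "a \<le> b" "b \<le> 1" "b - a = 1 / k"
      using Suc.prems assms(2) by (auto simp: a_def b_def field_simps)
    have "joins (param c (x a)) (param c (x b)) ((b - a) * integral {a..b} ?f)"
      unfolding joins_def
      using seg_restrict[OF s(1) ab(1-3)] by (intro exI conjI) auto
    from chain_Cons[OF Suc.IH this[unfolded a_def]]
    have "chain (Suc j) p (param c (x b)) (integral {0..a} ?f / k + (b - a) * integral {a..b} ?f)"
      using Suc.prems by (simp add: a_def)
    moreover have "integral {0..a} ?f + integral {a..b} ?f = integral {0..b} ?f"
      using ab by (intro Henstock_Kurzweil_Integration.integral_combine integrable_continuous_interval
          continuous_on_subset[OF energy_integrand_continuous[OF s(1)]]) auto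
    then have "integral {0..a} ?f / k + (b - a) * integral {a..b} ?f = integral {0..b} ?f / k"
      unfolding ab(4) by (simp flip: add_divide_distrib)
    ultimately show ?case unfolding b_def by simp
  qed
  from this[of k] show ?thesis using assms(2) s(3,4) by (simp add: energy_def)
qed

lemma chain_subdivide: "chain m p q T \<Longrightarrow> k > 0 \<Longrightarrow> chain (m * k) p q (T / k)"
proof (induction rule: chain.induct)
  case (chain_Nil p)
  then show ?case using chain.chain_Nil by simp
next
  case (chain_Cons n p q T r E)
  from chain_append[OF joins_subdivide[OF chain_Cons.hyps(2) chain_Cons.prems] chain_Cons.IH[OF chain_Cons.prems]]
  show ?case by (simp add: add.commute add_divide_distrib)
qed

lemma chain_points:
  "chain n p q T \<Longrightarrow> \<exists>P E. P 0 = p \<and> P n = q \<and> (\<forall>i<n. joins (P i) (P (Suc i)) (E i)) \<and> T = (\<Sum>i<n. E i)"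
proof (induction rule: chain.induct)
  case (chain_Nil p)
  show ?case by (rule exI[of _ "\<lambda>_. p"]) auto
next
  case (chain_Cons n p q T r E')
  then obtain P E where "P 0 = p" "P n = q" "\<forall>i<n. joins (P i) (P (Suc i)) (E i)" "T = (\<Sum>i<n. E i)" by blast
  then show ?case
    using chain_Cons.hyps(2) by (intro exI[of _ "P(Suc n := r)"] exI[of _ "E(n := E')"]) (auto simp: less_Suc_eq)
qed

text \<open>Straight lines in a coordinate ball. Both directions are stated because reachability and
  its negation both have to be open conditions.\<close>

lemma joins_near:
  shows "\<exists>O'. open O' \<and> p \<in> O' \<and> (\<forall>q\<in>O'. (\<exists>E. joins p q E) \<and> (\<exists>E. joins q p E))"
proof -
  obtain c where c: "c \<in> A" "p \<in> cdom c" using ex_chart by blast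
  define a where "a = coord c p"
  have "a \<in> cimg c" using c a_def by blast
  then obtain r where r: "r > 0" "ball a r \<subseteq> cimg c"
    using chart_facts(2)[OF c(1)] open_contains_ball by blast
  define O' where "O' = cdom c \<inter> coord c -` ball a r"
  have line: "\<exists>E. joins (param c y) (param c z) E" if "y \<in> ball a r" "z \<in> ball a r" for y z
  proof -
    have "seg c (\<lambda>t. y + t *\<^sub>R (z - y)) (\<lambda>t. z - y)"
      unfolding seg_def
    proof (intro conjI ballI c(1) continuous_on_const)
      fix t :: real assume t: "t \<in> {0..1}"
      have "y + t *\<^sub>R (z - y) = (1 - t) *\<^sub>R y + t *\<^sub>R z" by (simp add: algebra_simps)
      also have "\<dots> \<in> ball a r" using that t convexD_alt[OF convex_ball] by auto
      finally show "y + t *\<^sub>R (z - y) \<in> cimg c" using r(2) by blast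
      show "((\<lambda>t. y + t *\<^sub>R (z - y)) has_vector_derivative z - y) (at t within {0..1})"
        by (auto intro!: derivative_eq_intros simp: has_vector_derivative_def)
    qed
    then show ?thesis unfolding joins_def
      by (intro exI[of _ "energy (mr c) (\<lambda>t. y + t *\<^sub>R (z - y)) (\<lambda>t. z - y)"] exI[of _ c]
          exI[of _ "\<lambda>t. y + t *\<^sub>R (z - y)"] exI[of _ "\<lambda>t. z - y"]) simp
  qed
  have "open O'" unfolding O'_def
    using continuous_open_preimage[OF chart_facts(3,1)[OF c(1)]] by simp
  moreover have pO: "p \<in> O'" using c r a_def O'_def by simp
  moreover have "param c (coord c q) = q" "coord c q \<in> ball a r" if "q \<in> O'" for q
    using that chart_facts(5)[OF c(1)] O'_def by auto
  ultimately show ?thesis using line by (metis (no_types, lifting))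
qed

text \<open>The set of points reachable from \<open>p\<close> is open and closed in a connected
  space.\<close>

lemma ex_chain:
  assumes "connected (UNIV :: 'm set)"
  shows "\<exists>n T. chain n p q T"
proof -
  define R where "R = {q. \<exists>n T. chain n p q T}"
  have "open R"
  proof (rule Topological_Spaces.openI)
    fix q assume "q \<in> R"
    then obtain n T where q: "chain n p q T" by (auto simp: R_def)
    obtain O' where O': "open O'" "q \<in> O'" "\<And>q'. q' \<in> O' \<Longrightarrow> \<exists>E. joins q q' E" using joins_near[of q] by blast
    have "O' \<subseteq> R"
    proof
      fix q' assume "q' \<in> O'"
      then obtain E where "joins q q' E" using O'(3) by blast
      from chain_Cons[OF q this] show "q' \<in> R" by (auto simp: R_def)
    qed
    then show "\<exists>T. open T \<and> q \<in> T \<and> T \<subseteq> R" using O' by blast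
  qed
  moreover have "open (- R)"
  proof (rule Topological_Spaces.openI)
    fix q assume q: "q \<in> - R"
    obtain O' where O': "open O'" "q \<in> O'" "\<And>q'. q' \<in> O' \<Longrightarrow> \<exists>E. joins q' q E" using joins_near[of q] by blast
    have "O' \<subseteq> - R"
    proof
      fix q' assume "q' \<in> O'"
      then obtain E where E: "joins q' q E" using O'(3) by blast
      show "q' \<in> - R"
      proof
        assume "q' \<in> R"
        then obtain n T where "chain n p q' T" by (auto simp: R_def)
        from chain_Cons[OF this E] show False using q by (auto simp: R_def)
      qed
    qed
    then show "\<exists>T. open T \<and> q \<in> T \<and> T \<subseteq> - R" using O' by blast
  qed
  moreover have "p \<in> R" using chain_Nil by (auto simp: R_def)
  ultimately have "R = UNIV"
    using connectedD[OF assms, of R "- R"] by blast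
  then have "q \<in> R" by simp
  then show ?thesis by (simp add: R_def)
qed

text \<open>Cauchy-Schwarz for the velocity together with the lower bound \<open>l\<close> of the
  metric: small energy forces small displacement in the chart.\<close>

lemma seg_displacement:
  assumes s: "seg c x x'" and l: "l > 0" "\<And>t a. t \<in> {0..1} \<Longrightarrow> l * (norm a)\<^sup>2 \<le> mr c (x t) a a"
  shows "l * (norm (x 1 - x 0))\<^sup>2 \<le> energy (mr c) x x'"
proof -
  note c' = segD(4)[OF s]
  have "(x' has_integral (x 1 - x 0)) {0..1}"
    by (rule fundamental_theorem_of_calculus[OF _ segD(3)[OF s]]) simp_all
  then have "norm (x 1 - x 0) = norm (integral {0..1} x')" by (simp add: integral_unique)
  also have "\<dots> \<le> integral {0..1} (\<lambda>t. norm (x' t))"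
    by (intro Henstock_Kurzweil_Integration.integral_norm_bound_integral integrable_continuous_interval continuous_intros c') simp
  finally have "(norm (x 1 - x 0))\<^sup>2 \<le> (integral {0..1} (\<lambda>t. norm (x' t)))\<^sup>2" by (simp add: power_mono)
  also have "\<dots> \<le> integral {0..1} (\<lambda>t. (norm (x' t))\<^sup>2)"
    by (intro integral_square_le continuous_intros c')
  finally have "l * (norm (x 1 - x 0))\<^sup>2 \<le> l * integral {0..1} (\<lambda>t. (norm (x' t))\<^sup>2)" using l(1) by simp
  also have "\<dots> = integral {0..1} (\<lambda>t. l * (norm (x' t))\<^sup>2)" by simp
  also have "\<dots> \<le> energy (mr c) x x'"
    unfolding energy_def
    by (intro integral_le integrable_continuous_interval continuous_intros c' energy_integrand_continuous[OF s] l(2))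
  finally show ?thesis .
qed

text \<open>Consider the first time at which the curve leaves the chart.\<close>

lemma short_seg_stays:
  assumes c: "c \<in> A" and K: "cball x0 (2 * R) \<subseteq> cimg c" "R > 0" "0 < \<delta>" "\<delta> \<le> R"
  shows "\<exists>\<eta>>0. \<forall>d y y'. seg d y y' \<longrightarrow> param d (y 0) \<in> param c ` ball x0 R \<longrightarrow> energy (mr d) y y' < \<eta> \<longrightarrow>
    (\<forall>t\<in>{0..1}. param d (y t) \<in> cdom c \<and> norm (coord c (param d (y t)) - coord c (param d (y 0))) \<le> \<delta>)"
proof -
  obtain l where l: "l > 0" "\<And>x a. x \<in> cball x0 (2 * R) \<Longrightarrow> l * (norm a)\<^sup>2 \<le> mr c x a a"
    using chart_metric.ex_lower_bound[OF chart_metric_mr[OF c] compact_cball K(1)] by blast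
  have "param d (y t) \<in> cdom c \<and> norm (coord c (param d (y t)) - coord c (param d (y 0))) \<le> \<delta>"
    if s: "seg d y y'" and start: "param d (y 0) \<in> param c ` ball x0 R" and small: "energy (mr d) y y' < l * \<delta>\<^sup>2"
      and t: "t \<in> {0..1}" for d y y' t
  proof -
    define \<sigma> where "\<sigma> t = param d (y t)" for t
    define z0 where "z0 = coord c (\<sigma> 0)"
    \<comment> \<open>The displacement bound that the energy allows; the threshold
      \<open>l * \<delta>\<^sup>2\<close> makes it strictly smaller than \<delta>.\<close>
    define \<rho> where "\<rho> = sqrt (energy (mr d) y y' / l)"
    have "energy (mr d) y y' / l < \<delta>\<^sup>2" using small l(1) by (simp add: field_simps)
    then have \<rho>: "\<rho> < \<delta>" "\<rho> \<ge> 0" using K(3) energy_nonneg[OF s] l(1)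
      by (auto simp: \<rho>_def intro!: real_less_lsqrt)
    obtain b where b: "b \<in> ball x0 R" "\<sigma> 0 = param c b" using start by (auto simp: \<sigma>_def)
    have "ball x0 R \<subseteq> cball x0 (2 * R)" using K(2) by auto
    then have bc: "b \<in> cimg c" using b(1) K(1) by blast
    have z0b: "z0 = b" using chart_facts(6)[OF c bc] b(2) z0_def by simp
    have sub: "cball z0 \<delta> \<subseteq> cball x0 (2 * R)"
    proof
      fix w assume "w \<in> cball z0 \<delta>"
      then show "w \<in> cball x0 (2 * R)" using b(1) z0b K(4) dist_triangle[of x0 w z0] by auto
    qed
    have sub': "cball z0 \<delta> \<subseteq> cimg c" using sub K(1) by blast
    define U where "U = param c ` ball z0 \<delta>"
    have U_eq: "U = cdom c \<inter> coord c -` ball z0 \<delta>"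
    proof -
      have "ball z0 \<delta> \<subseteq> cimg c" using sub' by force
      then show ?thesis unfolding U_def using chart_facts(5,6,7)[OF c] by force
    qed
    have openU: "open U" unfolding U_eq
      using continuous_open_preimage[OF chart_facts(3,1)[OF c]] by simp
    have cont: "continuous_on {0..1} \<sigma>"
      unfolding \<sigma>_def by (rule continuous_on_compose2[OF chart_facts(4)[OF segD(1)[OF s]] segD(5,6)[OF s]])
    \<comment> \<open>As long as the curve has stayed in the open set \<open>U\<close> over the ball
      of radius \<delta>, it lies already over the closed ball of the smaller radius \<rho>.\<close>
    have in_small: "\<sigma> t \<in> param c ` cball z0 \<rho>" if t: "t \<in> {0..1}" and inU: "\<And>u. 0 \<le> u \<Longrightarrow> u \<le> t \<Longrightarrow> \<sigma> u \<in> U" for t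
    proof -
      have t01: "0 \<le> (0::real)" "0 \<le> t" "t \<le> 1" using t by auto
      note r = seg_restrict[OF s t01]
      define w where "w = (\<lambda>u. y (0 + (t - 0) * u))"
      define w' where "w' = (\<lambda>u. (t - 0) *\<^sub>R y' (0 + (t - 0) * u))"
      have w: "seg d w w'" "energy (mr d) w w' = (t - 0) * integral {0..t} (\<lambda>t. mr d (y t) (y' t) (y' t))"
        using r unfolding w_def w'_def by auto
      have "energy (mr d) w w' \<le> energy (mr d) y y'"
      proof -
        let ?f = "\<lambda>t. mr d (y t) (y' t) (y' t)"
        have f0: "?f u \<ge> 0" if "u \<in> {0..1}" for u
          by (rule chart_metric.G_nonneg[OF chart_metric_mr[OF segD(1)[OF s]] segD(2)[OF s that]])
        have int: "?f integrable_on {0..u}" if "u \<le> 1" for u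
          by (intro integrable_continuous_interval continuous_on_subset[OF energy_integrand_continuous[OF s]]) (use that in auto)
        have "integral {0..t} ?f \<ge> 0" using f0 t by (intro integral_nonneg int) auto
        then have "(t - 0) * integral {0..t} ?f \<le> 1 * integral {0..t} ?f" using t by (intro mult_right_mono) auto
        also have "\<dots> \<le> integral {0..1} ?f"
          using integral_subset_le[of "{0..t}" "{0..1}" ?f] int f0 t by simp
        finally show ?thesis unfolding w(2) by (simp add: energy_def)
      qed
      have wU: "param d (w u) \<in> U" if "u \<in> {0..1}" for u
      proof -
        have "0 \<le> t * u" "t * u \<le> t * 1" using that t mult_left_mono[of u 1 t] by auto
        then show ?thesis using inU[of "t * u"] unfolding w_def \<sigma>_def by simp
      qed
      have wc: "\<And>u. u \<in> {0..1} \<Longrightarrow> param d (w u) \<in> cdom c" using wU U_eq by blast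
      define v where "v = (\<lambda>u. transition d c (w u))"
      define v' where "v' = (\<lambda>u. dB (transition d c) (w u) (w' u))"
      have v: "seg c v v'" "energy (mr c) v v' = energy (mr d) w w'" "\<And>u. u \<in> {0..1} \<Longrightarrow> v u = coord c (param d (w u))"
        using seg_transfer[OF w(1) c wc] unfolding v_def v'_def by auto
      have vK: "v u \<in> cball x0 (2 * R)" if "u \<in> {0..1}" for u
      proof -
        have "v u \<in> cball z0 \<delta>" using v(3)[OF that] wU[OF that] U_eq by auto
        then show ?thesis using sub by blast
      qed
      have "l * (norm (v 1 - v 0))\<^sup>2 \<le> energy (mr c) v v'"
        by (rule seg_displacement[OF v(1) l(1)]) (rule l(2)[OF vK])
      also have "\<dots> \<le> energy (mr d) y y'" using v(2) \<open>energy (mr d) w w' \<le> energy (mr d) y y'\<close> by simp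
      finally have "(norm (v 1 - v 0))\<^sup>2 \<le> energy (mr d) y y' / l" using l(1) by (simp add: field_simps)
      then have "norm (v 1 - v 0) \<le> \<rho>" unfolding \<rho>_def by (rule real_le_rsqrt)
      moreover have "v 0 = z0" "v 1 = coord c (\<sigma> t)"
        using v(3)[of 0] v(3)[of 1] by (auto simp: w_def z0_def \<sigma>_def)
      ultimately have "coord c (\<sigma> t) \<in> cball z0 \<rho>" by (simp add: dist_norm norm_minus_commute)
      moreover have "param c (coord c (\<sigma> t)) = \<sigma> t"
        using chart_facts(5)[OF c] inU[of t] t U_eq by auto
      ultimately show ?thesis by (metis imageI)
    qed
    have \<rho>sub: "param c ` cball z0 \<rho> \<subseteq> U" unfolding U_def using \<rho>(1) by (intro image_mono) auto
    have closedK: "closed (param c ` cball z0 \<rho>)"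
    proof -
      have "cball z0 \<rho> \<subseteq> cimg c" using sub' \<rho>(1) by force
      then have "compact (param c ` cball z0 \<rho>)"
        by (intro compact_continuous_image continuous_on_subset[OF chart_facts(4)[OF c]]) auto
      then show ?thesis by (rule compact_imp_closed)
    qed
    have all: "\<sigma> t \<in> U" if "t \<in> {0..1}" for t
    proof (rule ccontr)
      assume notU: "\<sigma> t \<notin> U"
      define B where "B = {0..1} \<inter> \<sigma> -` (- U)"
      have "closed B" unfolding B_def
        by (rule continuous_closed_preimage[OF cont]) (use openU in auto)
      moreover have "bounded B" unfolding B_def by (rule bounded_subset[OF bounded_closed_interval[of 0 1]]) blast
      ultimately have "compact B" by (simp add: compact_eq_bounded_closed)
      moreover have "B \<noteq> {}" using that notU B_def by blast
      ultimately have "\<exists>s\<in>B. \<forall>u\<in>B. s \<le> u" by (rule compact_attains_inf)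
      then obtain \<tau> where \<tau>: "\<tau> \<in> B" "\<And>u. u \<in> B \<Longrightarrow> \<tau> \<le> u" by blast
      have \<tau>01: "\<tau> \<in> {0..1}" "\<sigma> \<tau> \<notin> U" using \<tau>(1) B_def by auto
      have before: "\<sigma> u \<in> U" if "0 \<le> u" "u < \<tau>" for u
        using \<tau>(2)[of u] that \<tau>01 unfolding B_def by force
      have "\<sigma> 0 \<in> U" unfolding U_def using b(2) z0b K(3) by simp
      then have "\<tau> > 0" using \<tau>01 by (cases "\<tau> = 0") auto
      \<comment> \<open>The closed set \<open>Q\<close> contains all times before the first exit
        \<tau>, hence \<tau> itself, which puts the exit point back into \<open>U\<close>.\<close>
      define Q where "Q = {0..1} \<inter> \<sigma> -` (param c ` cball z0 \<rho>)"
      have "closed Q" unfolding Q_def by (rule continuous_closed_preimage[OF cont _ closedK]) auto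
      moreover have "{0..<\<tau>} \<subseteq> Q"
      proof
        fix u assume u: "u \<in> {0..<\<tau>}"
        have "\<sigma> u \<in> param c ` cball z0 \<rho>"
          by (rule in_small) (use u \<tau>01 before in auto)
        then show "u \<in> Q" unfolding Q_def using u \<tau>01 by auto
      qed
      ultimately have "closure {0..<\<tau>} \<subseteq> Q" by (rule closure_minimal[rotated])
      then have "\<tau> \<in> Q" using \<open>\<tau> > 0\<close> by auto
      then show False using \<tau>01(2) \<rho>sub unfolding Q_def by blast
    qed
    have "\<sigma> t \<in> U" by (rule all[OF t])
    then show ?thesis unfolding U_eq z0_def \<sigma>_def by (auto simp: dist_norm norm_minus_commute)
  qed
  then show ?thesis using l(1) K(3) by (intro exI[of _ "l * \<delta>\<^sup>2"]) auto
qed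

section \<open>Limits of short curves are realised by geodesics\<close>

definition geodesic_piece :: "('m, 'e) chart \<Rightarrow> (real \<Rightarrow> 'e) \<Rightarrow> (real \<Rightarrow> 'e) \<Rightarrow> bool" where
  "geodesic_piece c x x' \<longleftrightarrow> c \<in> A \<and> geodesic (cimg c) (mr c) x x' \<and> transportable (mr c) x x'"

text \<open>Lower semicontinuity of the energy together with a geodesic between the limit points.
  The energies \<open>E n\<close> need not converge, so the bound is required eventually and up to
  every \<epsilon>. The threshold \<eta> is a separate parameter so that compactness can make it
  uniform.\<close>

definition geodesic_limits :: "'m \<Rightarrow> real \<Rightarrow> bool" where
  "geodesic_limits q \<eta> \<longleftrightarrow> (\<forall>r Q S E. Q \<longlonglongrightarrow> q \<longrightarrow> S \<longlonglongrightarrow> r \<longrightarrow> (\<forall>n. joins (Q n) (S n) (E n) \<and> E n < \<eta>) \<longrightarrow>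
    (\<exists>c x x'. geodesic_piece c x x' \<and> param c (x 0) = q \<and> param c (x 1) = r \<and>
       (\<forall>\<epsilon>>0. eventually (\<lambda>n. energy (mr c) x x' \<le> E n + \<epsilon>) sequentially)))"

lemma geodesic_limits_mono:
  "geodesic_limits q \<eta> \<Longrightarrow> \<eta>' \<le> \<eta> \<Longrightarrow> geodesic_limits q \<eta>'"
  unfolding geodesic_limits_def by (meson order_less_le_trans)

text \<open>Short curves starting near \<open>p\<close> stay in one chart, where the limit points
  are joined by a short geodesic. Its energy is compared with that of the \<open>n\<close>-th curve;
  the error \<open>u n\<close> involves only the distances between the ends and tends to 0.\<close>

lemma geodesic_limits_local: "\<exists>W \<eta>. open W \<and> p \<in> W \<and> \<eta> > 0 \<and> (\<forall>q\<in>W. geodesic_limits q \<eta>)"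
proof -
  obtain c where c: "c \<in> A" "p \<in> cdom c" using ex_chart by blast
  define x0 where "x0 = coord c p"
  have "x0 \<in> cimg c" using c x0_def by blast
  then obtain R0 where R0: "R0 > 0" "cball x0 R0 \<subseteq> cimg c"
    using chart_facts(2)[OF c(1)] open_contains_cball by blast
  \<comment> \<open>Starting points lie within \<open>R\<close> and the curves within
    \<open>2 * R\<close>; the geodesics and all estimates use the ball of radius
    \<open>4 * R\<close>.\<close>
  define R where "R = R0 / 4"
  have R: "R > 0" "cball x0 (4 * R) \<subseteq> cimg c" "4 * R > 0" using R0 by (auto simp: R_def)
  note cm = chart_metric_mr[OF c(1)]
  obtain e C where e: "e > 0" "C > 0" and minimal: "\<And>x x' y y'. geodesic (cimg c) (mr c) x x' \<Longrightarrow>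
      (\<forall>t\<in>{0..1}. x t \<in> cball x0 (4 * R) \<and> norm (x' t) \<le> e) \<Longrightarrow>
      (\<forall>t\<in>{0..1}. y t \<in> cball x0 (4 * R) \<and> (y has_vector_derivative y' t) (at t within {0..1})) \<Longrightarrow> continuous_on {0..1} y' \<Longrightarrow>
      energy (mr c) x x' \<le> energy (mr c) y y' + C * (norm (y 0 - x 0) + norm (y 1 - x 1) + (norm (y 0 - x 0))\<^sup>2)"
    using chart_metric.geodesic_almost_minimal[OF cm R(2)] by metis
  obtain \<delta>0 where \<delta>0: "\<delta>0 > 0" and short: "\<And>a b. a \<in> cball x0 (4 * R / 2) \<Longrightarrow> norm (b - a) \<le> \<delta>0 \<Longrightarrow>
      (\<exists>x x'. geodesic (cimg c) (mr c) x x' \<and> x 0 = a \<and> x 1 = b \<and> transportable (mr c) x x' \<and>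
       (\<forall>t\<in>{0..1}. x t \<in> cball x0 (4 * R) \<and> norm (x' t) \<le> e))"
    using chart_metric.ex_short_geodesic[OF cm R(3,2) e(1)] by metis
  define \<delta> where "\<delta> = min \<delta>0 R"
  have \<delta>: "0 < \<delta>" "\<delta> \<le> R" "\<delta> \<le> \<delta>0" using \<delta>0 R by (auto simp: \<delta>_def)
  have sub2: "cball x0 (2 * R) \<subseteq> cball x0 (4 * R)" using R(1) by auto
  have K2: "cball x0 (2 * R) \<subseteq> cimg c" using sub2 R(2) by blast
  obtain \<eta> where \<eta>: "\<eta> > 0" and stays: "\<And>d y y' t. seg d y y' \<Longrightarrow> param d (y 0) \<in> param c ` ball x0 R \<Longrightarrow> energy (mr d) y y' < \<eta> \<Longrightarrow>
      t \<in> {0..1} \<Longrightarrow> param d (y t) \<in> cdom c \<and> norm (coord c (param d (y t)) - coord c (param d (y 0))) \<le> \<delta>"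
    using short_seg_stays[OF c(1) K2 R(1) \<delta>(1,2)] by metis
  define W where "W = cdom c \<inter> coord c -` ball x0 R"
  have openW: "open W" unfolding W_def
    using continuous_open_preimage[OF chart_facts(3,1)[OF c(1)]] by simp
  have pW: "p \<in> W" using c R(1) by (simp add: W_def x0_def)
  have W_im: "q \<in> param c ` ball x0 R" if "q \<in> W" for q
    using that chart_facts(5)[OF c(1), of q] unfolding W_def by (metis IntE imageI vimageD)
  have "\<exists>c x x'. geodesic_piece c x x' \<and> param c (x 0) = q \<and> param c (x 1) = r \<and>
       (\<forall>\<epsilon>>0. eventually (\<lambda>n. energy (mr c) x x' \<le> E n + \<epsilon>) sequentially)"
    if q: "q \<in> W" and Q: "Q \<longlonglongrightarrow> q" and S: "S \<longlonglongrightarrow> r" and E: "\<And>n. joins (Q n) (S n) (E n) \<and> E n < \<eta>" for q r Q S E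
  proof -
    have evQ: "eventually (\<lambda>n. Q n \<in> W) sequentially" using topological_tendstoD[OF Q openW q] .
    have curve: "\<exists>y y'. seg c y y' \<and> y 0 = coord c (Q n) \<and> y 1 = coord c (S n) \<and> S n \<in> cdom c \<and> energy (mr c) y y' = E n \<and>
        (\<forall>t\<in>{0..1}. y t \<in> cball x0 (2 * R)) \<and> norm (coord c (S n) - coord c (Q n)) \<le> \<delta>"
      if QW: "Q n \<in> W" for n
    proof -
      obtain d y y' where y: "seg d y y'" "param d (y 0) = Q n" "param d (y 1) = S n" "energy (mr d) y y' = E n"
        using E[of n] unfolding joins_def by blast
      have st: "param d (y t) \<in> cdom c \<and> norm (coord c (param d (y t)) - coord c (Q n)) \<le> \<delta>" if "t \<in> {0..1}" for t
        using stays[OF y(1) _ _ that] W_im[OF QW] y(2,4) E[of n] by simp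
      define v where "v = (\<lambda>t. transition d c (y t))"
      define v' where "v' = (\<lambda>t. dB (transition d c) (y t) (y' t))"
      have v: "seg c v v'" "energy (mr c) v v' = energy (mr d) y y'" "\<And>u. u \<in> {0..1} \<Longrightarrow> v u = coord c (param d (y u))"
        using seg_transfer[OF y(1) c(1)] st unfolding v_def v'_def by auto
      have "v t \<in> cball x0 (2 * R)" if "t \<in> {0..1}" for t
      proof -
        have "dist (coord c (Q n)) (v t) \<le> R" using st[OF that] v(3)[OF that] \<delta>(2) by (simp add: dist_norm norm_minus_commute)
        moreover have "dist x0 (coord c (Q n)) < R" using QW by (simp add: W_def)
        ultimately show ?thesis using dist_triangle[of x0 "v t" "coord c (Q n)"] by simp
      qed
      then show ?thesis
        using v(1,2) v(3)[of 0] v(3)[of 1] y st[of 1] by (intro exI[of _ v] exI[of _ v']) auto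
    qed
    define a where "a = coord c q"
    have qc: "q \<in> cdom c" "a \<in> ball x0 R" using q by (auto simp: W_def a_def)
    have isC: "isCont (coord c) z" if "z \<in> cdom c" for z
      using chart_facts(3,1)[OF c(1)] that continuous_on_eq_continuous_at by blast
    have Qa: "(\<lambda>n. coord c (Q n)) \<longlonglongrightarrow> a" unfolding a_def by (rule isCont_tendsto_compose[OF isC[OF qc(1)] Q])
    \<comment> \<open>The limit of the end points cannot leave the chart, because the image of the
      closed coordinate ball is compact and hence closed.\<close>
    have rK: "r \<in> param c ` cball x0 (2 * R)"
    proof (rule Lim_in_closed_set[OF _ _ _ S])
      have "compact (param c ` cball x0 (2 * R))"
        by (intro compact_continuous_image continuous_on_subset[OF chart_facts(4)[OF c(1)] K2]) auto
      then show "closed (param c ` cball x0 (2 * R))" by (rule compact_imp_closed)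
      show "eventually (\<lambda>n. S n \<in> param c ` cball x0 (2 * R)) sequentially"
        using evQ
      proof eventually_elim
        fix n assume "Q n \<in> W"
        from curve[OF this] obtain y :: "real \<Rightarrow> 'e" where y: "y 1 = coord c (S n)" "S n \<in> cdom c" "\<forall>t\<in>{0..1}. y t \<in> cball x0 (2 * R)" by blast
        have "coord c (S n) \<in> cball x0 (2 * R)" using y(1) y(3)[rule_format, of 1] by simp
        then show "S n \<in> param c ` cball x0 (2 * R)" using chart_facts(5)[OF c(1) y(2)] by (metis imageI)
      qed
    qed simp
    then have rc: "r \<in> cdom c" using K2 chart_facts(7)[OF c(1)] by blast
    define b where "b = coord c r"
    have Sb: "(\<lambda>n. coord c (S n)) \<longlonglongrightarrow> b" unfolding b_def by (rule isCont_tendsto_compose[OF isC[OF rc] S])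
    obtain N where N: "\<And>n. n \<ge> N \<Longrightarrow> Q n \<in> W" using evQ unfolding eventually_sequentially by blast
    have "norm (b - a) \<le> \<delta>"
    proof (rule Lim_bounded[of "\<lambda>n. norm (coord c (S n) - coord c (Q n))"])
      show "(\<lambda>n. norm (coord c (S n) - coord c (Q n))) \<longlonglongrightarrow> norm (b - a)" by (intro tendsto_intros Sb Qa)
      show "\<forall>n\<ge>N. norm (coord c (S n) - coord c (Q n)) \<le> \<delta>" using curve N by blast
    qed
    moreover have "a \<in> cball x0 (4 * R / 2)" using qc(2) R(1) by auto
    ultimately obtain x x' where x: "geodesic (cimg c) (mr c) x x'" "x 0 = a" "x 1 = b" "transportable (mr c) x x'"
       "\<forall>t\<in>{0..1}. x t \<in> cball x0 (4 * R) \<and> norm (x' t) \<le> e"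
      using short[of a b] \<delta>(3) by fastforce
    define u where "u n = C * (norm (coord c (Q n) - a) + norm (coord c (S n) - b) + (norm (coord c (Q n) - a))\<^sup>2)" for n
    have "u \<longlonglongrightarrow> C * (norm (a - a) + norm (b - b) + (norm (a - a))\<^sup>2)"
      unfolding u_def by (intro tendsto_intros Qa Sb)
    then have u0: "u \<longlonglongrightarrow> 0" by simp
    have le: "energy (mr c) x x' \<le> E n + u n" if QW: "Q n \<in> W" for n
    proof -
      obtain y y' where y: "seg c y y'" "y 0 = coord c (Q n)" "y 1 = coord c (S n)" "energy (mr c) y y' = E n"
        "\<forall>t\<in>{0..1}. y t \<in> cball x0 (2 * R)" using curve[OF QW] by blast
      have "\<forall>t\<in>{0..1}. y t \<in> cball x0 (4 * R) \<and> (y has_vector_derivative y' t) (at t within {0..1})"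
        using y(5) sub2 segD(3)[OF y(1)] by blast
      from minimal[OF x(1,5) this segD(4)[OF y(1)]] show ?thesis
        unfolding u_def using y x by simp
    qed
    have "eventually (\<lambda>n. energy (mr c) x x' \<le> E n + \<epsilon>) sequentially" if "\<epsilon> > 0" for \<epsilon>
      using evQ order_tendstoD(2)[OF u0 that] by eventually_elim (use le in fastforce)
    moreover have "geodesic_piece c x x'" unfolding geodesic_piece_def using c x by blast
    moreover have "param c (x 0) = q" "param c (x 1) = r"
      using x(2,3) chart_facts(5)[OF c(1)] qc(1) rc by (auto simp: a_def b_def)
    ultimately show ?thesis by blast
  qed
  then have "geodesic_limits q \<eta>" if "q \<in> W" for q
    using that unfolding geodesic_limits_def by simp
  then show ?thesis using openW pW \<eta> by blast
qed

text \<open>A finite subcover allows the minimum of the local thresholds to be taken.\<close>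

lemma ex_geodesic_limits:
  assumes "compact (UNIV :: 'm set)"
  shows "\<exists>\<eta>>0. \<forall>q. geodesic_limits q \<eta>"
proof -
  have 1: "\<forall>p. \<exists>W \<eta>. open W \<and> p \<in> W \<and> \<eta> > 0 \<and> (\<forall>q\<in>W. geodesic_limits q \<eta>)"
    by (rule allI, rule geodesic_limits_local)
  from choice[OF 1] obtain W where
    2: "\<forall>p. \<exists>\<eta>. open (W p) \<and> p \<in> W p \<and> \<eta> > 0 \<and> (\<forall>q\<in>W p. geodesic_limits q \<eta>)" ..
  from choice[OF 2] obtain \<eta> where
    3: "\<forall>p. open (W p) \<and> p \<in> W p \<and> \<eta> p > 0 \<and> (\<forall>q\<in>W p. geodesic_limits q (\<eta> p))" ..
  have W: "\<And>p. open (W p)" "\<And>p. p \<in> W p" "\<And>p. \<eta> p > 0"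
    and lim: "\<And>p q. q \<in> W p \<Longrightarrow> geodesic_limits q (\<eta> p)"
    using 3 by blast+
  have "UNIV \<subseteq> (\<Union>p\<in>UNIV. W p)" using W(2) by auto
  then obtain F where F: "finite F" "UNIV \<subseteq> (\<Union>p\<in>F. W p)"
    by (rule compactE_image[OF assms W(1)])
  define m where "m = Min (insert 1 (\<eta> ` F))"
  have m: "m > 0" "\<And>p. p \<in> F \<Longrightarrow> m \<le> \<eta> p" using F(1) W(3) by (auto simp: m_def)
  have "geodesic_limits q m" for q
  proof -
    obtain p where p: "p \<in> F" "q \<in> W p" using F(2) by blast
    show ?thesis by (rule geodesic_limits_mono[OF lim[OF p(2)] m(2)[OF p(1)]])
  qed
  then show ?thesis using m(1) by blast
qed

text \<open>Subdividing makes the energies of all pieces of an almost minimal chain small, so that they can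
  be replaced by short geodesics in the limit.\<close>

lemma ex_minimal_chain:
  assumes comp: "compact (UNIV :: 'm set)" and conn: "connected (UNIV :: 'm set)"
    and N1: "compact N1" "N1 \<noteq> {}" and N2: "compact N2" "N2 \<noteq> {}"
  shows "\<exists>m P c x x'. P 0 \<in> N1 \<and> P m \<in> N2 \<and>
     (\<forall>i<m. geodesic_piece (c i) (x i) (x' i) \<and> param (c i) (x i 0) = P i \<and> param (c i) (x i 1) = P (Suc i)) \<and>
     (\<forall>P' E'. P' 0 \<in> N1 \<longrightarrow> P' m \<in> N2 \<longrightarrow> (\<forall>i<m. joins (P' i) (P' (Suc i)) (E' i)) \<longrightarrow>
        (\<Sum>i<m. energy (mr (c i)) (x i) (x' i)) \<le> (\<Sum>i<m. E' i))"
proof -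
  obtain \<eta> where \<eta>: "\<eta> > 0" and lim: "\<And>q. geodesic_limits q \<eta>"
    using ex_geodesic_limits[OF comp] by blast
  obtain p q where pq: "p \<in> N1" "q \<in> N2" using N1 N2 by blast
  obtain m0 T0 where T0: "chain m0 p q T0" using ex_chain[OF conn] by blast
  \<comment> \<open>Subdividing an arbitrary chain brings its total energy below \<eta>. This fixes
    the number of pieces, so only finitely many joints need convergent subsequences.\<close>
  obtain k :: nat where k: "k > 0" "T0 / k < \<eta>"
  proof -
    obtain k :: nat where "T0 / \<eta> < k" using reals_Archimedean2 by blast
    then have "T0 / real (Suc k) < \<eta>" using \<eta> by (simp add: field_simps)
    then show ?thesis using that[of "Suc k"] by simp
  qed
  define m where "m = m0 * k"
  define admissible where "admissible P E \<longleftrightarrow> P 0 \<in> N1 \<and> P m \<in> N2 \<and> (\<forall>i<m. joins (P i) (P (Suc i)) (E i))" for P E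
  define V where "V = {(\<Sum>i<m. E i) |P E. admissible P E}"
  obtain P0 E0 where "P0 0 = p" "P0 m = q" "\<forall>i<m. joins (P0 i) (P0 (Suc i)) (E0 i)" "T0 / k = (\<Sum>i<m. E0 i)"
    using chain_points[OF chain_subdivide[OF T0 k(1)]] m_def by blast
  then have "T0 / k \<in> V" unfolding V_def admissible_def using pq by blast
  have E_nonneg: "E i \<ge> 0" if "admissible P E" "i < m" for P E i
    using that joins_nonneg unfolding admissible_def by blast
  have bdd: "bdd_below V"
    unfolding V_def by (rule bdd_belowI[of _ 0]) (auto intro!: sum_nonneg E_nonneg)
  define I where "I = Inf V"
  have "I < \<eta>" using cInf_lower[OF \<open>T0 / k \<in> V\<close> bdd] k(2) by (simp add: I_def)
  \<comment> \<open>The second entry of the minimum keeps the total, and hence every single piece,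
    below \<eta>.\<close>
  have ex: "\<exists>P E. admissible P E \<and> (\<Sum>i<m. E i) < I + min (1 / Suc n) (\<eta> - I)" for n
  proof -
    have "Inf V < I + min (1 / Suc n) (\<eta> - I)" using \<open>I < \<eta>\<close> by (simp add: I_def)
    then obtain T where T: "T \<in> V" "T < I + min (1 / Suc n) (\<eta> - I)"
      using cInf_less_iff[OF _ bdd] \<open>T0 / k \<in> V\<close> by (metis empty_iff)
    obtain P E where "admissible P E" "T = (\<Sum>i<m. E i)" using T(1) unfolding V_def by blast
    then show ?thesis using T(2) by (intro exI[of _ P] exI[of _ E]) auto
  qed
  then obtain P E where PE: "\<And>n. admissible (P n) (E n)" "\<And>n. (\<Sum>i<m. E n i) < I + min (1 / Suc n) (\<eta> - I)"
    by metis
  have E_small: "E n i < \<eta>" if "i < m" for n i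
  proof -
    have "E n i \<le> (\<Sum>i<m. E n i)" using that E_nonneg[OF PE(1)] by (intro member_le_sum) auto
    also have "\<dots> < \<eta>" using PE(2)[of n] by simp
    finally show ?thesis .
  qed
  obtain r L where r: "strict_mono r" "\<And>i. i < Suc m \<Longrightarrow> (\<lambda>n. P (r n) i) \<longlonglongrightarrow> L i"
    using finitely_many_convergent_subsequences[OF comp, of "Suc m" P] by blast
  have piece: "\<exists>c x x'. geodesic_piece c x x' \<and> param c (x 0) = L i \<and> param c (x 1) = L (Suc i) \<and>
       (\<forall>\<epsilon>>0. eventually (\<lambda>n. energy (mr c) x x' \<le> E (r n) i + \<epsilon>) sequentially)" if "i < m" for i
    by (rule lim[unfolded geodesic_limits_def, rule_format, OF r(2) r(2)])
      (use that PE(1) E_small in \<open>auto simp: admissible_def\<close>)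
  define good where "good i c x x' \<longleftrightarrow> geodesic_piece c x x' \<and> param c (x 0) = L i \<and> param c (x 1) = L (Suc i) \<and>
       (\<forall>\<epsilon>>0. eventually (\<lambda>n. energy (mr c) x x' \<le> E (r n) i + \<epsilon>) sequentially)" for i c x x'
  have "\<forall>i. \<exists>z. i < m \<longrightarrow> good i (fst z) (fst (snd z)) (snd (snd z))"
    using piece unfolding good_def by (metis fst_conv snd_conv)
  then obtain z where z: "\<And>i. i < m \<Longrightarrow> good i (fst (z i)) (fst (snd (z i))) (snd (snd (z i)))" by metis
  define c where "c i = fst (z i)" for i
  define x where "x i = fst (snd (z i))" for i
  define x' where "x' i = snd (snd (z i))" for i
  have gd: "geodesic_piece (c i) (x i) (x' i)" "param (c i) (x i 0) = L i" "param (c i) (x i 1) = L (Suc i)"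
    "\<And>\<epsilon>. \<epsilon> > 0 \<Longrightarrow> eventually (\<lambda>n. energy (mr (c i)) (x i) (x' i) \<le> E (r n) i + \<epsilon>) sequentially" if "i < m" for i
    using z[OF that] unfolding good_def c_def x_def x'_def by auto
  have "L 0 \<in> N1"
    by (rule Lim_in_closed_set[OF compact_imp_closed[OF N1(1)] _ _ r(2)])
      (use PE(1) in \<open>auto simp: admissible_def\<close>)
  moreover have "L m \<in> N2"
    by (rule Lim_in_closed_set[OF compact_imp_closed[OF N2(1)] _ _ r(2)])
      (use PE(1) in \<open>auto simp: admissible_def\<close>)
  moreover have "(\<Sum>i<m. energy (mr (c i)) (x i) (x' i)) \<le> I"
  proof (rule field_le_epsilon)
    fix \<epsilon> :: real assume \<epsilon>: "\<epsilon> > 0"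
    \<comment> \<open>One share for each of the \<open>m\<close> pieces and one for the distance of
      the approximating chain from the infimum.\<close>
    define \<epsilon>' where "\<epsilon>' = \<epsilon> / (m + 1)"
    have \<epsilon>': "\<epsilon>' > 0" "(m + 1) * \<epsilon>' = \<epsilon>" using \<epsilon> by (auto simp: \<epsilon>'_def)
    have 1: "eventually (\<lambda>n. \<forall>i\<in>{..<m}. energy (mr (c i)) (x i) (x' i) \<le> E (r n) i + \<epsilon>') sequentially"
      by (rule eventually_ball_finite) (use gd(4) \<epsilon>'(1) in auto)
    have "(\<lambda>n. 1 / real (Suc n)) \<longlonglongrightarrow> 0" by (rule LIMSEQ_inverse_real_of_nat[unfolded inverse_eq_divide])
    from order_tendstoD(2)[OF this \<epsilon>'(1)] have 2: "eventually (\<lambda>n. 1 / real (Suc n) < \<epsilon>') sequentially" .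
    obtain n where n: "\<forall>i\<in>{..<m}. energy (mr (c i)) (x i) (x' i) \<le> E (r n) i + \<epsilon>'" "1 / real (Suc n) < \<epsilon>'"
      using eventually_happens'[OF _ eventually_conj[OF 1 2]] by auto
    have "(\<Sum>i<m. energy (mr (c i)) (x i) (x' i)) \<le> (\<Sum>i<m. E (r n) i + \<epsilon>')" by (rule sum_mono) (use n(1) in blast)
    also have "\<dots> = (\<Sum>i<m. E (r n) i) + m * \<epsilon>'" by (simp add: sum.distrib)
    also have "(\<Sum>i<m. E (r n) i) \<le> I + 1 / Suc (r n)" using PE(2)[of "r n"] by simp
    also have "1 / Suc (r n) \<le> 1 / Suc n"
      using seq_suble[OF r(1), of n] by (intro divide_left_mono) auto
    finally show "(\<Sum>i<m. energy (mr (c i)) (x i) (x' i)) \<le> I + \<epsilon>"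
      using n(2) \<epsilon>'(2) by (simp add: algebra_simps)
  qed
  moreover have "I \<le> (\<Sum>i<m. E' i)" if "P' 0 \<in> N1" "P' m \<in> N2" "\<forall>i<m. joins (P' i) (P' (Suc i)) (E' i)" for P' E'
    unfolding I_def by (rule cInf_lower[OF _ bdd]) (use that in \<open>auto simp: V_def admissible_def\<close>)
  ultimately show ?thesis
    using gd(1-3) by (intro exI[of _ m] exI[of _ L] exI[of _ c] exI[of _ x] exI[of _ x']) (auto intro: order_trans)
qed

end

section \<open>Totally geodesic submanifolds\<close>

text \<open>A subspace of a Euclidean space is closed and contains all difference quotients.\<close>

lemma derivative_in_subspace:
  fixes S :: "'e::euclidean_space set"
  assumes "subspace S" "r > 0" "\<And>s. \<bar>s\<bar> < r \<Longrightarrow> f s \<in> S" "(f has_vector_derivative w) (at 0)"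
  shows "w \<in> S"
proof (rule Lim_in_closed_set[OF closed_subspace[OF assms(1)]])
  show "((\<lambda>s. (1 / s) *\<^sub>R (f s - f 0)) \<longlongrightarrow> w) (at (0::real))"
    using assms(4) unfolding has_vector_derivative_def has_derivative_at
  proof (elim conjE)
    assume "(\<lambda>h. norm (f (0 + h) - f 0 - h *\<^sub>R w) / norm h) \<midarrow>0\<rightarrow> 0"
    moreover have "norm ((1 / h) *\<^sub>R (f h - f 0) - w) = norm (f (0 + h) - f 0 - h *\<^sub>R w) / norm h" if "h \<noteq> 0" for h :: real
    proof -
      have "(1 / h) *\<^sub>R (f h - f 0) - w = (1 / h) *\<^sub>R (f h - f 0 - h *\<^sub>R w)" using that by (simp add: scaleR_diff_right)
      then show ?thesis by simp
    qed
    ultimately have "(\<lambda>h. norm ((1 / h) *\<^sub>R (f h - f 0) - w)) \<midarrow>0\<rightarrow> 0"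
      using LIM_cong[of 0 0 "\<lambda>h. norm ((1 / h) *\<^sub>R (f h - f 0) - w)" "\<lambda>h. norm (f (0 + h) - f 0 - h *\<^sub>R w) / norm h" 0 0] by auto
    then show ?thesis using tendsto_norm_zero_iff LIM_zero_iff by blast
  qed
  show "eventually (\<lambda>s. (1 / s) *\<^sub>R (f s - f 0) \<in> S) (at (0::real))"
    unfolding eventually_at
    using assms(2,3) by (intro exI[of _ r]) (auto intro!: subspace_scale subspace_diff assms(1))
qed simp

context manifold
begin

lemma line_in_chart:
  assumes "d \<in> A" "c \<in> A" "p \<in> cdom d" "p \<in> cdom c"
  shows "\<exists>r>0. \<forall>s. \<bar>s\<bar> < r \<longrightarrow> coord d p + s *\<^sub>R v \<in> overlap d c"
proof -
  let ?f = "\<lambda>s. coord d p + s *\<^sub>R v"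
  have "open (?f -` overlap d c)"
    by (intro continuous_open_vimage open_overlap assms continuous_intros)
  moreover have "0 \<in> ?f -` overlap d c" using overlapI[OF assms(3,4)] by simp
  ultimately obtain r where "r > 0" "ball 0 r \<subseteq> ?f -` overlap d c" unfolding open_contains_ball by blast
  then show ?thesis by (intro exI[of _ r]) (auto simp: subset_iff)
qed

lemma line_derivatives:
  assumes d: "d \<in> A" and c: "c \<in> A" and ov: "coord d p + s *\<^sub>R v \<in> overlap d c"
  shows "((\<lambda>s. transition d c (coord d p + s *\<^sub>R v)) has_vector_derivative
      dB (transition d c) (coord d p + s *\<^sub>R v) v) (at s)"
    "((\<lambda>s. dB (transition d c) (coord d p + s *\<^sub>R v) v) has_vector_derivative
      dB (dB (transition d c)) (coord d p + s *\<^sub>R v) v v) (at s)"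
proof -
  note sm = transition_smooth[OF d c] and sm1 = smooth_on_dB[OF open_overlap[OF d c] transition_smooth[OF d c]]
  have l: "((\<lambda>s. coord d p + s *\<^sub>R v) has_vector_derivative v) (at s)"
    by (auto intro!: derivative_eq_intros simp: has_vector_derivative_def)
  show "((\<lambda>s. transition d c (coord d p + s *\<^sub>R v)) has_vector_derivative
      dB (transition d c) (coord d p + s *\<^sub>R v) v) (at s)"
    by (rule has_vector_derivative_compose[OF l smooth_on_has_derivative[OF sm ov]])
  have "((\<lambda>s. dB (transition d c) (coord d p + s *\<^sub>R v)) has_vector_derivative
      dB (dB (transition d c)) (coord d p + s *\<^sub>R v) v) (at s)"
    by (rule has_vector_derivative_compose[OF l smooth_on_has_derivative[OF sm1 ov]])
  from has_vector_derivative_blinfun_apply[OF this has_vector_derivative_const]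
  show "((\<lambda>s. dB (transition d c) (coord d p + s *\<^sub>R v) v) has_vector_derivative
      dB (dB (transition d c)) (coord d p + s *\<^sub>R v) v v) (at s)"
    by simp
qed

lemma line_second_derivative_continuous:
  assumes d: "d \<in> A" and c: "c \<in> A" and ov: "\<And>s. s \<in> J \<Longrightarrow> coord d p + s *\<^sub>R v \<in> overlap d c"
  shows "continuous_on J (\<lambda>s. dB (dB (transition d c)) (coord d p + s *\<^sub>R v) v v)"
proof -
  have "continuous_on (overlap d c) (dB (dB (transition d c)))"
    by (intro smooth_on_continuous smooth_on_dB open_overlap transition_smooth d c)
  then have "continuous_on J (\<lambda>s. dB (dB (transition d c)) (coord d p + s *\<^sub>R v))"
    by (rule continuous_on_compose2) (use ov in \<open>auto intro!: continuous_intros\<close>)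
  then show ?thesis by (intro continuous_intros)
qed

lemma slice_chartD:
  assumes "slice_chart A N c S"
  shows "c \<in> A" "subspace S" "p \<in> N \<Longrightarrow> p \<in> cdom c \<Longrightarrow> coord c p \<in> S"
    "x \<in> cimg c \<Longrightarrow> x \<in> S \<Longrightarrow> param c x \<in> N"
proof -
  show c: "c \<in> A" and "subspace S" using assms unfolding slice_chart_def by auto
  have eq: "coord c ` (cdom c \<inter> N) = cimg c \<inter> S" using assms unfolding slice_chart_def by auto
  show "p \<in> N \<Longrightarrow> p \<in> cdom c \<Longrightarrow> coord c p \<in> S" using eq by blast
  show "param c x \<in> N" if x: "x \<in> cimg c" "x \<in> S"
  proof -
    have "x \<in> coord c ` (cdom c \<inter> N)" unfolding eq using x by (rule IntI)
    then obtain q where "q \<in> cdom c" "q \<in> N" "x = coord c q" by blast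
    then show ?thesis using chart_facts(5)[OF c] by simp
  qed
qed

text \<open>The definition only asks for some slice chart. A line with direction \<open>v c\<close>
  in the slice of \<open>c\<close> stays in \<open>N\<close>, so its image in \<open>d\<close> stays
  in \<open>S\<close>, and so does the derivative.\<close>

lemma submanifold_tangent_slice:
  assumes v: "v \<in> submanifold_tangent_space A N p" and p: "p \<in> N" and d: "slice_chart A N d S" "p \<in> cdom d"
  shows "v d \<in> S"
proof -
  obtain c S' where c: "slice_chart A N c S'" "p \<in> cdom c" "v c \<in> S'" and vt: "v \<in> tangent_space A p"
    using v unfolding submanifold_tangent_space_def by blast
  note cA = slice_chartD(1)[OF c(1)] and dA = slice_chartD(1)[OF d(1)]
  obtain r where r: "r > 0" "\<And>s. \<bar>s\<bar> < r \<Longrightarrow> coord c p + s *\<^sub>R v c \<in> overlap c d"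
    using line_in_chart[OF cA dA c(2) d(2)] by blast
  define f where "f s = transition c d (coord c p + s *\<^sub>R v c)" for s
  have "f s \<in> S" if s: "\<bar>s\<bar> < r" for s
  proof -
    define z where "z = coord c p + s *\<^sub>R v c"
    have z: "z \<in> cimg c" "param c z \<in> cdom d" using overlap_iff[OF cA] r(2)[OF s] z_def by auto
    have "z \<in> S'" unfolding z_def
      by (intro subspace_add subspace_scale slice_chartD(2,3)[OF c(1)] p c(2,3))
    then have "param c z \<in> N" using slice_chartD(4)[OF c(1) z(1)] by blast
    then have "coord d (param c z) \<in> S" using slice_chartD(3)[OF d(1)] z(2) by blast
    then show ?thesis unfolding f_def transition_def z_def .
  qed
  moreover have "(f has_vector_derivative dB (transition c d) (coord c p) (v c)) (at 0)"
    using line_derivatives(1)[OF cA dA r(2), of 0] r(1) unfolding f_def by simp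
  ultimately have "dB (transition c d) (coord c p) (v c) \<in> S"
    by (rule derivative_in_subspace[OF slice_chartD(2)[OF d(1)] r(1)])
  then show ?thesis using tangent_change[OF vt cA dA c(2) d(2)] by (simp add: tmap_def)
qed

lemma submanifold_tangentI:
  "slice_chart A N d S \<Longrightarrow> p \<in> cdom d \<Longrightarrow> v \<in> S \<Longrightarrow> tvec_of A d p v \<in> submanifold_tangent_space A N p"
proof -
  assume h: "slice_chart A N d S" "p \<in> cdom d" "v \<in> S"
  have "tvec_of A d p v \<in> tangent_space A p" "tvec_of A d p v d \<in> S"
    using tvec_of_tangent tvec_of_self slice_chartD(1)[OF h(1)] h(2,3) by metis+
  then show ?thesis using h(1,2) unfolding submanifold_tangent_space_def by blast
qed

text \<open>The field constant in chart \<open>d\<close> serves as test field for total geodesy; its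
  smoothness has to be known in every chart.\<close>

lemma constant_field_rep:
  assumes d: "d \<in> A" and c: "c \<in> A"
  shows "x \<in> overlap c d \<Longrightarrow> field_rep (\<lambda>q. tvec_of A d q v) c x = dB (transition d c) (transition c d x) v"
    "smooth_on (overlap c d) (field_rep (\<lambda>q. tvec_of A d q v) c)"
proof -
  show eq: "field_rep (\<lambda>q. tvec_of A d q v) c x = dB (transition d c) (transition c d x) v" if x: "x \<in> overlap c d" for x
  proof -
    have "param c x \<in> cdom c" "param c x \<in> cdom d"
      using x overlap_iff[OF c] chart_facts(7)[OF c] by auto
    then show ?thesis unfolding field_rep_def
      by (simp add: tvec_of_apply[OF d c] tmap_def transition_def)
  qed
  have "smooth_on (overlap c d) (\<lambda>x. dB (transition d c) (transition c d x) v)"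
    by (rule smooth_on_compose[OF open_overlap[OF c d] open_overlap[OF d c] transition_smooth[OF c d] _
          smooth_on_dB_apply[OF open_overlap[OF d c] transition_smooth[OF d c]]])
      (use transition_overlap[OF c] in blast)
  then show "smooth_on (overlap c d) (field_rep (\<lambda>q. tvec_of A d q v) c)"
    using smooth_on_cong[OF open_overlap[OF c d], of "field_rep (\<lambda>q. tvec_of A d q v) c" "\<lambda>x. dB (transition d c) (transition c d x) v"] eq
    by blast
qed

end

context riemannian
begin

text \<open>In its own chart a constant field has only the Christoffel term. Since
  \<open>nabla\<close> evaluates in the chart picked by \<open>chart_at\<close>, the derivative of
  the field there has to be matched with the inhomogeneous transformation law.\<close>

lemma nabla_constant_field:
  assumes d: "d \<in> A" "p \<in> cdom d"
  shows "nabla A g p (tvec_of A d p v) (\<lambda>q. tvec_of A d q v) = tvec_of A d p (christoffel (mr d) (coord d p) v v)"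
proof -
  define c where "c = chart_at A p"
  have c: "c \<in> A" "p \<in> cdom c" using chart_at c_def by auto
  define Y where "Y = field_rep (\<lambda>q. tvec_of A d q v) c"
  let ?x = "coord c p" and ?y = "coord d p"
  have x: "?x \<in> overlap c d" by (rule overlapI[OF c(2) d(2)])
  have y: "transition c d ?x = ?y" by (rule transition_coord[OF c])
  have Yx: "Y ?x = tmap d c p v" using constant_field_rep(1)[OF d(1) c(1) x] y by (simp add: Y_def tmap_def)
  have "((\<lambda>z. dB (transition d c) (transition c d z)) has_derivative (\<lambda>u. dB (dB (transition d c)) ?y (tmap c d p u))) (at ?x)"
    by (rule has_derivative_compose[OF transition_deriv[OF c(1) d(1) c(2) d(2)]])
      (unfold y, rule smooth_on_has_derivative[OF smooth_on_dB[OF open_overlap[OF d(1) c(1)] transition_smooth[OF d(1) c(1)]] overlapI[OF d(2) c(2)]])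
  then have "((\<lambda>z. dB (transition d c) (transition c d z) v) has_derivative (\<lambda>u. dB (dB (transition d c)) ?y (tmap c d p u) v)) (at ?x)"
    by (rule bounded_linear.has_derivative[OF blinfun.bounded_linear_left])
  then have "(Y has_derivative (\<lambda>u. dB (dB (transition d c)) ?y (tmap c d p u) v)) (at ?x)"
    by (rule has_derivative_transform_within_open[OF _ open_overlap[OF c(1) d(1)] x])
      (simp add: Y_def constant_field_rep(1)[OF d(1) c(1)])
  from D_eqI[OF this] have DY: "D Y ?x (tmap d c p v) = dB (dB (transition d c)) ?y v v"
    by (simp add: tmap_inverse[OF d(1) c(1) d(2) c(2)])
  have "nabla_rep (mr c) (tmap d c p v) Y ?x = tmap d c p (christoffel (mr d) ?y v v)"
    unfolding nabla_rep_def DY Yx using christoffel_change[OF d(1) c(1) d(2) c(2), of v v] by simp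
  then have "nabla A g p (tvec_of A d p v) (\<lambda>q. tvec_of A d q v) = tvec_of A c p (tmap d c p (christoffel (mr d) ?y v v))"
    unfolding nabla_def Let_def c_def[symmetric] Y_def[symmetric] using tvec_of_apply[OF d(1) c(1) d(2) c(2)] by simp
  then show ?thesis using tvec_of_change[OF d(1) c(1) d(2) c(2)] by simp
qed

text \<open>The constant field with value in \<open>S\<close> is tangent to \<open>N\<close> along
  the whole slice, so it is admissible in the definition. Geometrically, the covariant acceleration
  of a straight line in the slice is tangent to \<open>N\<close>.\<close>

lemma totally_geodesic_slice:
  assumes tg: "totally_geodesic A g N" and p: "p \<in> N" and d: "slice_chart A N d S" "p \<in> cdom d" and v: "v \<in> S"
  shows "tvec_of A d p (christoffel (mr d) (coord d p) v v) \<in> submanifold_tangent_space A N p"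
proof -
  note dA = slice_chartD(1)[OF d(1)]
  let ?Y = "\<lambda>q. tvec_of A d q v"
  have "smooth_vector_field_on A (cdom d) ?Y"
    unfolding smooth_vector_field_on_def
    using tvec_of_tangent[OF dA] constant_field_rep(2)[OF dA] unfolding overlap_def by blast
  moreover have "\<forall>q\<in>N \<inter> cdom d. ?Y q \<in> submanifold_tangent_space A N q"
    using submanifold_tangentI[OF d(1) _ v] by blast
  ultimately have "nabla A g p (?Y p) ?Y \<in> submanifold_tangent_space A N p"
    using tg p d(2) chart_facts(1)[OF dA] submanifold_tangentI[OF d v] unfolding totally_geodesic_def by blast
  then show ?thesis unfolding nabla_constant_field[OF dA d(2)] .
qed

end

section \<open>Variations of a minimising chain\<close>

text \<open>If the second derivative were negative, the first would be negative just after 0 and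
  \<open>f\<close> would drop below \<open>f 0\<close>.\<close>

lemma second_derivative_at_minimum:
  fixes f f' :: "real \<Rightarrow> real"
  assumes "e > 0" and f: "\<And>s. \<bar>s\<bar> < e \<Longrightarrow> (f has_real_derivative f' s) (at s)"
    and f': "(f' has_real_derivative l) (at 0)" and min: "\<And>s. \<bar>s\<bar> < e \<Longrightarrow> f 0 \<le> f s"
  shows "f' 0 = 0" "l \<ge> 0"
proof -
  show 0: "f' 0 = 0"
    by (rule DERIV_local_min[OF f assms(1)]) (use assms(1) min in auto)
  show "l \<ge> 0"
  proof (rule ccontr)
    assume "\<not> l \<ge> 0"
    then obtain d where d: "d > 0" "\<And>h. h > 0 \<Longrightarrow> h < d \<Longrightarrow> f' h < 0"
      using DERIV_neg_dec_right[OF f'] 0 by auto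
    define h where "h = min d e / 2"
    have h: "h > 0" "h < d" "h < e" using d(1) assms(1) by (auto simp: h_def)
    obtain z where z: "0 < z" "z < h" "f h - f 0 = (h - 0) * f' z"
      using MVT2[of 0 h f f'] f h by force
    then have "f h - f 0 < 0" using d(2)[of z] h by (simp add: mult_pos_neg)
    then show False using min[of h] h by simp
  qed
qed

lemma common_radius:
  fixes m :: nat
  assumes "\<And>i. i < m \<Longrightarrow> \<exists>r>0. \<forall>s. \<bar>s\<bar> < r \<longrightarrow> Q i s"
  shows "\<exists>r>0::real. \<forall>i<m. \<forall>s. \<bar>s\<bar> < r \<longrightarrow> Q i s"
  using assms
proof (induction m)
  case 0
  then show ?case by (auto intro: exI[of _ 1])
next
  case (Suc m)
  then obtain r where r: "r > 0" "\<forall>i<m. \<forall>s. \<bar>s\<bar> < r \<longrightarrow> Q i s" by force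
  obtain r' where r': "r' > 0" "\<forall>s. \<bar>s\<bar> < r' \<longrightarrow> Q m s" using Suc.prems by blast
  show ?case using r r' by (intro exI[of _ "min r r'"]) (auto simp: less_Suc_eq)
qed

context riemannian
begin

definition second_variation_integrand :: "('m, 'e) chart \<Rightarrow> (real \<Rightarrow> 'e) \<Rightarrow> (real \<Rightarrow> 'e) \<Rightarrow> (real \<Rightarrow> 'e) \<Rightarrow> (real \<Rightarrow> 'e) \<Rightarrow> real \<Rightarrow> real" where
  "second_variation_integrand c x x' V V' t =
     mr c (x t) (V' t + christoffel (mr c) (x t) (x' t) (V t)) (V' t + christoffel (mr c) (x t) (x' t) (V t))
       - Rm (mr c) (x t) (V t) (x' t)"

text \<open>The covariant acceleration of the curve through \<open>p\<close> which is a straight line in the chart \<open>d\<close>.\<close>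

definition line_acceleration :: "('m, 'e) chart \<Rightarrow> 'm \<Rightarrow> ('m, 'e) tvec \<Rightarrow> ('m, 'e) tvec" where
  "line_acceleration d p v = tvec_of A d p (christoffel (mr d) (coord d p) (v d) (v d))"

lemma line_acceleration_tangent: "d \<in> A \<Longrightarrow> p \<in> cdom d \<Longrightarrow> line_acceleration d p v \<in> tangent_space A p"
  unfolding line_acceleration_def by (rule tvec_of_tangent)

text \<open>A line of \<open>d\<close>, seen in \<open>c\<close>, acquires a second derivative from
  the transition map; the connection term of \<open>c\<close> completes it to the component of a
  tangent vector that does not depend on \<open>c\<close>.\<close>

lemma line_acceleration_component:
  assumes d: "d \<in> A" "p \<in> cdom d" and c: "c \<in> A" "p \<in> cdom c" and v: "v \<in> tangent_space A p"
  shows "dB (dB (transition d c)) (coord d p) (v d) (v d) + christoffel (mr c) (coord c p) (v c) (v c) = line_acceleration d p v c"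
  using christoffel_change[OF d(1) c(1) d(2) c(2), of "v d" "v d"] tangent_change[OF v d(1) c(1) d(2) c(2)]
  by (simp add: line_acceleration_def tvec_of_apply[OF d(1) c(1) d(2) c(2)] add.commute)

text \<open>The ends move along lines of charts \<open>d\<close> and \<open>d'\<close>, which are
  attached to the points and not to the piece. So two neighbouring pieces can move their common
  joint in the same way although they live in different charts.\<close>

lemma piece_variation:
  assumes piece: "geodesic_piece c x x'" "param c (x 0) = p" "param c (x 1) = q"
    and d: "d \<in> A" "p \<in> cdom d" and d': "d' \<in> A" "q \<in> cdom d'"
    and v: "v \<in> tangent_space A p" and w: "w \<in> tangent_space A q"
    and V: "\<And>t. t \<in> {0..1} \<Longrightarrow> (V has_vector_derivative V' t) (at t within {0..1})" "continuous_on {0..1} V'"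
      "V 0 = v c" "V 1 = w c"
  shows "\<exists>e E f1 f2. 0 < e \<and>
    (\<forall>s. \<bar>s\<bar> < e \<longrightarrow> coord d p + s *\<^sub>R v d \<in> cimg d \<and> coord d' q + s *\<^sub>R w d' \<in> cimg d' \<and>
       joins (param d (coord d p + s *\<^sub>R v d)) (param d' (coord d' q + s *\<^sub>R w d')) (E s) \<and>
       (E has_real_derivative f1 s) (at s)) \<and>
    (f1 has_real_derivative f2) (at 0) \<and> E 0 = energy (mr c) x x' \<and>
    f1 0 = 2 * (g q (tvec_of A c q (x' 1)) w - g p (tvec_of A c p (x' 0)) v) \<and>
    (second_variation_integrand c x x' V V' has_integral
      (f2 / 2 - (g q (tvec_of A c q (x' 1)) (line_acceleration d' q w)
         - g p (tvec_of A c p (x' 0)) (line_acceleration d p v)))) {0..1}"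
proof -
  have cA: "c \<in> A" and geo: "geodesic (cimg c) (mr c) x x'" using piece(1) unfolding geodesic_piece_def by auto
  have x01: "x 0 \<in> cimg c" "x 1 \<in> cimg c" using geodesicD(1)[OF geo] by auto
  have pc: "p \<in> cdom c" "coord c p = x 0" and qc: "q \<in> cdom c" "coord c q = x 1"
    using chart_facts(6,7)[OF cA x01(1)] chart_facts(6,7)[OF cA x01(2)] piece(2,3) by auto
  obtain r1 where r1: "r1 > 0" "\<And>s. \<bar>s\<bar> < r1 \<Longrightarrow> coord d p + s *\<^sub>R v d \<in> overlap d c"
    using line_in_chart[OF d(1) cA d(2) pc(1)] by blast
  obtain r2 where r2: "r2 > 0" "\<And>s. \<bar>s\<bar> < r2 \<Longrightarrow> coord d' q + s *\<^sub>R w d' \<in> overlap d' c"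
    using line_in_chart[OF d'(1) cA d'(2) qc(1)] by blast
  define r where "r = min r1 r2"
  have r: "r > 0" "\<And>s. \<bar>s\<bar> < r \<Longrightarrow> coord d p + s *\<^sub>R v d \<in> overlap d c" "\<And>s. \<bar>s\<bar> < r \<Longrightarrow> coord d' q + s *\<^sub>R w d' \<in> overlap d' c"
    using r1 r2 by (auto simp: r_def)
  define a where "a s = transition d c (coord d p + s *\<^sub>R v d)" for s
  define a' where "a' s = dB (transition d c) (coord d p + s *\<^sub>R v d) (v d)" for s
  define a'' where "a'' s = dB (dB (transition d c)) (coord d p + s *\<^sub>R v d) (v d) (v d)" for s
  define b where "b s = transition d' c (coord d' q + s *\<^sub>R w d')" for s
  define b' where "b' s = dB (transition d' c) (coord d' q + s *\<^sub>R w d') (w d')" for s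
  define b'' where "b'' s = dB (dB (transition d' c)) (coord d' q + s *\<^sub>R w d') (w d') (w d')" for s
  have va: "v c = tmap d c p (v d)" and wa: "w c = tmap d' c q (w d')"
    using tangent_change[OF v d(1) cA d(2) pc(1)] tangent_change[OF w d'(1) cA d'(2) qc(1)] by auto
  have "variation (cimg c) (mr c) x x' V V' a a' a'' b b' b'' r"
  proof (intro variation.intro variation_axioms.intro)
    show "chart_metric (cimg c) (mr c)" by (rule chart_metric_mr[OF cA])
    show "(a has_vector_derivative a' s) (at s)" "(a' has_vector_derivative a'' s) (at s)" if "\<bar>s\<bar> < r" for s
      unfolding a_def a'_def a''_def by (rule line_derivatives[OF d(1) cA r(2)[OF that]])+
    show "(b has_vector_derivative b' s) (at s)" "(b' has_vector_derivative b'' s) (at s)" if "\<bar>s\<bar> < r" for s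
      unfolding b_def b'_def b''_def by (rule line_derivatives[OF d'(1) cA r(3)[OF that]])+
    show "continuous_on {- r<..<r} a''" unfolding a''_def
      by (rule line_second_derivative_continuous[OF d(1) cA]) (use r(2) in auto)
    show "continuous_on {- r<..<r} b''" unfolding b''_def
      by (rule line_second_derivative_continuous[OF d'(1) cA]) (use r(3) in auto)
    show "a 0 = x 0" "a' 0 = V 0" "b 0 = x 1" "b' 0 = V 1"
      using V(3,4) va wa pc(2) qc(2) transition_coord[OF d, of c] transition_coord[OF d', of c]
      by (simp_all add: a_def a'_def b_def b'_def tmap_def)
  qed (use geo V r(1) in auto)
  from variation.ex_variation[OF this] obtain X Y e f1 f2 where e: "0 < e" "e \<le> r"
    and X: "\<And>s. \<bar>s\<bar> < e \<Longrightarrow> (\<forall>t\<in>{0..1}. X s t \<in> cimg c \<and> (X s has_vector_derivative Y s t) (at t within {0..1})) \<and>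
       continuous_on {0..1} (Y s) \<and> X s 0 = a s \<and> X s 1 = b s \<and>
       ((\<lambda>s. energy (mr c) (X s) (Y s)) has_real_derivative f1 s) (at s)"
    and f: "(f1 has_real_derivative f2) (at 0)" "energy (mr c) (X 0) (Y 0) = energy (mr c) x x'"
      "f1 0 = 2 * mr c (x 1) (x' 1) (V 1) - 2 * mr c (x 0) (x' 0) (V 0)"
    and int: "((\<lambda>t. mr c (x t) (V' t + christoffel (mr c) (x t) (x' t) (V t)) (V' t + christoffel (mr c) (x t) (x' t) (V t)) - Rm (mr c) (x t) (V t) (x' t))
     has_integral (f2 / 2 - (mr c (x 1) (x' 1) (b'' 0 + christoffel (mr c) (x 1) (V 1) (V 1))
        - mr c (x 0) (x' 0) (a'' 0 + christoffel (mr c) (x 0) (V 0) (V 0))))) {0..1}"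
    by blast
  define E where "E s = energy (mr c) (X s) (Y s)" for s
  have ge: "g p (tvec_of A c p z) u = mr c (x 0) z (u c)" if "u \<in> tangent_space A p" for z u
    using g_eq[OF tvec_of_tangent[OF cA pc(1)] that cA pc(1)] tvec_of_self[OF cA pc(1)] pc(2) by simp
  have ge': "g q (tvec_of A c q z) u = mr c (x 1) z (u c)" if "u \<in> tangent_space A q" for z u
    using g_eq[OF tvec_of_tangent[OF cA qc(1)] that cA qc(1)] tvec_of_self[OF cA qc(1)] qc(2) by simp
  have "joins (param d (coord d p + s *\<^sub>R v d)) (param d' (coord d' q + s *\<^sub>R w d')) (E s)" if s: "\<bar>s\<bar> < e" for s
  proof -
    have "seg c (X s) (Y s)" unfolding seg_def using cA X[OF s] by blast
    moreover have "param c (a s) = param d (coord d p + s *\<^sub>R v d)"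
      unfolding a_def by (rule param_transition[OF d(1) cA r(2)]) (use s e in simp)
    moreover have "param c (b s) = param d' (coord d' q + s *\<^sub>R w d')"
      unfolding b_def by (rule param_transition[OF d'(1) cA r(3)]) (use s e in simp)
    ultimately show ?thesis unfolding joins_def E_def using X[OF s] by metis
  qed
  moreover have "coord d p + s *\<^sub>R v d \<in> cimg d \<and> coord d' q + s *\<^sub>R w d' \<in> cimg d'" if "\<bar>s\<bar> < e" for s
    using r(2,3)[of s] that e(2) overlap_iff d(1) d'(1) by simp
  moreover have "(E has_real_derivative f1 s) (at s)" if "\<bar>s\<bar> < e" for s
    using X[OF that] unfolding E_def by blast
  moreover have "f1 0 = 2 * (g q (tvec_of A c q (x' 1)) w - g p (tvec_of A c p (x' 0)) v)"
    using f(3) V(3,4) ge[OF v] ge'[OF w] by simp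
  moreover have "(second_variation_integrand c x x' V V' has_integral
      (f2 / 2 - (g q (tvec_of A c q (x' 1)) (line_acceleration d' q w)
         - g p (tvec_of A c p (x' 0)) (line_acceleration d p v)))) {0..1}"
  proof -
    have "a'' 0 + christoffel (mr c) (x 0) (V 0) (V 0) = line_acceleration d p v c"
      using line_acceleration_component[OF d cA pc(1) v] pc(2) V(3) by (simp add: a''_def)
    moreover have "b'' 0 + christoffel (mr c) (x 1) (V 1) (V 1) = line_acceleration d' q w c"
      using line_acceleration_component[OF d' cA qc(1) w] qc(2) V(4) by (simp add: b''_def)
    ultimately show ?thesis
      using int ge[OF line_acceleration_tangent[OF d]] ge'[OF line_acceleration_tangent[OF d']]
      unfolding second_variation_integrand_def by simp
  qed
  ultimately show ?thesis
    using e(1) f(1,2) unfolding E_def[of 0, symmetric] by blast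
qed

end

text \<open>The situation of the indirect proof. Minimality is relative to chains with the same
  number of pieces, and all variations stay among these; \<open>d\<^sub>1\<close> and
  \<open>d\<^sub>2\<close> are slice charts at the two ends.\<close>

locale minimal_chain = riemannian A g
  for A :: "('m::{t2_space,second_countable_topology}, 'e::euclidean_space) chart set" and g +
  fixes N\<^sub>1 N\<^sub>2 :: "'m set" and m :: nat and P :: "nat \<Rightarrow> 'm" and c :: "nat \<Rightarrow> ('m, 'e) chart"
    and x x' :: "nat \<Rightarrow> real \<Rightarrow> 'e" and d\<^sub>1 d\<^sub>2 :: "('m, 'e) chart" and S\<^sub>1 S\<^sub>2 :: "'e set"
  assumes slice\<^sub>1: "slice_chart A N\<^sub>1 d\<^sub>1 S\<^sub>1" "P 0 \<in> cdom d\<^sub>1"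
    and slice\<^sub>2: "slice_chart A N\<^sub>2 d\<^sub>2 S\<^sub>2" "P m \<in> cdom d\<^sub>2"
    and tg: "totally_geodesic A g N\<^sub>1" "totally_geodesic A g N\<^sub>2"
    and disj: "N\<^sub>1 \<inter> N\<^sub>2 = {}"
    and P: "P 0 \<in> N\<^sub>1" "P m \<in> N\<^sub>2"
    and piece: "\<And>i. i < m \<Longrightarrow> geodesic_piece (c i) (x i) (x' i)"
    and ends: "\<And>i. i < m \<Longrightarrow> param (c i) (x i 0) = P i" "\<And>i. i < m \<Longrightarrow> param (c i) (x i 1) = P (Suc i)"
    and minimal: "\<And>P' E'. P' 0 \<in> N\<^sub>1 \<Longrightarrow> P' m \<in> N\<^sub>2 \<Longrightarrow> (\<And>i. i < m \<Longrightarrow> joins (P' i) (P' (Suc i)) (E' i)) \<Longrightarrow>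
        (\<Sum>i<m. energy (mr (c i)) (x i) (x' i)) \<le> (\<Sum>i<m. E' i)"
begin

text \<open>With no pieces the single point \<open>P 0\<close> would lie in both
  submanifolds.\<close>

lemma m_pos: "m > 0"
  using P disj by (cases m) auto

lemma piece_chart:
  assumes "i < m"
  shows "c i \<in> A" "geodesic (cimg (c i)) (mr (c i)) (x i) (x' i)" "transportable (mr (c i)) (x i) (x' i)"
    "P i \<in> cdom (c i)" "P (Suc i) \<in> cdom (c i)" "coord (c i) (P i) = x i 0" "coord (c i) (P (Suc i)) = x i 1"
proof -
  show cA: "c i \<in> A" and geo: "geodesic (cimg (c i)) (mr (c i)) (x i) (x' i)" and "transportable (mr (c i)) (x i) (x' i)"
    using piece[OF assms] unfolding geodesic_piece_def by auto
  have x01: "x i 0 \<in> cimg (c i)" "x i 1 \<in> cimg (c i)" using geodesicD(1)[OF geo] by auto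
  show "P i \<in> cdom (c i)" "P (Suc i) \<in> cdom (c i)" "coord (c i) (P i) = x i 0" "coord (c i) (P (Suc i)) = x i 1"
    using chart_facts(6,7)[OF cA x01(1)] chart_facts(6,7)[OF cA x01(2)] ends[OF assms] by auto
qed

definition initial :: "nat \<Rightarrow> ('m, 'e) tvec" where
  "initial i = tvec_of A (c i) (P i) (x' i 0)"

definition final :: "nat \<Rightarrow> ('m, 'e) tvec" where
  "final i = tvec_of A (c i) (P (Suc i)) (x' i 1)"

text \<open>The total energy as a function of \<open>s\<close> has a minimum at 0, because the lines
  at the ends remain in the two submanifolds. Its first and second derivatives are the sums over the
  pieces found in \<open>piece_variation\<close>.\<close>

lemma chain_variation:
  assumes d: "\<And>i. i \<le> m \<Longrightarrow> d i \<in> A \<and> P i \<in> cdom (d i)"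
    and u: "\<And>i. i \<le> m \<Longrightarrow> u i \<in> tangent_space A (P i)"
    and S1: "d 0 = d\<^sub>1" "u 0 d\<^sub>1 \<in> S\<^sub>1" and S2: "d m = d\<^sub>2" "u m d\<^sub>2 \<in> S\<^sub>2"
    and V: "\<And>i t. i < m \<Longrightarrow> t \<in> {0..1} \<Longrightarrow> (V i has_vector_derivative V' i t) (at t within {0..1})"
      "\<And>i. i < m \<Longrightarrow> continuous_on {0..1} (V' i)" "\<And>i. i < m \<Longrightarrow> V i 0 = u i (c i)" "\<And>i. i < m \<Longrightarrow> V i 1 = u (Suc i) (c i)"
  shows "(\<Sum>i<m. g (P (Suc i)) (final i) (u (Suc i)) - g (P i) (initial i) (u i)) = 0"
    "(\<Sum>i<m. integral {0..1} (second_variation_integrand (c i) (x i) (x' i) (V i) (V' i))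
      + (g (P (Suc i)) (final i) (line_acceleration (d (Suc i)) (P (Suc i)) (u (Suc i)))
        - g (P i) (initial i) (line_acceleration (d i) (P i) (u i)))) \<ge> 0"
proof -
  define y where "y i s = coord (d i) (P i) + s *\<^sub>R u i (d i)" for i s
  define var where "var i e E f1 f2 \<longleftrightarrow> 0 < e \<and>
    (\<forall>s. \<bar>s\<bar> < e \<longrightarrow> y i s \<in> cimg (d i) \<and> y (Suc i) s \<in> cimg (d (Suc i)) \<and>
       joins (param (d i) (y i s)) (param (d (Suc i)) (y (Suc i) s)) (E s) \<and> (E has_real_derivative f1 s) (at s)) \<and>
    (f1 has_real_derivative f2) (at 0) \<and> E 0 = energy (mr (c i)) (x i) (x' i) \<and>
    f1 0 = 2 * (g (P (Suc i)) (final i) (u (Suc i)) - g (P i) (initial i) (u i)) \<and>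
    (second_variation_integrand (c i) (x i) (x' i) (V i) (V' i) has_integral
      (f2 / 2 - (g (P (Suc i)) (final i) (line_acceleration (d (Suc i)) (P (Suc i)) (u (Suc i)))
         - g (P i) (initial i) (line_acceleration (d i) (P i) (u i))))) {0..1}" for i e E f1 f2
  have "\<exists>e E f1 f2. var i e E f1 f2" if i: "i < m" for i
  proof -
    have i': "i \<le> m" "Suc i \<le> m" using i by auto
    show ?thesis
      unfolding var_def y_def initial_def final_def
      using d[OF i'(1)] d[OF i'(2)] u[OF i'(1)] u[OF i'(2)]
      by (intro piece_variation piece ends i V) auto
  qed
  then have "\<forall>i. \<exists>z. i < m \<longrightarrow> var i (fst z) (fst (snd z)) (fst (snd (snd z))) (snd (snd (snd z)))"
    by (metis fst_conv snd_conv)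
  from choice[OF this] obtain z where z: "\<forall>i<m. var i (fst (z i)) (fst (snd (z i))) (fst (snd (snd (z i)))) (snd (snd (snd (z i))))" ..
  define e where "e i = fst (z i)" for i
  define E where "E i = fst (snd (z i))" for i
  define f1 where "f1 i = fst (snd (snd (z i)))" for i
  define f2 where "f2 i = snd (snd (snd (z i)))" for i
  have var: "var i (e i) (E i) (f1 i) (f2 i)" if "i < m" for i
    using z that unfolding e_def E_def f1_def f2_def by blast
  have "\<exists>r>0. \<forall>i<m. \<forall>s. \<bar>s\<bar> < r \<longrightarrow> y i s \<in> cimg (d i) \<and> y (Suc i) s \<in> cimg (d (Suc i)) \<and>
       joins (param (d i) (y i s)) (param (d (Suc i)) (y (Suc i) s)) (E i s) \<and> (E i has_real_derivative f1 i s) (at s)"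
  proof (rule common_radius)
    fix i assume "i < m"
    from var[OF this] show "\<exists>r>0. \<forall>s. \<bar>s\<bar> < r \<longrightarrow> y i s \<in> cimg (d i) \<and> y (Suc i) s \<in> cimg (d (Suc i)) \<and>
       joins (param (d i) (y i s)) (param (d (Suc i)) (y (Suc i) s)) (E i s) \<and> (E i has_real_derivative f1 i s) (at s)"
      unfolding var_def by blast
  qed
  then obtain r where r: "r > 0" "\<And>i s. i < m \<Longrightarrow> \<bar>s\<bar> < r \<Longrightarrow> y i s \<in> cimg (d i) \<and> y (Suc i) s \<in> cimg (d (Suc i)) \<and>
       joins (param (d i) (y i s)) (param (d (Suc i)) (y (Suc i) s)) (E i s) \<and> (E i has_real_derivative f1 i s) (at s)"
    by blast
  have "(\<Sum>i<m. E i 0) \<le> (\<Sum>i<m. E i s)" if s: "\<bar>s\<bar> < r" for s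
  proof -
    have "(\<Sum>i<m. E i 0) = (\<Sum>i<m. energy (mr (c i)) (x i) (x' i))"
      using var unfolding var_def by (intro sum.cong) auto
    also have "\<dots> \<le> (\<Sum>i<m. E i s)"
    proof (rule minimal[of "\<lambda>i. param (d i) (y i s)"])
      have "y 0 s \<in> S\<^sub>1" unfolding y_def
        unfolding S1(1) by (intro subspace_add subspace_scale slice_chartD(2,3)[OF slice\<^sub>1(1)] P S1(2) slice\<^sub>1(2))
      then show "param (d 0) (y 0 s) \<in> N\<^sub>1" using slice_chartD(4)[OF slice\<^sub>1(1)] r(2)[OF m_pos s] S1(1) by simp
      have "y m s \<in> S\<^sub>2" unfolding y_def
        unfolding S2(1) by (intro subspace_add subspace_scale slice_chartD(2,3)[OF slice\<^sub>2(1)] P S2(2) slice\<^sub>2(2))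
      \<comment> \<open>Chart membership is provided piece by piece, so the last joint is reached as
        the end of piece \<open>m - 1\<close>.\<close>
      moreover have "y m s \<in> cimg (d m)" using r(2)[of "m - 1", OF _ s] m_pos by simp
      ultimately show "param (d m) (y m s) \<in> N\<^sub>2" using slice_chartD(4)[OF slice\<^sub>2(1)] S2(1) by simp
    qed (use r(2) s in blast)
    finally show ?thesis .
  qed
  moreover have "((\<lambda>s. \<Sum>i<m. E i s) has_real_derivative (\<Sum>i<m. f1 i s)) (at s)" if "\<bar>s\<bar> < r" for s
    by (rule DERIV_sum) (use r(2) that in blast)
  moreover have "((\<lambda>s. \<Sum>i<m. f1 i s) has_real_derivative (\<Sum>i<m. f2 i)) (at 0)"
    by (rule DERIV_sum) (use var in \<open>auto simp: var_def\<close>)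
  ultimately have min: "(\<Sum>i<m. f1 i 0) = 0" "(\<Sum>i<m. f2 i) \<ge> 0"
    using second_derivative_at_minimum[OF r(1), of "\<lambda>s. \<Sum>i<m. E i s" "\<lambda>s. \<Sum>i<m. f1 i s" "\<Sum>i<m. f2 i"] by auto
  have "(\<Sum>i<m. f1 i 0) = 2 * (\<Sum>i<m. g (P (Suc i)) (final i) (u (Suc i)) - g (P i) (initial i) (u i))"
    unfolding sum_distrib_left using var unfolding var_def by (intro sum.cong) auto
  then show "(\<Sum>i<m. g (P (Suc i)) (final i) (u (Suc i)) - g (P i) (initial i) (u i)) = 0"
    using min(1) by simp
  have "(\<Sum>i<m. integral {0..1} (second_variation_integrand (c i) (x i) (x' i) (V i) (V' i))
      + (g (P (Suc i)) (final i) (line_acceleration (d (Suc i)) (P (Suc i)) (u (Suc i)))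
        - g (P i) (initial i) (line_acceleration (d i) (P i) (u i)))) = (\<Sum>i<m. f2 i / 2)"
  proof (rule sum.cong[OF refl])
    fix i assume "i \<in> {..<m}"
    then have "var i (e i) (E i) (f1 i) (f2 i)" using var by simp
    then have "integral {0..1} (second_variation_integrand (c i) (x i) (x' i) (V i) (V' i)) =
      f2 i / 2 - (g (P (Suc i)) (final i) (line_acceleration (d (Suc i)) (P (Suc i)) (u (Suc i)))
         - g (P i) (initial i) (line_acceleration (d i) (P i) (u i)))"
      unfolding var_def by (intro integral_unique) blast
    then show "integral {0..1} (second_variation_integrand (c i) (x i) (x' i) (V i) (V' i))
      + (g (P (Suc i)) (final i) (line_acceleration (d (Suc i)) (P (Suc i)) (u (Suc i)))
        - g (P i) (initial i) (line_acceleration (d i) (P i) (u i))) = f2 i / 2" by simp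
  qed
  also have "\<dots> = (\<Sum>i<m. f2 i) / 2" by (simp add: sum_divide_distrib)
  finally show "(\<Sum>i<m. integral {0..1} (second_variation_integrand (c i) (x i) (x' i) (V i) (V' i))
      + (g (P (Suc i)) (final i) (line_acceleration (d (Suc i)) (P (Suc i)) (u (Suc i)))
        - g (P i) (initial i) (line_acceleration (d i) (P i) (u i)))) \<ge> 0"
    using min(2) by simp
qed

text \<open>Slice charts at the two ends keep the moving ends on the submanifolds; the inner joints
  may use any chart.\<close>

definition bchart :: "nat \<Rightarrow> ('m, 'e) chart" where
  "bchart i = (if i = 0 then d\<^sub>1 else if i = m then d\<^sub>2 else chart_at A (P i))"

lemma bchart: "i \<le> m \<Longrightarrow> bchart i \<in> A \<and> P i \<in> cdom (bchart i)" "bchart 0 = d\<^sub>1" "bchart m = d\<^sub>2"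
  using slice_chartD(1)[OF slice\<^sub>1(1)] slice_chartD(1)[OF slice\<^sub>2(1)] slice\<^sub>1(2) slice\<^sub>2(2) chart_at m_pos
  by (auto simp: bchart_def)

lemma velocity_tangent: "i < m \<Longrightarrow> initial i \<in> tangent_space A (P i)" "i < m \<Longrightarrow> final i \<in> tangent_space A (P (Suc i))"
  unfolding initial_def final_def using tvec_of_tangent piece_chart by blast+

text \<open>Only joint \<open>j\<close> is moved, so just the pieces \<open>j - 1\<close> and
  \<open>j\<close> contribute. The conditionals drop the missing neighbour at either end of the
  chain, where the direction has to be tangent to the submanifold.\<close>

lemma first_variation_at:
  assumes j: "j \<le> m" and w: "w \<in> tangent_space A (P j)"
    and "j = 0 \<Longrightarrow> w \<in> submanifold_tangent_space A N\<^sub>1 (P 0)" "j = m \<Longrightarrow> w \<in> submanifold_tangent_space A N\<^sub>2 (P m)"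
  shows "(if 0 < j then g (P j) (final (j - 1)) w else 0) = (if j < m then g (P j) (initial j) w else 0)"
proof -
  define u where "u i = (if i = j then w else (\<lambda>_. 0))" for i
  define V where "V i t = (1 - t) *\<^sub>R u i (c i) + t *\<^sub>R u (Suc i) (c i)" for i and t :: real
  have ut: "u i \<in> tangent_space A (P i)" for i using w zero_tangent by (simp add: u_def)
  have "(\<Sum>i<m. g (P (Suc i)) (final i) (u (Suc i)) - g (P i) (initial i) (u i)) = 0"
  proof (rule chain_variation(1)[OF bchart(1) ut])
    show "bchart 0 = d\<^sub>1" "bchart m = d\<^sub>2" by (rule bchart(2,3))+
    show "u 0 d\<^sub>1 \<in> S\<^sub>1"
    proof (cases "j = 0")
      case True
      then show ?thesis using submanifold_tangent_slice[OF assms(3)[OF True] P(1) slice\<^sub>1] by (simp add: u_def)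
    next
      case False then show ?thesis using subspace_0[OF slice_chartD(2)[OF slice\<^sub>1(1)]] by (simp add: u_def)
    qed
    show "u m d\<^sub>2 \<in> S\<^sub>2"
    proof (cases "j = m")
      case True
      then show ?thesis using submanifold_tangent_slice[OF assms(4)[OF True] P(2) slice\<^sub>2] by (simp add: u_def)
    next
      case False then show ?thesis using subspace_0[OF slice_chartD(2)[OF slice\<^sub>2(1)]] by (simp add: u_def)
    qed
    show "(V i has_vector_derivative u (Suc i) (c i) - u i (c i)) (at t within {0..1})" for i t
      unfolding V_def by (auto intro!: derivative_eq_intros simp: has_vector_derivative_def algebra_simps)
    show "continuous_on {0..1} (\<lambda>t. u (Suc i) (c i) - u i (c i))" for i by (rule continuous_on_const)
    show "V i 0 = u i (c i)" "V i 1 = u (Suc i) (c i)" for i by (auto simp: V_def)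
  qed
  moreover have "g (P (Suc i)) (final i) (u (Suc i)) = (if i = j - 1 then (if 0 < j then g (P j) (final (j - 1)) w else 0) else 0)"
    if "i < m" for i
    using that g_zero[OF velocity_tangent(2)[OF that]] by (cases j) (auto simp: u_def)
  moreover have "g (P i) (initial i) (u i) = (if i = j then g (P j) (initial j) w else 0)" if "i < m" for i
    using that g_zero[OF velocity_tangent(1)[OF that]] by (auto simp: u_def)
  ultimately have "(\<Sum>i<m. (if i = j - 1 then (if 0 < j then g (P j) (final (j - 1)) w else 0) else 0))
     - (\<Sum>i<m. (if i = j then g (P j) (initial j) w else 0)) = 0"
    by (simp add: sum_subtractf)
  then show ?thesis using j m_pos by (cases j) (auto simp: sum.delta)
qed

text \<open>At an inner joint every direction is allowed, so both velocities have the same inner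
  product with all tangent vectors.\<close>

lemma no_corner:
  assumes "0 < j" "j < m"
  shows "final (j - 1) = initial j"
proof (rule ccontr)
  assume ne: "final (j - 1) \<noteq> initial j"
  have j: "j - 1 < m" "Suc (j - 1) = j" using assms by auto
  have t: "final (j - 1) \<in> tangent_space A (P j)" "initial j \<in> tangent_space A (P j)"
    using velocity_tangent(2)[OF j(1)] velocity_tangent(1)[OF assms(2)] j(2) by auto
  define e where "e = chart_at A (P j)"
  have e: "e \<in> A" "P j \<in> cdom e" using chart_at e_def by auto
  note cm = chart_metric_mr[OF e(1)]
  have "final (j - 1) e = initial j e"
  proof (rule chart_metric.nondegenerate[OF cm, of "coord e (P j)"])
    show "coord e (P j) \<in> cimg e" using e by blast
    fix w
    have w: "tvec_of A e (P j) w \<in> tangent_space A (P j)" by (rule tvec_of_tangent[OF e])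
    show "mr e (coord e (P j)) (final (j - 1) e) w = mr e (coord e (P j)) (initial j e) w"
      using first_variation_at[of j, OF _ w] assms g_eq[OF t(1) w e] g_eq[OF t(2) w e] tvec_of_self[OF e] by simp
  qed
  then show False using ne tangent_eqI[OF t e] by blast
qed

text \<open>At an end joint only one piece is affected, and its boundary term must vanish by
  itself.\<close>

lemma perpendicular:
  "w \<in> submanifold_tangent_space A N\<^sub>1 (P 0) \<Longrightarrow> g (P 0) (initial 0) w = 0"
  "w \<in> submanifold_tangent_space A N\<^sub>2 (P m) \<Longrightarrow> g (P m) (final (m - 1)) w = 0"
  using first_variation_at[of 0 w] first_variation_at[of m w] m_pos
  unfolding submanifold_tangent_space_def by auto

end

section \<open>Parallel fields along a minimising chain\<close>

context chart_metric
begin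

text \<open>The derivative of the inner product vanishes by metric compatibility.\<close>

lemma parallel_inner:
  assumes geo: "geodesic S G x x'" and U: "parallel_along G x x' U" and W: "parallel_along G x x' W" and t: "t \<in> {0..1}"
  shows "G (x t) (U t) (W t) = G (x 0) (U 0) (W 0)"
proof -
  have "((\<lambda>t. G (x t) (U t) (W t)) has_real_derivative 0) (at t within {0..1})" if t: "t \<in> {0..1}" for t
  proof -
    note g = geodesicD[OF geo] geodesicD[OF geo t]
    have "((\<lambda>t. G (x t) (U t) (W t)) has_real_derivative
      bform1 G (x t) (x' t) (U t) (W t) + G (x t) (- \<Gamma> (x t) (x' t) (U t)) (W t) + G (x t) (U t) (- \<Gamma> (x t) (x' t) (W t)))
       (at t within {0..1})"
      using U W t unfolding parallel_along_def by (intro G_curve_derivative g(1,5)) auto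
    then show ?thesis
    proof (rule DERIV_cong)
      have "G (x t) (U t) (\<Gamma> (x t) (x' t) (W t)) = koszul G (x t) (x' t) (W t) (U t)"
        using sym_G[OF g(4)] christoffel_koszul[OF g(4)] by metis
      then show "bform1 G (x t) (x' t) (U t) (W t) + G (x t) (- \<Gamma> (x t) (x' t) (U t)) (W t) + G (x t) (U t) (- \<Gamma> (x t) (x' t) (W t)) = 0"
        using koszul_metric[OF g(4), of "x' t" "U t" "W t"] christoffel_koszul[OF g(4), of "x' t" "U t" "W t"]
        by (simp add: G_bilinear_simps[OF g(4)])
    qed
  qed
  from has_field_derivative_zero_constant[OF _ this]
  obtain k where "\<And>t. t \<in> {0..1} \<Longrightarrow> G (x t) (U t) (W t) = k" by auto
  then show ?thesis using t by simp
qed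

lemma geodesic_parallel: "geodesic S G x x' \<Longrightarrow> parallel_along G x x' x'"
  unfolding parallel_along_def using geodesicD(3) by blast

lemma parallel_continuous: "parallel_along G x x' U \<Longrightarrow> continuous_on {0..1} U"
  unfolding parallel_along_def by (intro continuous_on_vector_derivative) blast

lemma continuous_on_Rm:
  assumes "continuous_on T x" "continuous_on T a" "continuous_on T b" "x ` T \<subseteq> S"
  shows "continuous_on T (\<lambda>t. Rm G (x t) (a t) (b t))"
  unfolding Rm_def
  by (intro continuous_intros continuous_on_G continuous_on_christoffel continuous_on_bform assms) simp_all

end

context minimal_chain
begin

text \<open>The tangent vectors \<open>u i\<close> at the joints glue the pieces: the end of
  \<open>U i\<close> and the start of \<open>U (Suc i)\<close> are components of the same vector in
  two charts.\<close>

definition parallel_family :: "(nat \<Rightarrow> ('m, 'e) tvec) \<Rightarrow> (nat \<Rightarrow> real \<Rightarrow> 'e) \<Rightarrow> bool" where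
  "parallel_family u U \<longleftrightarrow> (\<forall>i\<le>m. u i \<in> tangent_space A (P i)) \<and>
     (\<forall>i<m. parallel_along (mr (c i)) (x i) (x' i) (U i) \<and> U i 0 = u i (c i) \<and> U i 1 = u (Suc i) (c i))"

lemma parallel_familyD:
  assumes "parallel_family u U"
  shows "i \<le> m \<Longrightarrow> u i \<in> tangent_space A (P i)" "i < m \<Longrightarrow> parallel_along (mr (c i)) (x i) (x' i) (U i)"
    "i < m \<Longrightarrow> U i 0 = u i (c i)" "i < m \<Longrightarrow> U i 1 = u (Suc i) (c i)"
  using assms unfolding parallel_family_def by auto

lemma parallel_family_inner:
  assumes u: "parallel_family u U" and w: "parallel_family w W"
  shows "i \<le> m \<Longrightarrow> g (P i) (u i) (w i) = g (P 0) (u 0) (w 0)"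
    "i < m \<Longrightarrow> t \<in> {0..1} \<Longrightarrow> mr (c i) (x i t) (U i t) (W i t) = g (P 0) (u 0) (w 0)"
proof -
  have const: "mr (c i) (x i t) (U i t) (W i t) = g (P i) (u i) (w i)" if i: "i < m" and t: "t \<in> {0..1}" for i t
  proof -
    note pc = piece_chart[OF i]
    have "mr (c i) (x i t) (U i t) (W i t) = mr (c i) (x i 0) (U i 0) (W i 0)"
      by (rule chart_metric.parallel_inner[OF chart_metric_mr[OF pc(1)] pc(2) parallel_familyD(2)[OF u i] parallel_familyD(2)[OF w i] t])
    also have "\<dots> = g (P i) (u i) (w i)"
      using g_eq[OF parallel_familyD(1)[OF u] parallel_familyD(1)[OF w] pc(1,4)] i pc(6)
        parallel_familyD(3)[OF u i] parallel_familyD(3)[OF w i] by simp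
    finally show ?thesis .
  qed
  show 1: "g (P i) (u i) (w i) = g (P 0) (u 0) (w 0)" if "i \<le> m" for i
    using that
  proof (induction i)
    case (Suc i)
    then have i: "i < m" "Suc i \<le> m" by auto
    note pc = piece_chart[OF i(1)]
    have "g (P (Suc i)) (u (Suc i)) (w (Suc i)) = mr (c i) (x i 1) (U i 1) (W i 1)"
      using g_eq[OF parallel_familyD(1)[OF u i(2)] parallel_familyD(1)[OF w i(2)] pc(1,5)] pc(7)
        parallel_familyD(4)[OF u i(1)] parallel_familyD(4)[OF w i(1)] by simp
    then show ?case using const[OF i(1), of 1] Suc by simp
  qed simp
  show "mr (c i) (x i t) (U i t) (W i t) = g (P 0) (u 0) (w 0)" if "i < m" "t \<in> {0..1}"
    using const[OF that] 1[of i] that by simp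
qed

lemma ex_parallel_family:
  assumes u0: "u0 \<in> tangent_space A (P 0)"
  shows "\<exists>u U. parallel_family u U \<and> u 0 = u0"
proof -
  define step where "step i w = (SOME V. parallel_along (mr (c i)) (x i) (x' i) V \<and> V 0 = w (c i))" for i and w :: "('m, 'e) tvec"
  have step: "parallel_along (mr (c i)) (x i) (x' i) (step i w) \<and> step i w 0 = w (c i)" if "i < m" for i w
  proof -
    have "\<exists>V. parallel_along (mr (c i)) (x i) (x' i) V \<and> V 0 = w (c i)"
      using piece_chart(3)[OF that] unfolding transportable_def by blast
    from someI_ex[OF this] show ?thesis unfolding step_def .
  qed
  define u where "u = rec_nat u0 (\<lambda>i w. tvec_of A (c i) (P (Suc i)) (step i w 1))"
  define U where "U i = step i (u i)" for i
  have u_simps: "u 0 = u0" "u (Suc i) = tvec_of A (c i) (P (Suc i)) (U i 1)" for i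
    by (simp_all add: u_def U_def)
  have "u i \<in> tangent_space A (P i)" if "i \<le> m" for i
  proof (cases i)
    case 0 then show ?thesis using u0 u_simps(1) by simp
  next
    case (Suc j)
    then have "j < m" using that by simp
    then show ?thesis unfolding Suc u_simps(2) by (intro tvec_of_tangent piece_chart)
  qed
  moreover have "U i 1 = u (Suc i) (c i)" if "i < m" for i
    unfolding u_simps(2) using tvec_of_self piece_chart[OF that] by simp
  ultimately have "parallel_family u U"
    unfolding parallel_family_def using step unfolding U_def by simp
  then show ?thesis using u_simps(1) by blast
qed

text \<open>The last joint has no outgoing piece, hence the special case. At inner joints
  \<open>no_corner\<close> makes incoming and outgoing velocity agree.\<close>

definition velocity :: "nat \<Rightarrow> ('m, 'e) tvec" where
  "velocity i = (if i < m then initial i else final (m - 1))"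

lemma velocity: "i < m \<Longrightarrow> velocity i = initial i" "i < m \<Longrightarrow> velocity (Suc i) = final i"
proof -
  show "i < m \<Longrightarrow> velocity i = initial i" by (simp add: velocity_def)
  assume i: "i < m"
  show "velocity (Suc i) = final i"
  proof (cases "Suc i = m")
    case True then show ?thesis by (auto simp: velocity_def)
  next
    case False
    then have "Suc i < m" using i by simp
    then show ?thesis using no_corner[of "Suc i"] by (simp add: velocity_def)
  qed
qed

text \<open>Geodesics have parallel velocity and there are no corners. In particular the speed is
  constant along the entire chain.\<close>

lemma velocity_family: "parallel_family velocity x'"
proof -
  have "velocity i \<in> tangent_space A (P i)" if "i \<le> m" for i
    using velocity_tangent(1)[of i] velocity_tangent(2)[of "m - 1"] that m_pos unfolding velocity_def by (cases "i = m") auto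
  moreover have "x' i 0 = velocity i (c i)" "x' i 1 = velocity (Suc i) (c i)" if "i < m" for i
    unfolding velocity[OF that] initial_def final_def using tvec_of_self piece_chart[OF that] by simp_all
  ultimately show ?thesis
    unfolding parallel_family_def
    using chart_metric.geodesic_parallel[OF chart_metric_mr] piece_chart by auto
qed

text \<open>A chain of zero speed would be constant, and its two ends would coincide although they
  lie in disjoint sets.\<close>

lemma velocity_nonzero: "g (P 0) (velocity 0) (velocity 0) > 0"
proof (rule ccontr)
  assume "\<not> ?thesis"
  then have neg: "g (P 0) (velocity 0) (velocity 0) \<le> 0" by simp
  have "P i = P 0" if "i \<le> m" for i
    using that
  proof (induction i)
    case (Suc i)
    then have i: "i < m" by simp
    note pc = piece_chart[OF i]
    have "x' i t = 0" if t: "t \<in> {0..1}" for t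
      using parallel_family_inner(2)[OF velocity_family velocity_family i t] neg
        chart_metric.pos_G[OF chart_metric_mr[OF pc(1)] geodesicD(1)[OF pc(2) t], of "x' i t"] by force
    then have "(x i has_derivative (\<lambda>h. 0)) (at t within {0..1})" if "t \<in> {0..1}" for t
      using geodesicD(2)[OF pc(2) that] that by (simp add: has_vector_derivative_def)
    from has_derivative_zero_constant[OF convex_real_interval(5) this]
    obtain k where "\<And>t. t \<in> {0..1} \<Longrightarrow> x i t = k" by blast
    then have "x i 0 = x i 1" by simp
    then have "P (Suc i) = P i" using ends[OF i] by simp
    then show ?case using Suc by simp
  qed simp
  from this[of m] have "P m = P 0" by blast
  then show False using P disj by auto
qed

text \<open>Parallel transport maps the tangent space of \<open>N\<^sub>1\<close> into the orthogonal complement of the velocity,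
  which contains the tangent space of \<open>N\<^sub>2\<close> as well, so these intersect for dimensional reasons.\<close>

lemma ex_tangent_parallel_family:
  assumes dims: "dim S\<^sub>1 + dim S\<^sub>2 \<ge> DIM('e)"
  shows "\<exists>u U. parallel_family u U \<and> u 0 d\<^sub>1 \<in> S\<^sub>1 \<and> u m d\<^sub>2 \<in> S\<^sub>2 \<and>
    g (P 0) (u 0) (u 0) = 1 \<and> g (P 0) (u 0) (velocity 0) = 0"
proof -
  note d1 = slice_chartD(1)[OF slice\<^sub>1(1)] slice\<^sub>1(2) and d2 = slice_chartD(1)[OF slice\<^sub>2(1)] slice\<^sub>2(2)
  note cm1 = chart_metric_mr[OF d1(1)] and cm2 = chart_metric_mr[OF d2(1)]
  let ?B1 = "mr d\<^sub>1 (coord d\<^sub>1 (P 0))" and ?B2 = "mr d\<^sub>2 (coord d\<^sub>2 (P m))"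
  have in1: "coord d\<^sub>1 (P 0) \<in> cimg d\<^sub>1" and in2: "coord d\<^sub>2 (P m) \<in> cimg d\<^sub>2" using d1 d2 by auto
  note bl1 = chart_metric.G_bilinear_simps[OF cm1 in1] and bl2 = chart_metric.G_bilinear_simps[OF cm2 in2]
  have "\<forall>a. \<exists>u. \<exists>U. parallel_family u U \<and> u 0 = tvec_of A d\<^sub>1 (P 0) a"
    using ex_parallel_family[OF tvec_of_tangent[OF d1]] by blast
  from choice[OF this] obtain u where "\<forall>a. \<exists>U. parallel_family (u a) U \<and> u a 0 = tvec_of A d\<^sub>1 (P 0) a" ..
  from choice[OF this] obtain U where fam: "\<And>a. parallel_family (u a) (U a)" and u0: "\<And>a. u a 0 = tvec_of A d\<^sub>1 (P 0) a"
    by blast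
  \<comment> \<open>Parallel transport from the first to the last joint, written in the two slice
    charts.\<close>
  define L where "L a = u a m d\<^sub>2" for a
  define \<nu> where "\<nu> = velocity m d\<^sub>2"
  have fin: "g (P m) (w m) (w' m) = ?B2 (w m d\<^sub>2) (w' m d\<^sub>2)" if "parallel_family w W" "parallel_family w' W'" for w W w' W'
    using g_eq[OF parallel_familyD(1)[OF that(1)] parallel_familyD(1)[OF that(2)] d2] by simp
  have ini: "g (P 0) (w 0) (w' 0) = ?B1 (w 0 d\<^sub>1) (w' 0 d\<^sub>1)" if "parallel_family w W" "parallel_family w' W'" for w W w' W'
    using g_eq[OF parallel_familyD(1)[OF that(1)] parallel_familyD(1)[OF that(2)] d1] by simp
  have iso: "?B2 (L a) (L b) = ?B1 a b" for a b
    using fin[OF fam[of a] fam[of b]] ini[OF fam[of a] fam[of b]] parallel_family_inner(1)[OF fam[of a] fam[of b], of m]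
    by (simp add: L_def u0 tvec_of_self[OF d1])
  have zero: "z = 0" if "?B2 z z = 0" for z
    using chart_metric.pos_G[OF cm2 in2, of z] that by force
  \<comment> \<open>The family for each \<open>a\<close> was merely chosen, so linearity is not
    immediate. It follows from the preservation of inner products: the square of each defect expands
    to 0.\<close>
  have "linear L"
  proof (rule linearI)
    fix a b
    have "?B2 (L (a + b) - L a - L b) (L (a + b) - L a - L b) = 0"
      unfolding bl2 iso bl1 by simp
    from zero[OF this] show "L (a + b) = L a + L b" by (simp add: diff_diff_eq)
  next
    fix k a
    have "?B2 (L (k *\<^sub>R a) - k *\<^sub>R L a) (L (k *\<^sub>R a) - k *\<^sub>R L a) = 0"
      unfolding bl2 iso bl1 by simp
    from zero[OF this] show "L (k *\<^sub>R a) = k *\<^sub>R L a" by simp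
  qed
  have "inj L"
    unfolding linear_injective_0[OF \<open>linear L\<close>]
  proof (intro allI impI)
    fix a assume "L a = 0"
    then have "?B1 a a = 0" using iso[of a a] bl2(9) by simp
    then show "a = 0" using chart_metric.pos_G[OF cm1 in1, of a] by force
  qed
  define W where "W = {w. ?B2 \<nu> w = 0}"
  have perp1: "g (P 0) (velocity 0) (tvec_of A d\<^sub>1 (P 0) a) = 0" if "a \<in> S\<^sub>1" for a
    using perpendicular(1)[OF submanifold_tangentI[OF slice\<^sub>1 that]] velocity(1)[OF m_pos] by simp
  have L_W: "L a \<in> W" if "a \<in> S\<^sub>1" for a
  proof -
    have "?B2 \<nu> (L a) = g (P 0) (velocity 0) (u a 0)"
      using fin[OF velocity_family fam[of a]] parallel_family_inner(1)[OF velocity_family fam[of a], of m]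
      by (simp add: \<nu>_def L_def)
    then show ?thesis using perp1[OF that] by (simp add: W_def u0)
  qed
  have S2_W: "w \<in> W" if "w \<in> S\<^sub>2" for w
  proof -
    have "g (P m) (velocity m) (tvec_of A d\<^sub>2 (P m) w) = 0"
      using perpendicular(2)[OF submanifold_tangentI[OF slice\<^sub>2 that]] by (simp add: velocity_def)
    then show ?thesis
      using g_eq[OF parallel_familyD(1)[OF velocity_family, of m] tvec_of_tangent[OF d2] d2, of w] tvec_of_self[OF d2]
      by (simp add: W_def \<nu>_def)
  qed
  have subS: "subspace S\<^sub>1" "subspace S\<^sub>2" using slice_chartD(2)[OF slice\<^sub>1(1)] slice_chartD(2)[OF slice\<^sub>2(1)] by auto
  have subL: "subspace (L ` S\<^sub>1)" by (rule linear_subspace_image[OF \<open>linear L\<close> subS(1)])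
  have "subspace W" unfolding W_def subspace_def using bl2 by simp
  have dimL: "dim (L ` S\<^sub>1) = dim S\<^sub>1"
    by (rule dim_image_eq[OF \<open>linear L\<close>]) (rule inj_on_subset[OF \<open>inj L\<close> subset_UNIV])
  \<comment> \<open>Otherwise the sum of the two subspaces of \<open>W\<close> would have full
    dimension, and the velocity would be orthogonal to itself.\<close>
  have "\<exists>w. w \<in> L ` S\<^sub>1 \<and> w \<in> S\<^sub>2 \<and> w \<noteq> 0"
  proof (rule ccontr)
    assume "\<not> ?thesis"
    then have "L ` S\<^sub>1 \<inter> S\<^sub>2 \<subseteq> {0}" by blast
    then have dim0: "dim (L ` S\<^sub>1 \<inter> S\<^sub>2) = 0" by (simp only: dim_eq_0)
    have eqd: "dim {a + b |a b. a \<in> L ` S\<^sub>1 \<and> b \<in> S\<^sub>2} = dim S\<^sub>1 + dim S\<^sub>2"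
      using dim_sums_Int[OF subL subS(2)] unfolding dimL dim0 by simp
    have subW: "{a + b |a b. a \<in> L ` S\<^sub>1 \<and> b \<in> S\<^sub>2} \<subseteq> W"
      using L_W S2_W subspace_add[OF \<open>subspace W\<close>] by blast
    have "dim W \<ge> DIM('e)" using dim_subset[OF subW] eqd dims by linarith
    then have "dim W = DIM('e)" using dim_subset_UNIV[of W] by simp
    then have "W = UNIV" using dim_eq_full[of W] span_eq_iff[of W] \<open>subspace W\<close> by simp
    then have "?B2 \<nu> \<nu> = 0" unfolding W_def by blast
    then show False
      using fin[OF velocity_family velocity_family] parallel_family_inner(1)[OF velocity_family velocity_family, of m] velocity_nonzero
      by (simp add: \<nu>_def)
  qed
  then obtain a where a: "a \<in> S\<^sub>1" "L a \<in> S\<^sub>2" "L a \<noteq> 0" by blast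
  have "a \<noteq> 0" using a(3) linear_0[OF \<open>linear L\<close>] by auto
  define k where "k = 1 / sqrt (?B1 a a)"
  have B1: "?B1 a a > 0" by (rule chart_metric.pos_G[OF cm1 in1 \<open>a \<noteq> 0\<close>])
  define b where "b = k *\<^sub>R a"
  have "?B1 b b = 1" unfolding b_def bl1 k_def using B1 by simp
  moreover have b1: "b \<in> S\<^sub>1" unfolding b_def by (rule subspace_scale[OF subS(1) a(1)])
  moreover have "L b \<in> S\<^sub>2" unfolding b_def linear_scale[OF \<open>linear L\<close>] by (rule subspace_scale[OF subS(2) a(2)])
  ultimately show ?thesis
    using fam[of b] u0[of b] tvec_of_self[OF d1, of b] ini[OF fam[of b] fam[of b]] perp1[OF b1]
      metric_facts(1)[OF tvec_of_tangent[OF d1, of b] parallel_familyD(1)[OF velocity_family, of 0]]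
    by (intro exI[of _ "u b"] exI[of _ "U b"]) (simp add: L_def)
qed

text \<open>The core shared by both curvature cases. The integrand along \<open>\<phi> U\<close> is
  strictly dominated by derivatives \<open>K' i\<close> whose primitives fit together at the joints,
  with values \<kappa>, and vanish at both ends; so the second variation would be negative.
  \<open>F\<close> holds the values of \<phi> at the joints.\<close>

lemma no_negative_variation:
  assumes fam: "parallel_family u U" and u: "u 0 d\<^sub>1 \<in> S\<^sub>1" "u m d\<^sub>2 \<in> S\<^sub>2"
    and \<phi>: "\<And>i t. i < m \<Longrightarrow> t \<in> {0..1} \<Longrightarrow> (\<phi> i has_real_derivative \<phi>' i t) (at t within {0..1})"
      "\<And>i. i < m \<Longrightarrow> continuous_on {0..1} (\<phi>' i)" "\<And>i. i < m \<Longrightarrow> \<phi> i 0 = F i" "\<And>i. i < m \<Longrightarrow> \<phi> i 1 = F (Suc i)"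
    and K: "\<And>i t. i < m \<Longrightarrow> t \<in> {0..1} \<Longrightarrow> (K i has_real_derivative K' i t) (at t within {0..1})"
      "\<And>i. i < m \<Longrightarrow> continuous_on {0..1} (K' i)" "\<And>i. i < m \<Longrightarrow> K i 0 = \<kappa> i" "\<And>i. i < m \<Longrightarrow> K i 1 = \<kappa> (Suc i)" "\<kappa> 0 = 0" "\<kappa> m = 0"
    and neg: "\<And>i t. i < m \<Longrightarrow> t \<in> {0..1} \<Longrightarrow>
      (\<phi>' i t)\<^sup>2 * mr (c i) (x i t) (U i t) (U i t) - (\<phi> i t)\<^sup>2 * Rm (mr (c i)) (x i t) (U i t) (x' i t) < K' i t"
  shows False
proof -
  define V where "V i t = \<phi> i t *\<^sub>R U i t" for i t
  define V' where "V' i t = \<phi>' i t *\<^sub>R U i t - \<phi> i t *\<^sub>R christoffel (mr (c i)) (x i t) (x' i t) (U i t)" for i t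
  define v where "v i = (\<lambda>d. F i *\<^sub>R u i d)" for i
  have dU: "(U i has_vector_derivative - christoffel (mr (c i)) (x i t) (x' i t) (U i t)) (at t within {0..1})"
    if "i < m" "t \<in> {0..1}" for i t
    using parallel_familyD(2)[OF fam that(1)] that(2) unfolding parallel_along_def by blast
  have cU: "continuous_on {0..1} (U i)" if "i < m" for i
    by (rule chart_metric.parallel_continuous[OF chart_metric_mr[OF piece_chart(1)[OF that]] parallel_familyD(2)[OF fam that]])
  have c\<phi>: "continuous_on {0..1} (\<phi> i)" if "i < m" for i
    using \<phi>(1)[OF that] DERIV_continuous_on by blast
  note gc = geodesic_continuous[OF piece_chart(2)]
  have c\<Gamma>: "continuous_on {0..1} (\<lambda>t. christoffel (mr (c i)) (x i t) (x' i t) (U i t))" if "i < m" for i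
    by (rule chart_metric.continuous_on_christoffel[OF chart_metric_mr[OF piece_chart(1)[OF that]] gc(1,2)[OF that] cU[OF that] gc(3)[OF that]])
  have dV: "(V i has_vector_derivative V' i t) (at t within {0..1})" if "i < m" "t \<in> {0..1}" for i t
    using has_vector_derivative_scaleR[OF \<phi>(1)[OF that] dU[OF that]] unfolding V_def V'_def by (simp add: algebra_simps)
  have cV': "continuous_on {0..1} (V' i)" if "i < m" for i
    unfolding V'_def by (intro continuous_intros \<phi>(2) c\<phi> cU c\<Gamma> that)
  \<comment> \<open>The boundary terms of the pieces, written with \<open>velocity\<close> so that
    they telescope; the outer two vanish since there the acceleration is tangent to the submanifold
    and the velocity normal to it.\<close>
  define q where "q i = g (P i) (velocity i) (line_acceleration (bchart i) (P i) (v i))" for i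
  have var: "(\<Sum>i<m. integral {0..1} (second_variation_integrand (c i) (x i) (x' i) (V i) (V' i))
      + (g (P (Suc i)) (final i) (line_acceleration (bchart (Suc i)) (P (Suc i)) (v (Suc i)))
        - g (P i) (initial i) (line_acceleration (bchart i) (P i) (v i)))) \<ge> 0"
  proof (rule chain_variation(2)[OF bchart(1) _ bchart(2) _ bchart(3) _ dV cV'])
    show "v i \<in> tangent_space A (P i)" if "i \<le> m" for i
      unfolding v_def by (rule tangent_scale[OF parallel_familyD(1)[OF fam that]])
    show "v 0 d\<^sub>1 \<in> S\<^sub>1" "v m d\<^sub>2 \<in> S\<^sub>2"
      unfolding v_def using u slice_chartD(2)[OF slice\<^sub>1(1)] slice_chartD(2)[OF slice\<^sub>2(1)] by (auto intro: subspace_scale)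
    show "V i 0 = v i (c i)" "V i 1 = v (Suc i) (c i)" if "i < m" for i
      unfolding V_def v_def using \<phi>(3,4)[OF that] parallel_familyD(3,4)[OF fam that] by simp_all
  qed
  have "(\<Sum>i<m. integral {0..1} (second_variation_integrand (c i) (x i) (x' i) (V i) (V' i)) + (q (Suc i) - q i)) \<ge> 0"
    using var unfolding q_def by (simp add: velocity)
  moreover have "(\<Sum>i<m. q (Suc i) - q i) = q m - q 0" by (rule sum_lessThan_telescope)
  moreover have "q 0 = 0"
  proof -
    have "v 0 d\<^sub>1 \<in> S\<^sub>1" unfolding v_def using u(1) slice_chartD(2)[OF slice\<^sub>1(1)] by (auto intro: subspace_scale)
    from perpendicular(1)[OF totally_geodesic_slice[OF tg(1) P(1) slice\<^sub>1 this]]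
    show ?thesis by (simp add: q_def velocity(1)[OF m_pos] bchart(2) line_acceleration_def)
  qed
  moreover have "q m = 0"
  proof -
    have "v m d\<^sub>2 \<in> S\<^sub>2" unfolding v_def using u(2) slice_chartD(2)[OF slice\<^sub>2(1)] by (auto intro: subspace_scale)
    from perpendicular(2)[OF totally_geodesic_slice[OF tg(2) P(2) slice\<^sub>2 this]]
    show ?thesis by (simp add: q_def velocity_def bchart(3) line_acceleration_def)
  qed
  ultimately have nonneg: "(\<Sum>i<m. integral {0..1} (second_variation_integrand (c i) (x i) (x' i) (V i) (V' i))) \<ge> 0"
    by (simp add: sum.distrib)
  have "integral {0..1} (second_variation_integrand (c i) (x i) (x' i) (V i) (V' i)) < \<kappa> (Suc i) - \<kappa> i" if i: "i < m" for i
  proof -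
    note pc = piece_chart[OF i] and cm = chart_metric_mr[OF piece_chart(1)[OF i]]
    define J where "J t = (\<phi>' i t)\<^sup>2 * mr (c i) (x i t) (U i t) (U i t) - (\<phi> i t)\<^sup>2 * Rm (mr (c i)) (x i t) (U i t) (x' i t)" for t
    have eq: "second_variation_integrand (c i) (x i) (x' i) (V i) (V' i) t = J t" if t: "t \<in> {0..1}" for t
    proof -
      note xS = geodesicD(1)[OF pc(2) t]
      have "V' i t + christoffel (mr (c i)) (x i t) (x' i t) (V i t) = \<phi>' i t *\<^sub>R U i t"
        unfolding V_def V'_def chart_metric.christoffel_bilinear_simps[OF cm xS] by simp
      then show ?thesis
        unfolding second_variation_integrand_def J_def
        using chart_metric.Rm_scale[OF cm xS, of "\<phi> i t" "U i t" 1 "x' i t"]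
        by (simp add: V_def chart_metric.G_bilinear_simps[OF cm xS] power2_eq_square)
    qed
    have cJ: "continuous_on {0..1} J"
      unfolding J_def
      by (intro continuous_intros \<phi>(2)[OF i] c\<phi>[OF i] cU[OF i] gc[OF i]
          chart_metric.continuous_on_G[OF cm] chart_metric.continuous_on_Rm[OF cm])
    have "integral {0..1} (second_variation_integrand (c i) (x i) (x' i) (V i) (V' i)) = integral {0..1} J"
      by (rule integral_cong[OF eq])
    also have "\<dots> < integral {0..1} (K' i)"
      by (rule integral_less_real[OF cJ K(2)[OF i]]) (use neg[OF i] in \<open>auto simp: J_def\<close>)
    also have "integral {0..1} (K' i) = K i 1 - K i 0"
      by (intro integral_unique fundamental_theorem_of_calculus)
        (use K(1)[OF i] in \<open>auto simp: has_real_derivative_iff_has_vector_derivative\<close>)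
    finally show ?thesis using K(3,4)[OF i] by simp
  qed
  then have "(\<Sum>i<m. integral {0..1} (second_variation_integrand (c i) (x i) (x' i) (V i) (V' i))) < (\<Sum>i<m. \<kappa> (Suc i) - \<kappa> i)"
    using m_pos by (intro sum_strict_mono) auto
  then show False using nonneg K(5,6) by (simp add: sum_lessThan_telescope)
qed

end

section \<open>Positive weighted sectional curvature\<close>

context minimal_chain
begin

text \<open>The parallel velocity has constant length \<open>l\<close>, so dividing by
  \<open>l\<close> gives a unit vector, normal to \<open>U\<close>; \<open>Rm\<close> is quadratic
  in it, hence the denominator \<open>l\<^sup>2\<close>.\<close>

lemma sectional_curvature_along:
  assumes fam: "parallel_family u U" "g (P 0) (u 0) (u 0) = 1" "g (P 0) (u 0) (velocity 0) = 0"
    and i: "i < m" and t: "t \<in> {0..1}"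
  defines "l \<equiv> sqrt (g (P 0) (velocity 0) (velocity 0))" and "p \<equiv> param (c i) (x i t)"
  shows "orthonormal_pair A g p (tvec_of A (c i) p (U i t)) (tvec_of A (c i) p ((1 / l) *\<^sub>R x' i t))"
    "sectional_curvature A g p (tvec_of A (c i) p (U i t)) (tvec_of A (c i) p ((1 / l) *\<^sub>R x' i t))
      = Rm (mr (c i)) (x i t) (U i t) (x' i t) / l\<^sup>2"
    "l > 0" "p \<in> cdom (c i)" "coord (c i) p = x i t"
proof -
  note pc = piece_chart[OF i] and xS = geodesicD(1)[OF piece_chart(2)[OF i] t]
  note cm = chart_metric_mr[OF pc(1)]
  show l: "l > 0" using velocity_nonzero by (simp add: l_def)
  show p: "p \<in> cdom (c i)" "coord (c i) p = x i t"
    using chart_facts(6,7)[OF pc(1) xS] by (auto simp: p_def)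
  have ge: "g p (tvec_of A (c i) p a) (tvec_of A (c i) p b) = mr (c i) (x i t) a b" for a b
    using g_eq[OF tvec_of_tangent tvec_of_tangent, OF pc(1) p(1) pc(1) p(1) pc(1) p(1)] p(2) tvec_of_self[OF pc(1) p(1)] by simp
  have "mr (c i) (x i t) (U i t) (U i t) = 1" "mr (c i) (x i t) (U i t) (x' i t) = 0" "mr (c i) (x i t) (x' i t) (x' i t) = l\<^sup>2"
    using parallel_family_inner(2)[OF fam(1) fam(1) i t] parallel_family_inner(2)[OF fam(1) velocity_family i t]
      parallel_family_inner(2)[OF velocity_family velocity_family i t] fam(2,3) velocity_nonzero
    by (auto simp: l_def)
  then show on: "orthonormal_pair A g p (tvec_of A (c i) p (U i t)) (tvec_of A (c i) p ((1 / l) *\<^sub>R x' i t))"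
    unfolding orthonormal_pair_def ge chart_metric.G_bilinear_simps[OF cm xS]
    using l tvec_of_tangent[OF pc(1) p(1)] by (simp add: power2_eq_square)
  show "sectional_curvature A g p (tvec_of A (c i) p (U i t)) (tvec_of A (c i) p ((1 / l) *\<^sub>R x' i t))
      = Rm (mr (c i)) (x i t) (U i t) (x' i t) / l\<^sup>2"
    unfolding sectional_curvature_chart[OF on pc(1) p(1)] tvec_of_self[OF pc(1) p(1)] p(2)
    using chart_metric.Rm_scale[OF cm xS, of 1 "U i t" "1 / l" "x' i t"] by (simp add: power_divide)
qed

lemma velocity_components: "i < m \<Longrightarrow> velocity i (c i) = x' i 0" "i < m \<Longrightarrow> velocity (Suc i) (c i) = x' i 1"
  using parallel_familyD(3,4)[OF velocity_family] by auto

text \<open>With \<phi> = 1 the comparison function \<open>K\<close> is the inner product of the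
  velocity with \<open>X\<close>; it vanishes at both ends because there \<open>X\<close> is tangent
  and the velocity normal.\<close>

lemma not_positive_weighted_sec:
  assumes X: "smooth_vector_field_on A UNIV X" and tangent: "tangent_on A N\<^sub>1 X" "tangent_on A N\<^sub>2 X"
    and dims: "dim S\<^sub>1 + dim S\<^sub>2 \<ge> DIM('e)"
    and pos: "\<And>p U V. orthonormal_pair A g p U V \<Longrightarrow> weighted_sec A g X p V U > 0"
  shows False
proof -
  obtain u U where fam: "parallel_family u U" "u 0 d\<^sub>1 \<in> S\<^sub>1" "u m d\<^sub>2 \<in> S\<^sub>2"
    "g (P 0) (u 0) (u 0) = 1" "g (P 0) (u 0) (velocity 0) = 0"
    using ex_tangent_parallel_family[OF dims] by blast
  define Z where "Z i = field_rep X (c i)" for i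
  define K where "K i t = mr (c i) (x i t) (x' i t) (Z i (x i t))" for i t
  define K' where "K' i t = bform1 (mr (c i)) (x i t) (Z i (x i t)) (x' i t) (x' i t) / 2
    + mr (c i) (x i t) (dB (Z i) (x i t) (x' i t)) (x' i t)" for i t
  define \<kappa> where "\<kappa> i = g (P i) (velocity i) (X (P i))" for i
  have XT: "X p \<in> tangent_space A p" for p using X unfolding smooth_vector_field_on_def by blast
  have Zs: "smooth_on (cimg (c i)) (Z i)" if "i < m" for i
    unfolding Z_def by (rule field_rep_smooth[OF X piece_chart(1)[OF that]])
  show False
  proof (rule no_negative_variation[OF fam(1-3), where \<phi> = "\<lambda>_ _. 1" and \<phi>' = "\<lambda>_ _. 0" and F = "\<lambda>_. 1" and K = K and K' = K' and \<kappa> = \<kappa>])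
    fix i t assume i: "i < m" and t: "t \<in> {0..1::real}"
    note pc = piece_chart[OF i] and g' = geodesicD[OF piece_chart(2)[OF i] t]
    note cm = chart_metric_mr[OF pc(1)]
    have dZ: "((\<lambda>t. Z i (x i t)) has_vector_derivative dB (Z i) (x i t) (x' i t)) (at t within {0..1})"
      by (rule has_vector_derivative_compose[OF g'(2) smooth_on_has_derivative[OF Zs[OF i] g'(1)]])
    show "(K i has_real_derivative K' i t) (at t within {0..1})"
      unfolding K_def
    proof (rule DERIV_cong[OF chart_metric.G_curve_derivative[OF cm t geodesicD(1)[OF pc(2)] g'(2,3) dZ]])
      \<comment> \<open>By the Koszul formula the geodesic acceleration cancels the derivative of
        the metric along the curve and leaves half of its derivative in direction \<open>X\<close>;
        with the last term this is half the Lie derivative on the velocity.\<close>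
      show "bform1 (mr (c i)) (x i t) (x' i t) (x' i t) (Z i (x i t))
         + mr (c i) (x i t) (- christoffel (mr (c i)) (x i t) (x' i t) (x' i t)) (Z i (x i t))
         + mr (c i) (x i t) (x' i t) (dB (Z i) (x i t) (x' i t)) = K' i t"
        unfolding K'_def chart_metric.G_bilinear_simps[OF cm g'(1)] chart_metric.christoffel_koszul[OF cm g'(1)] koszul_def
          chart_metric.sym_G[OF cm g'(1), of "x' i t"]
        by (simp add: field_simps)
    qed
    define l where "l = sqrt (g (P 0) (velocity 0) (velocity 0))"
    define p where "p = param (c i) (x i t)"
    define v where "v = tvec_of A (c i) p ((1 / l) *\<^sub>R x' i t)"
    note s = sectional_curvature_along[OF fam(1,4,5) i t, folded l_def, folded p_def, folded v_def]
    have "lie_derivative_metric A g X p v v = 2 * K' i t / l\<^sup>2"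
      unfolding lie_derivative_chart[OF X tvec_of_tangent[OF pc(1) s(4)] pc(1) s(4), of "(1 / l) *\<^sub>R x' i t", folded v_def] s(5)
      unfolding v_def tvec_of_self[OF pc(1) s(4)] Z_def[symmetric] K'_def
      using s(3) by (simp add: blinfun.bilinear_simps chart_metric.G_bilinear_simps[OF cm g'(1)] power2_eq_square field_simps)
    then have "weighted_sec A g X p v (tvec_of A (c i) p (U i t)) = (Rm (mr (c i)) (x i t) (U i t) (x' i t) + K' i t) / l\<^sup>2"
      unfolding weighted_sec_def s(2) by (simp add: add_divide_distrib)
    then have "Rm (mr (c i)) (x i t) (U i t) (x' i t) + K' i t > 0"
      using pos[OF s(1)] s(3) by (simp add: zero_less_divide_iff)
    then show "0\<^sup>2 * mr (c i) (x i t) (U i t) (U i t) - 1\<^sup>2 * Rm (mr (c i)) (x i t) (U i t) (x' i t) < K' i t" by simp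
  next
    fix i assume i: "i < m"
    note pc = piece_chart[OF i] and gc = geodesic_continuous[OF piece_chart(2)[OF i]]
    note cm = chart_metric_mr[OF pc(1)]
    have cZ: "continuous_on {0..1} (\<lambda>t. Z i (x i t))"
      by (rule continuous_on_compose2[OF smooth_on_continuous[OF Zs[OF i]] gc(1,3)])
    have cdZ: "continuous_on {0..1} (\<lambda>t. dB (Z i) (x i t))"
      by (rule continuous_on_compose2[OF smooth_on_continuous[OF smooth_on_dB[OF chart_facts(2)[OF pc(1)] Zs[OF i]]] gc(1,3)])
    show "continuous_on {0..1} (K' i)"
      unfolding K'_def
      by (intro continuous_intros chart_metric.continuous_on_G[OF cm] chart_metric.continuous_on_bform[OF cm] gc cZ cdZ) simp
    show "K i 0 = \<kappa> i"
      using g_eq[OF parallel_familyD(1)[OF velocity_family] XT pc(1,4)] i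
      by (simp add: K_def \<kappa>_def Z_def field_rep_def pc(6) velocity_components ends)
    show "K i 1 = \<kappa> (Suc i)"
      using g_eq[OF parallel_familyD(1)[OF velocity_family] XT pc(1,5)] i
      by (simp add: K_def \<kappa>_def Z_def field_rep_def pc(7) velocity_components ends)
  next
    show "\<kappa> 0 = 0" using perpendicular(1) tangent(1) P(1) velocity(1)[OF m_pos] unfolding \<kappa>_def tangent_on_def by simp
    show "\<kappa> m = 0" using perpendicular(2) tangent(2) P(2) unfolding \<kappa>_def tangent_on_def velocity_def by simp
  qed auto
qed

text \<open>\<open>K\<close> is e^(2f) times the derivative \<delta> of \<open>f\<close> along the
  chain. Since \<open>X\<close> is the gradient, \<delta> is at the joints the inner product of the
  velocity with \<open>X\<close>, so \<open>K\<close> vanishes at both ends.\<close>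

lemma not_positive_strongly_weighted_sec:
  assumes X: "tangent_on A N\<^sub>1 X" "tangent_on A N\<^sub>2 X"
    and f: "smooth_function A f" and grad: "is_gradient A g f X"
    and dims: "dim S\<^sub>1 + dim S\<^sub>2 \<ge> DIM('e)"
    and pos: "\<And>p U V. orthonormal_pair A g p U V \<Longrightarrow> strongly_weighted_sec A g f p V U > 0"
  shows False
proof -
  obtain u U where fam: "parallel_family u U" "u 0 d\<^sub>1 \<in> S\<^sub>1" "u m d\<^sub>2 \<in> S\<^sub>2"
    "g (P 0) (u 0) (u 0) = 1" "g (P 0) (u 0) (velocity 0) = 0"
    using ex_tangent_parallel_family[OF dims] by blast
  define F where "F i = frep f (c i)" for i
  define \<delta> where "\<delta> i t = dB (F i) (x i t) (x' i t)" for i t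
  \<comment> \<open>Along a geodesic the second derivative of \<open>f\<close> is its Hessian on the
    velocity; the Christoffel term is the geodesic acceleration.\<close>
  define \<delta>' where "\<delta>' i t = dB (dB (F i)) (x i t) (x' i t) (x' i t)
     - dB (F i) (x i t) (christoffel (mr (c i)) (x i t) (x' i t) (x' i t))" for i t
  define \<phi> where "\<phi> i t = exp (F i (x i t))" for i t
  define \<phi>' where "\<phi>' i t = exp (F i (x i t)) * \<delta> i t" for i t
  define K where "K i t = (\<phi> i t)\<^sup>2 * \<delta> i t" for i t
  define K' where "K' i t = 2 * \<phi> i t * \<phi>' i t * \<delta> i t + (\<phi> i t)\<^sup>2 * \<delta>' i t" for i t
  define \<kappa> where "\<kappa> i = (exp (f (P i)))\<^sup>2 * g (P i) (velocity i) (X (P i))" for i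
  have XT: "X p \<in> tangent_space A p" for p using grad unfolding is_gradient_def by blast
  have Fs: "smooth_on (cimg (c i)) (F i)" if "i < m" for i
    unfolding F_def by (rule frep_smooth[OF f piece_chart(1)[OF that]])
  have df: "g p w (X p) = dB (frep f d) (coord d p) (w d)" if "w \<in> tangent_space A p" "d \<in> A" "p \<in> cdom d" for p w d
    using grad that differential_chart[OF f that] metric_facts(1)[OF XT that(1)] unfolding is_gradient_def by metis
  show False
  proof (rule no_negative_variation[OF fam(1-3), where \<phi> = \<phi> and \<phi>' = \<phi>' and F = "\<lambda>i. exp (f (P i))" and K = K and K' = K' and \<kappa> = \<kappa>])
    fix i t assume i: "i < m" and t: "t \<in> {0..1::real}"
    note pc = piece_chart[OF i] and g' = geodesicD[OF piece_chart(2)[OF i] t]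
    note cm = chart_metric_mr[OF pc(1)]
    have "((\<lambda>t. F i (x i t)) has_vector_derivative \<delta> i t) (at t within {0..1})"
      unfolding \<delta>_def by (rule has_vector_derivative_compose[OF g'(2) smooth_on_has_derivative[OF Fs[OF i] g'(1)]])
    then have dF: "((\<lambda>t. F i (x i t)) has_real_derivative \<delta> i t) (at t within {0..1})"
      by (simp add: has_real_derivative_iff_has_vector_derivative)
    have "((\<lambda>t. dB (F i) (x i t)) has_vector_derivative dB (dB (F i)) (x i t) (x' i t)) (at t within {0..1})"
      by (rule has_vector_derivative_compose[OF g'(2) smooth_on_has_derivative[OF smooth_on_dB[OF chart_facts(2)[OF pc(1)] Fs[OF i]] g'(1)]])
    from has_vector_derivative_blinfun_apply[OF this g'(3)]
    have d\<delta>: "(\<delta> i has_real_derivative \<delta>' i t) (at t within {0..1})"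
      unfolding has_real_derivative_iff_has_vector_derivative \<delta>_def \<delta>'_def by (simp add: blinfun.bilinear_simps)
    show d\<phi>: "(\<phi> i has_real_derivative \<phi>' i t) (at t within {0..1})"
      unfolding \<phi>_def \<phi>'_def using dF by (auto intro!: derivative_eq_intros)
    show "(K i has_real_derivative K' i t) (at t within {0..1})"
      unfolding K_def K'_def using d\<phi> d\<delta> by (auto intro!: derivative_eq_intros simp: power2_eq_square algebra_simps)
    define l where "l = sqrt (g (P 0) (velocity 0) (velocity 0))"
    define p where "p = param (c i) (x i t)"
    define v where "v = tvec_of A (c i) p ((1 / l) *\<^sub>R x' i t)"
    note s = sectional_curvature_along[OF fam(1,4,5) i t, folded l_def, folded p_def, folded v_def]
    have vT: "v \<in> tangent_space A p" unfolding v_def by (rule tvec_of_tangent[OF pc(1) s(4)])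
    have vc: "v (c i) = (1 / l) *\<^sub>R x' i t" unfolding v_def by (rule tvec_of_self[OF pc(1) s(4)])
    have "hessian A g f p v v = \<delta>' i t / l\<^sup>2"
      unfolding hessian_chart[OF f vT pc(1) s(4)] s(5) vc F_def[symmetric] \<delta>'_def
      by (simp add: blinfun.bilinear_simps chart_metric.christoffel_bilinear_simps[OF cm g'(1)] power2_eq_square diff_divide_distrib)
    moreover have "differential A f p v = \<delta> i t / l"
      unfolding differential_chart[OF f vT pc(1) s(4)] s(5) vc F_def[symmetric] \<delta>_def by (simp add: blinfun.bilinear_simps)
    ultimately have "strongly_weighted_sec A g f p v (tvec_of A (c i) p (U i t))
       = (Rm (mr (c i)) (x i t) (U i t) (x' i t) + \<delta>' i t + (\<delta> i t)\<^sup>2) / l\<^sup>2"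
      unfolding strongly_weighted_sec_def s(2) by (simp add: add_divide_distrib power_divide)
    then have "Rm (mr (c i)) (x i t) (U i t) (x' i t) + \<delta>' i t + (\<delta> i t)\<^sup>2 > 0"
      using pos[OF s(1)] s(3) by (simp add: zero_less_divide_iff)
    \<comment> \<open>Since \<phi>' = \<phi> \<delta>, the required inequality is this positivity
      multiplied by the square of \<phi>, once \<open>U\<close> has unit length.\<close>
    then have "0 < (\<phi> i t)\<^sup>2 * (Rm (mr (c i)) (x i t) (U i t) (x' i t) + \<delta>' i t + (\<delta> i t)\<^sup>2)"
      by (simp add: \<phi>_def)
    moreover have "mr (c i) (x i t) (U i t) (U i t) = 1"
      using parallel_family_inner(2)[OF fam(1) fam(1) i t] fam(4) by simp
    ultimately show "(\<phi>' i t)\<^sup>2 * mr (c i) (x i t) (U i t) (U i t) - (\<phi> i t)\<^sup>2 * Rm (mr (c i)) (x i t) (U i t) (x' i t) < K' i t"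
      unfolding K'_def \<phi>'_def \<phi>_def[symmetric] by (simp add: power2_eq_square algebra_simps)
  next
    fix i assume i: "i < m"
    note pc = piece_chart[OF i] and gc = geodesic_continuous[OF piece_chart(2)[OF i]]
    note cm = chart_metric_mr[OF pc(1)] and op = chart_facts(2)[OF piece_chart(1)[OF i]]
    have cF: "continuous_on {0..1} (\<lambda>t. F i (x i t))"
      by (rule continuous_on_compose2[OF smooth_on_continuous[OF Fs[OF i]] gc(1,3)])
    have cdF: "continuous_on {0..1} (\<lambda>t. dB (F i) (x i t))"
      by (rule continuous_on_compose2[OF smooth_on_continuous[OF smooth_on_dB[OF op Fs[OF i]]] gc(1,3)])
    have cddF: "continuous_on {0..1} (\<lambda>t. dB (dB (F i)) (x i t))"
      by (rule continuous_on_compose2[OF smooth_on_continuous[OF smooth_on_dB[OF op smooth_on_dB[OF op Fs[OF i]]]] gc(1,3)])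
    have c\<delta>: "continuous_on {0..1} (\<delta> i)" unfolding \<delta>_def by (intro continuous_intros cdF gc)
    have c\<phi>: "continuous_on {0..1} (\<phi> i)" unfolding \<phi>_def by (intro continuous_intros cF)
    show c\<phi>': "continuous_on {0..1} (\<phi>' i)" unfolding \<phi>'_def by (intro continuous_intros cF c\<delta>)
    have c\<delta>': "continuous_on {0..1} (\<delta>' i)" unfolding \<delta>'_def
      by (intro continuous_intros cdF cddF gc chart_metric.continuous_on_christoffel[OF cm])
    show "continuous_on {0..1} (K' i)" unfolding K'_def by (intro continuous_intros c\<phi> c\<phi>' c\<delta> c\<delta>')
    show \<phi>01: "\<phi> i 0 = exp (f (P i))" "\<phi> i 1 = exp (f (P (Suc i)))"
      by (simp_all add: \<phi>_def F_def frep_def ends[OF i])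
    show "K i 0 = \<kappa> i"
      using df[OF parallel_familyD(1)[OF velocity_family] pc(1,4)] i
      by (simp add: K_def \<kappa>_def \<phi>01 \<delta>_def F_def pc(6) velocity_components)
    show "K i 1 = \<kappa> (Suc i)"
      using df[OF parallel_familyD(1)[OF velocity_family] pc(1,5)] i
      by (simp add: K_def \<kappa>_def \<phi>01 \<delta>_def F_def pc(7) velocity_components)
  next
    show "\<kappa> 0 = 0" using perpendicular(1) X(1) P(1) velocity(1)[OF m_pos] unfolding \<kappa>_def tangent_on_def by simp
    show "\<kappa> m = 0" using perpendicular(2) X(2) P(2) unfolding \<kappa>_def tangent_on_def velocity_def by simp
  qed
qed

end

theorem theorem6p1:
  fixes A :: "('m::{t2_space,second_countable_topology}, 'e::euclidean_space) chart set"
    and g :: "'m \<Rightarrow> ('m, 'e) tvec \<Rightarrow> ('m, 'e) tvec \<Rightarrow> real"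
    and X :: "'m \<Rightarrow> ('m, 'e) tvec"
    and N\<^sub>1 N\<^sub>2 :: "'m set"
    and k\<^sub>1 k\<^sub>2 :: nat
  assumes "smooth_structure A"
    and "connected (UNIV :: 'm set)"
    and "compact (UNIV :: 'm set)"
    and "riemannian_metric A g"
    and "smooth_vector_field_on A UNIV X"
    and "positive_weighted_sectional_curvature A g X"
    and "closed_submanifold A N\<^sub>1 k\<^sub>1"
    and "closed_submanifold A N\<^sub>2 k\<^sub>2"
    and "totally_geodesic A g N\<^sub>1"
    and "totally_geodesic A g N\<^sub>2"
    and "tangent_on A N\<^sub>1 X"
    and "tangent_on A N\<^sub>2 X"
    and "k\<^sub>1 + k\<^sub>2 \<ge> DIM('e)"
  shows "N\<^sub>1 \<inter> N\<^sub>2 \<noteq> {}"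
proof
  assume disj: "N\<^sub>1 \<inter> N\<^sub>2 = {}"
  interpret riemannian A g by unfold_locales (rule assms(1,4))+
  have N: "compact N\<^sub>1" "N\<^sub>1 \<noteq> {}" "compact N\<^sub>2" "N\<^sub>2 \<noteq> {}"
    using assms(7,8) unfolding closed_submanifold_def by auto
  from ex_minimal_chain[OF assms(3,2) N] obtain m P c x x' where
    P: "P 0 \<in> N\<^sub>1" "P m \<in> N\<^sub>2" and
    pieces: "\<And>i. i < m \<Longrightarrow> geodesic_piece (c i) (x i) (x' i) \<and> param (c i) (x i 0) = P i \<and> param (c i) (x i 1) = P (Suc i)" and
    min: "\<And>P' E'. P' 0 \<in> N\<^sub>1 \<Longrightarrow> P' m \<in> N\<^sub>2 \<Longrightarrow> (\<forall>i<m. joins (P' i) (P' (Suc i)) (E' i)) \<Longrightarrow>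
        (\<Sum>i<m. energy (mr (c i)) (x i) (x' i)) \<le> (\<Sum>i<m. E' i)"
    by blast
  \<comment> \<open>The slice charts are taken at the two ends found by minimisation; their slices
    have dimensions \<open>k\<^sub>1\<close> and \<open>k\<^sub>2\<close>, which enter the dimension
    count.\<close>
  obtain d\<^sub>1 S\<^sub>1 where 1: "slice_chart A N\<^sub>1 d\<^sub>1 S\<^sub>1" "dim S\<^sub>1 = k\<^sub>1" "P 0 \<in> cdom d\<^sub>1"
    using assms(7) P(1) unfolding closed_submanifold_def by blast
  obtain d\<^sub>2 S\<^sub>2 where 2: "slice_chart A N\<^sub>2 d\<^sub>2 S\<^sub>2" "dim S\<^sub>2 = k\<^sub>2" "P m \<in> cdom d\<^sub>2"
    using assms(8) P(2) unfolding closed_submanifold_def by blast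
  interpret minimal_chain A g N\<^sub>1 N\<^sub>2 m P c x x' d\<^sub>1 d\<^sub>2 S\<^sub>1 S\<^sub>2
    by unfold_locales (use 1 2 assms(9,10) disj P pieces min in blast)+
  have dims: "dim S\<^sub>1 + dim S\<^sub>2 \<ge> DIM('e)" using assms(13) 1(2) 2(2) by simp
  from assms(6) show False
    unfolding positive_weighted_sectional_curvature_def
    using not_positive_weighted_sec[OF assms(5,11,12) dims]
      not_positive_strongly_weighted_sec[OF assms(11,12) _ _ dims] by blast
qed

end
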